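(* Let $M$ be the rank one Heisenberg VOA with generator $h$, let $\boldsymbol\alpha=(\alpha_1,\ldots,\alpha_g)\in\mathbb C^g$, and let $\gamma_1,\ldots,\gamma_m\in\mathbb C$ with $\sum_{j=1}^m\gamma_j=0$. For $n$ states $h$ inserted at $x_1,\ldots,x_n$ and states $e^{\gamma_j}\in M_{\gamma_j}$ inserted at $z_j$, $j=1,\ldots,m$, the genus $g$ correlation form satisfies $$\mathcal F_{M_{\boldsymbol\alpha}}(\boldsymbol h,\boldsymbol x;\boldsymbol{e^\gamma},\boldsymbol z)=\mathrm{Sym}_n(\omega,\nu_{\boldsymbol{\alpha,\gamma}})\,\mathcal F_{M_{\boldsymbol\alpha}}(\boldsymbol{e^\gamma},\boldsymbol z),$$ where $$\mathrm{Sym}_n(\omega,\nu_{\boldsymbol{\alpha,\gamma}})=\sum_\varphi\prod_q\nu_{\boldsymbol{\alpha,\gamma}}(x_q,\boldsymbol z)\prod_{(rs)}\omega(x_r,x_s),$$ the sum being over all inequivalent involutions $\varphi=(q)\cdots(rs)\cdots$ of the labels $\{1,\ldots,n\}$ (with the first product over the fixed points $q$ and the second over the 2-cycles $(rs)$ of $\varphi$).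
   Context: **Heisenberg VOA.** $M$ is the rank one Heisenberg VOA generated by $h\in M_1$ with modes $[h(m),h(n)]=m\delta_{m,-n}$, vacuum $\mathbf 1$, conformal vector $\frac12h(-1)h$. Its irreducible modules are $M_\alpha=M\otimes e^\alpha$, $\alpha\in\mathbb C$, with $h(0)(u\otimes e^\alpha)=\alpha\,u\otimes e^\alpha$, $h(n)(u\otimes e^\alpha)=(h(n)u)\otimes e^\alpha$ for $n\ne0$, and $u\otimes e^\alpha$ of weight $\mathrm{wt}(u)+\frac12\alpha^2$; $e^\alpha$ denotes $\mathbf 1\otimes e^\alpha$. The contragredient of $M_\alpha$ is $M_{-\alpha}$. Intertwiners exist only of type $\binom{\alpha+\beta}{\alpha\ \ \beta}$, forming a one-dimensional space; $\mathcal Y^{\alpha+\beta}_{\alpha\,\beta}$ denotes the chosen one (with $\mathcal Y^\beta_{0\beta}=Y_\beta$; $\mathcal Y^\alpha_{\alpha0}(v,z)u=e^{zL(-1)}Y_\alpha(u,-z)v$; $\langle u,\mathcal Y^0_{\alpha,-\alpha}(v,z)v'\rangle=\langle\mathcal Y^\alpha_{\alpha0}(e^{zL(1)}(-z^{-2})^{L(0)}v,z^{-1})u,v'\rangle$, the pairings being the invariant form on $M$ with $\langle\mathbf 1,\mathbf 1\rangle=1$ and the canonical pairing of $M_\alpha$ with $M_{-\alpha}$; the normalizations of the other types are fixed as in the Heisenberg generalized VOA). **Correlation forms.** Let $\mathcal I=\{\pm1,\ldots,\pm g\}$, with formal variables $w_a$ ($a\in\mathcal I$), $\rho_a=\rho_{-a}$.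 Let $\{b_a\}$ be a homogeneous basis of $M_{\alpha_a}$, $\{b_a'\}$ the dual basis of $M_{-\alpha_a}$, $b_{-a}=\rho_a^{\mathrm{wt}(b_a)}b_a'$ ($a=1,\ldots,g$). Then, writing $\mathcal Y(v,y)$ for the intertwiner acting between the uniquely determined modules, $$\mathcal F_{M_{\boldsymbol\alpha}}(\boldsymbol h,\boldsymbol x;\boldsymbol{e^\gamma},\boldsymbol z)=\sum_{b_1,\ldots,b_g}\Big\langle\mathbf 1,\prod_{i=1}^nY(h,x_i)\prod_{j=1}^m\mathcal Y(e^{\gamma_j},z_j)\prod_{a=1}^g\mathcal Y(b_a,w_a)\mathcal Y(b_{-a},w_{-a})\,\mathbf 1\Big\rangle\prod_idx_i\prod_jdz_j^{\gamma_j^2/2}$$ (ordered products, increasing index left to right), and $\mathcal F_{M_{\boldsymbol\alpha}}(\boldsymbol{e^\gamma},\boldsymbol z)$ is the same with no $h$ insertions. **Forms on the surface.** For Schottky parameters with $|w_a-w_b|>|\rho_a|^{1/2}+|\rho_b|^{1/2}$ ($a\ne b$ in $\mathcal I$), $\Gamma$ is the free (Schottky) group generated by $\gamma_az=w_{-a}+\rho_a/(z-w_a)$, $a=1,\ldots,g$, $\Omega_0$ the complement of its limit set in $\widehat{\mathbb C}$ and $\Omega_0/\Gamma$ the genus $g$ surface. With $A_0\in\Omega_0$, $$\Psi_1(x,y)=\sum_{\gamma\in\Gamma}\Big(\frac1{\gamma x-y}-\frac1{\gamma x-A_0}\Big)d(\gamma x),\quad\omega(x,y)=\partial_y\Psi_1(x,y)\,dy=\sum_{\gamma\in\Gamma}\frac{d(\gamma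 x)dy}{(\gamma x-y)^2},$$ $\nu_a(x)=\Psi_1(x,y)-\Psi_1(x,\gamma_ay)$ (the holomorphic differentials, independent of $y$), and $\omega_{y-z}(x)=\Psi_1(x,y)-\Psi_1(x,z)=\int_z^y\omega(x,\cdot)$. Then $$\nu_{\boldsymbol{\alpha,\gamma}}(x,\boldsymbol z)=\sum_{a=1}^g\alpha_a\nu_a(x)+\sum_{j=1}^m\gamma_j\,\omega_{z_j-z_0}(x)$$ for any $z_0$ (independent of $z_0$ since $\sum_j\gamma_j=0$). **Expansions in $\rho$.** The identity is formal, these forms being represented by their expansions in the $\rho_a$: with $\pi_1(x,y)=\frac1{x-y}-\frac1{x-A_0}$, $h^{(i,j)}=\frac1{i!j!}\partial_x^i\partial_y^jh$, $L_b^n(x)=\rho_b^{n/2}\pi_1^{(0,n)}(x,w_b)dx$, $R_a^m(y)=-\rho_a^{(m+1)/2}\pi_1^{(m,0)}(w_{-a},y)$, $A_{ab}^{mn}=-\rho_a^{(m+1)/2}\rho_b^{n/2}\pi_1^{(m,n)}(w_{-a},w_b)$ if $a\ne-b$, $A_{a,-a}^{mn}=-\rho_a^{(m+n+1)/2}\delta_{n,0}f_0^{(m)}(w_{-a})$ with $f_0(x)=-1/(x-A_0)$ and $f_0^{(m)}=\frac1{m!}\partial^mf_0$, $\Delta_{ab}^{mn}=\delta_{m,n+1}\delta_{ab}$ ($a,b\in\mathcal I$, $m,n\ge0$), $\widetilde L=L\Delta$, $\widetilde A=A\Delta$: $\Psi_1=\pi_1dx+\widetilde L(x)\sum_{k\ge0}\widetilde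 A^kR(y)$ and $\nu_a=T_a-T_{-a}$ with $T_a=\big(L+\widetilde L\sum_{k\ge0}\widetilde A^kA\big)_a^0$. *)

theory Defs
  imports
    "HOL-Analysis.Analysis"
    "HOL-Library.Multiset"
    "HOL-Library.Poly_Mapping"
    "HOL-Library.FuncSet"
    "HOL-Combinatorics.Permutations"
begin

section \<open>Formal series with complex exponents\<close>

text \<open>
  Monomials in formal variables \<open>v\<close> have complex exponents, finitely many of them nonzero.
  A linear order on the variables encodes the expansion convention: \<open>u < v\<close> means that series
  are expanded in the domain \<open>|u| > |v|\<close>, with \<open>v\<close> infinitely smaller than \<open>u\<close>. Accordingly a
  series is an iterated Laurent series (up to finitely many complex exponent shifts and half-integer
  steps): once the exponents of all smaller variables are fixed, the exponents of a variable are
  bounded below.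
\<close>

definition admissible :: "('v::linorder \<Rightarrow>\<^sub>0 complex) set \<Rightarrow> bool" where
  "admissible S \<longleftrightarrow>
     (\<exists>V. finite V \<and> (\<forall>e\<in>S. Poly_Mapping.keys e \<subseteq> V)) \<and>
     (\<forall>v c. \<exists>B. finite B \<and>
        (\<forall>e\<in>S. (\<forall>u>v. Poly_Mapping.lookup e u = c u) \<longrightarrow>
           (\<exists>b\<in>B. \<exists>k::nat. Poly_Mapping.lookup e v = b + of_nat k / 2)))"

lemma admissible_vars: "admissible S \<Longrightarrow> \<exists>V. finite V \<and> (\<forall>e\<in>S. Poly_Mapping.keys e \<subseteq> V)"
  unfolding admissible_def by (rule conjunct1)

lemma admissible_bound:
  assumes "admissible S"
  shows "\<exists>B. finite B \<and> (\<forall>e\<in>S. (\<forall>u>v. Poly_Mapping.lookup e u = c u) \<longrightarrow>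
           (\<exists>b\<in>B. \<exists>k::nat. Poly_Mapping.lookup e v = b + of_nat k / 2))"
  using assms[unfolded admissible_def, THEN conjunct2, THEN spec, THEN spec] .

lemma admissible_subset:
  assumes "admissible T" "S \<subseteq> T" shows "admissible S"
  unfolding admissible_def
proof (intro conjI allI)
  show "\<exists>V. finite V \<and> (\<forall>e\<in>S. Poly_Mapping.keys e \<subseteq> V)"
    using admissible_vars[OF assms(1)] assms(2) by fast
  show "\<exists>B. finite B \<and> (\<forall>e\<in>S. (\<forall>u>v. Poly_Mapping.lookup e u = c u) \<longrightarrow>
           (\<exists>b\<in>B. \<exists>k::nat. Poly_Mapping.lookup e v = b + of_nat k / 2))" for v c
    using admissible_bound[OF assms(1), of v c] assms(2) by fast
qed

lemma admissible_empty [simp]: "admissible {}"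
  unfolding admissible_def by auto

lemma admissible_singleton [simp]: "admissible {e}"
  unfolding admissible_def
proof (intro conjI allI)
  show "\<exists>V. finite V \<and> (\<forall>e\<in>{e}. Poly_Mapping.keys e \<subseteq> V)"
    by (rule exI[of _ "Poly_Mapping.keys e"]) simp
  show "\<exists>B. finite B \<and> (\<forall>e\<in>{e}. (\<forall>u>v. Poly_Mapping.lookup e u = c u) \<longrightarrow>
           (\<exists>b\<in>B. \<exists>k::nat. Poly_Mapping.lookup e v = b + of_nat k / 2))" for v c
    by (rule exI[of _ "{Poly_Mapping.lookup e v}"]) (auto intro: exI[of _ 0])
qed

lemma admissible_Un:
  assumes "admissible S" "admissible T" shows "admissible (S \<union> T)"
  unfolding admissible_def
proof (intro conjI allI)
  obtain V W where VW: "finite V" "\<forall>e\<in>S. Poly_Mapping.keys e \<subseteq> V"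
      "finite W" "\<forall>e\<in>T. Poly_Mapping.keys e \<subseteq> W"
    using admissible_vars[OF assms(1)] admissible_vars[OF assms(2)] by auto
  show "\<exists>V. finite V \<and> (\<forall>e\<in>S \<union> T. Poly_Mapping.keys e \<subseteq> V)"
    by (rule exI[of _ "V \<union> W"]) (use VW in auto)
next
  fix v c
  obtain B where B: "finite B"
    "\<forall>e\<in>S. (\<forall>u>v. Poly_Mapping.lookup e u = c u) \<longrightarrow>
         (\<exists>b\<in>B. \<exists>k::nat. Poly_Mapping.lookup e v = b + of_nat k / 2)"
    using admissible_bound[OF assms(1), of v c] by auto
  obtain C where C: "finite C"
    "\<forall>e\<in>T. (\<forall>u>v. Poly_Mapping.lookup e u = c u) \<longrightarrow>
         (\<exists>b\<in>C. \<exists>k::nat. Poly_Mapping.lookup e v = b + of_nat k / 2)"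
    using admissible_bound[OF assms(2), of v c] by auto
  show "\<exists>B. finite B \<and> (\<forall>e\<in>S \<union> T. (\<forall>u>v. Poly_Mapping.lookup e u = c u) \<longrightarrow>
           (\<exists>b\<in>B. \<exists>k::nat. Poly_Mapping.lookup e v = b + of_nat k / 2))"
    by (rule exI[of _ "B \<union> C"]) (use B C in \<open>simp add: Ball_def Bex_def, blast\<close>)
qed

lemma lookup_notin_keys: "Poly_Mapping.keys e \<subseteq> V \<Longrightarrow> u \<notin> V \<Longrightarrow> Poly_Mapping.lookup e u = 0"
  by (auto simp: Poly_Mapping.in_keys_iff)

lemma finite_half_pairs:
  fixes B C :: "complex set"
  assumes "finite B" "finite C"
  shows "finite {(x, y). (\<exists>b\<in>B. \<exists>k::nat. x = b + of_nat k / 2) \<and>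
           (\<exists>b\<in>C. \<exists>k::nat. y = b + of_nat k / 2) \<and> x + y = c}" (is "finite ?S")
proof -
  define K where "K b d = nat \<lfloor>Re (2 * (c - b - d))\<rfloor>" for b d
  let ?U = "\<Union>b\<in>B. \<Union>d\<in>C. (\<lambda>k::nat. (b + of_nat k / 2, c - (b + of_nat k / 2))) ` {..K b d}"
  have "?S \<subseteq> ?U"
  proof (rule subsetI)
    fix z assume "z \<in> ?S"
    then obtain b d :: complex and k l :: nat where
      h: "b \<in> B" "d \<in> C" "b + of_nat k / 2 + (d + of_nat l / 2) = c"
      and z: "z = (b + of_nat k / 2, d + of_nat l / 2)" by auto
    have "2 * (c - b - d) = of_nat (k + l)" by (simp add: h(3)[symmetric] algebra_simps)
    then have "K b d = k + l" unfolding K_def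
      by (metis Re_complex_of_real floor_of_nat nat_int of_real_of_nat_eq)
    then have "k \<in> {..K b d}" by simp
    moreover have "d + of_nat l / 2 = c - (b + of_nat k / 2)"
      using h(3) by (auto simp: algebra_simps)
    ultimately show "z \<in> ?U" unfolding z using h(1,2) by auto
  qed
  moreover have "finite ?U" using assms by auto
  ultimately show ?thesis by (rule finite_subset)
qed

lemma finite_restricted_pairs:
  fixes S T :: "('v::linorder \<Rightarrow>\<^sub>0 complex) set"
  assumes S: "admissible S" and T: "admissible T"
    and V: "\<forall>e\<in>S. Poly_Mapping.keys e \<subseteq> V" "\<forall>e\<in>T. Poly_Mapping.keys e \<subseteq> V"
    and "finite W" "W \<subseteq> V" "\<forall>u\<in>V. \<forall>w\<in>W. w < u \<longrightarrow> u \<in> W"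
  shows "finite ((\<lambda>(a, b). (\<lambda>u. if u \<in> W then Poly_Mapping.lookup a u else 0,
                            \<lambda>u. if u \<in> W then Poly_Mapping.lookup b u else 0)) `
            {(a, b). a \<in> S \<and> b \<in> T \<and>
               (\<forall>u\<in>W. Poly_Mapping.lookup a u + Poly_Mapping.lookup b u = c u)})"
  using assms(5-7)
proof (induction W rule: finite_linorder_min_induct)
  case empty
  have "(\<lambda>(a, b). (\<lambda>u. if u \<in> {} then Poly_Mapping.lookup a u else 0,
                            \<lambda>u. if u \<in> {} then Poly_Mapping.lookup b u else 0)) `
            {(a, b). a \<in> S \<and> b \<in> T \<and>
               (\<forall>u\<in>{}. Poly_Mapping.lookup a u + Poly_Mapping.lookup b u = c u)}
        \<subseteq> {(\<lambda>u. 0, \<lambda>u. 0)}" by auto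
  then show ?case by (rule finite_subset) simp
next
  case (insert v W)
  let ?r = "\<lambda>W a u. if u \<in> W then Poly_Mapping.lookup a u else (0::complex)"
  let ?P = "\<lambda>W. {(a, b). a \<in> S \<and> b \<in> T \<and>
               (\<forall>u\<in>W. Poly_Mapping.lookup a u + Poly_Mapping.lookup b u = c u)}"
  let ?F = "\<lambda>W. (\<lambda>(a, b). (?r W a, ?r W b)) ` ?P W"
  have vW: "v \<notin> W" using insert.hyps by auto
  have up: "\<forall>u\<in>V. \<forall>w\<in>W. w < u \<longrightarrow> u \<in> W"
    using insert.prems(2) insert.hyps(2) by (metis insert_iff order_less_asym)
  have fin: "finite (?F W)"
    using insert.IH insert.prems up by simp
  have big: "u \<in> W" if "v < u" "u \<in> V" for u
    using insert.prems(2) that by (metis insert_iff order_less_irrefl)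
  have lk: "Poly_Mapping.lookup a u = ?r W a u" if "a \<in> S \<or> a \<in> T" "v < u" for a u
    using that big V lookup_notin_keys[of a V u] by (cases "u \<in> V") auto
  have "\<forall>p. \<exists>B. finite B \<and> (\<forall>e\<in>S. (\<forall>u>v. Poly_Mapping.lookup e u = p u) \<longrightarrow>
           (\<exists>b\<in>B. \<exists>k::nat. Poly_Mapping.lookup e v = b + of_nat k / 2))"
    by (rule allI, rule admissible_bound[OF S])
  then obtain BS where BS: "\<And>p. finite (BS p)"
    "\<And>p e. e \<in> S \<Longrightarrow> (\<forall>u>v. Poly_Mapping.lookup e u = p u) \<Longrightarrow>
           (\<exists>b\<in>BS p. \<exists>k::nat. Poly_Mapping.lookup e v = b + of_nat k / 2)" by metis
  have "\<forall>p. \<exists>B. finite B \<and> (\<forall>e\<in>T. (\<forall>u>v. Poly_Mapping.lookup e u = p u) \<longrightarrow>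
           (\<exists>b\<in>B. \<exists>k::nat. Poly_Mapping.lookup e v = b + of_nat k / 2))"
    by (rule allI, rule admissible_bound[OF T])
  then obtain BT where BT: "\<And>p. finite (BT p)"
    "\<And>p e. e \<in> T \<Longrightarrow> (\<forall>u>v. Poly_Mapping.lookup e u = p u) \<Longrightarrow>
           (\<exists>b\<in>BT p. \<exists>k::nat. Poly_Mapping.lookup e v = b + of_nat k / 2)" by metis
  define G where "G p q = {(x, y). (\<exists>b\<in>BS p. \<exists>k::nat. x = b + of_nat k / 2) \<and>
           (\<exists>b\<in>BT q. \<exists>k::nat. y = b + of_nat k / 2) \<and> x + y = c v}" for p q
  have "finite (G p q)" for p q unfolding G_def by (rule finite_half_pairs) (use BS BT in auto)
  then have finU: "finite (\<Union>(p, q)\<in>?F W. (\<lambda>(x, y). (p(v := x), q(v := y))) ` G p q)"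
    by (intro finite_UN_I[OF fin]) auto
  have "?F (insert v W) \<subseteq> (\<Union>(p, q)\<in>?F W. (\<lambda>(x, y). (p(v := x), q(v := y))) ` G p q)"
  proof clarify
    fix a b assume ab: "a \<in> S" "b \<in> T"
      "\<forall>u\<in>insert v W. Poly_Mapping.lookup a u + Poly_Mapping.lookup b u = c u"
    have 1: "(?r W a, ?r W b) \<in> ?F W" using ab by (auto intro!: image_eqI[of _ _ "(a, b)"])
    have 2: "(Poly_Mapping.lookup a v, Poly_Mapping.lookup b v) \<in> G (?r W a) (?r W b)"
      unfolding G_def using ab BS(2)[OF ab(1), of "?r W a"] BT(2)[OF ab(2), of "?r W b"] lk by auto
    have 3: "?r (insert v W) a = (?r W a)(v := Poly_Mapping.lookup a v)"
      "?r (insert v W) b = (?r W b)(v := Poly_Mapping.lookup b v)" by auto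
    show "(?r (insert v W) a, ?r (insert v W) b)
        \<in> (\<Union>(p, q)\<in>?F W. (\<lambda>(x, y). (p(v := x), q(v := y))) ` G p q)"
      unfolding 3 by (rule UN_I[OF 1]) (use 2 in auto)
  qed
  then show ?case using finU by (rule finite_subset)
qed

lemma admissible_common_vars:
  assumes "admissible S" "admissible T"
  obtains V where "finite V" "\<forall>e\<in>S. Poly_Mapping.keys e \<subseteq> V" "\<forall>e\<in>T. Poly_Mapping.keys e \<subseteq> V"
proof -
  obtain V W where VW: "finite V" "\<forall>e\<in>S. Poly_Mapping.keys e \<subseteq> V"
      "finite W" "\<forall>e\<in>T. Poly_Mapping.keys e \<subseteq> W"
    using admissible_vars[OF assms(1)] admissible_vars[OF assms(2)] by auto
  show ?thesis by (rule that[of "V \<union> W"]) (use VW in auto)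
qed

lemma finite_sum_pairs:
  assumes "admissible S" "admissible T"
  shows "finite {(a, b). a \<in> S \<and> b \<in> T \<and> a + b = e}" (is "finite ?P")
proof -
  obtain V where V: "finite V" "\<forall>e\<in>S. Poly_Mapping.keys e \<subseteq> V" "\<forall>e\<in>T. Poly_Mapping.keys e \<subseteq> V"
    using admissible_common_vars[OF assms] .
  let ?r = "\<lambda>a u. if u \<in> V then Poly_Mapping.lookup a u else (0::complex)"
  have r: "?r a = Poly_Mapping.lookup a" if "a \<in> S \<or> a \<in> T" for a
    using that V lookup_notin_keys[of a V] by (auto simp: fun_eq_iff)
  have "finite ((\<lambda>(a, b). (?r a, ?r b)) ` {(a, b). a \<in> S \<and> b \<in> T \<and>
               (\<forall>u\<in>V. Poly_Mapping.lookup a u + Poly_Mapping.lookup b u = Poly_Mapping.lookup e u)})"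
    by (rule finite_restricted_pairs[OF assms V(2,3) V(1)]) auto
  then have "finite ((\<lambda>(a, b). (?r a, ?r b)) ` ?P)"
    by (rule rev_finite_subset) (auto simp: lookup_add)
  moreover have "inj_on (\<lambda>(a, b). (?r a, ?r b)) ?P"
  proof (rule inj_onI, clarify)
    fix a b a' b' assume *: "a \<in> S" "b \<in> T" "a' \<in> S" "b' \<in> T" "?r a = ?r a'" "?r b = ?r b'"
    from * have "Poly_Mapping.lookup a = Poly_Mapping.lookup a'"
      "Poly_Mapping.lookup b = Poly_Mapping.lookup b'" using r by metis+
    then show "a = a' \<and> b = b'" by (simp add: poly_mapping_eqI)
  qed
  ultimately show ?thesis by (rule finite_imageD)
qed

lemma admissible_plus:
  assumes "admissible S" "admissible T"
  shows "admissible {a + b | a b. a \<in> S \<and> b \<in> T}"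
proof -
  obtain V where V: "finite V" "\<forall>e\<in>S. Poly_Mapping.keys e \<subseteq> V" "\<forall>e\<in>T. Poly_Mapping.keys e \<subseteq> V"
    using admissible_common_vars[OF assms] .
  have 1: "\<exists>V. finite V \<and> (\<forall>e\<in>{a + b | a b. a \<in> S \<and> b \<in> T}. Poly_Mapping.keys e \<subseteq> V)"
    using V by (intro exI[of _ V]) (auto dest!: subsetD[OF Poly_Mapping.keys_add])
  have 2: "\<exists>B. finite B \<and>
        (\<forall>e\<in>{a + b | a b. a \<in> S \<and> b \<in> T}. (\<forall>u>v. Poly_Mapping.lookup e u = c u) \<longrightarrow>
           (\<exists>b\<in>B. \<exists>k::nat. Poly_Mapping.lookup e v = b + of_nat k / 2))" for v c
  proof -
    define W where "W = {u\<in>V. v < u}"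
    let ?r = "\<lambda>a u. if u \<in> W then Poly_Mapping.lookup a u else (0::complex)"
    let ?F = "(\<lambda>(a, b). (?r a, ?r b)) ` {(a, b). a \<in> S \<and> b \<in> T \<and>
               (\<forall>u\<in>W. Poly_Mapping.lookup a u + Poly_Mapping.lookup b u = c u)}"
    have fin: "finite ?F"
      by (rule finite_restricted_pairs[OF assms V(2,3)]) (use V(1) in \<open>auto simp: W_def\<close>)
    have lk: "Poly_Mapping.lookup a u = ?r a u" if "a \<in> S \<or> a \<in> T" "v < u" for a u
      using that V lookup_notin_keys[of a V u] by (cases "u \<in> V") (auto simp: W_def)
    have "\<forall>p. \<exists>B. finite B \<and> (\<forall>e\<in>S. (\<forall>u>v. Poly_Mapping.lookup e u = p u) \<longrightarrow>
             (\<exists>b\<in>B. \<exists>k::nat. Poly_Mapping.lookup e v = b + of_nat k / 2))"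
      by (rule allI, rule admissible_bound[OF assms(1)])
    then obtain BS where BS: "\<And>p. finite (BS p)"
      "\<And>p e. e \<in> S \<Longrightarrow> (\<forall>u>v. Poly_Mapping.lookup e u = p u) \<Longrightarrow>
             (\<exists>b\<in>BS p. \<exists>k::nat. Poly_Mapping.lookup e v = b + of_nat k / 2)" by metis
    have "\<forall>p. \<exists>B. finite B \<and> (\<forall>e\<in>T. (\<forall>u>v. Poly_Mapping.lookup e u = p u) \<longrightarrow>
             (\<exists>b\<in>B. \<exists>k::nat. Poly_Mapping.lookup e v = b + of_nat k / 2))"
      by (rule allI, rule admissible_bound[OF assms(2)])
    then obtain BT where BT: "\<And>p. finite (BT p)"
      "\<And>p e. e \<in> T \<Longrightarrow> (\<forall>u>v. Poly_Mapping.lookup e u = p u) \<Longrightarrow>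
             (\<exists>b\<in>BT p. \<exists>k::nat. Poly_Mapping.lookup e v = b + of_nat k / 2)" by metis
    define B where "B = (\<Union>(p, q)\<in>?F. (\<lambda>(x, y). x + y) ` (BS p \<times> BT q))"
    have "finite B" unfolding B_def by (intro finite_UN_I[OF fin]) (use BS(1) BT(1) in auto)
    moreover have "\<exists>d\<in>B. \<exists>k::nat. Poly_Mapping.lookup (a + b) v = d + of_nat k / 2"
      if ab: "a \<in> S" "b \<in> T" "\<forall>u>v. Poly_Mapping.lookup (a + b) u = c u" for a b
    proof -
      have F: "(?r a, ?r b) \<in> ?F"
        using ab by (auto intro!: image_eqI[of _ _ "(a, b)"] simp: W_def lookup_add)
      obtain x k where x: "x \<in> BS (?r a)" "Poly_Mapping.lookup a v = x + of_nat k / 2"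
        using BS(2)[OF ab(1), of "?r a"] lk ab by blast
      obtain y l where y: "y \<in> BT (?r b)" "Poly_Mapping.lookup b v = y + of_nat l / 2"
        using BT(2)[OF ab(2), of "?r b"] lk ab by blast
      have "x + y \<in> B" unfolding B_def by (rule UN_I[OF F]) (use x y in auto)
      moreover have "Poly_Mapping.lookup (a + b) v = (x + y) + of_nat (k + l) / 2"
        using x y by (simp add: lookup_add field_simps)
      ultimately show ?thesis by blast
    qed
    ultimately show ?thesis by (intro exI[of _ B]) auto
  qed
  show ?thesis unfolding admissible_def using 1 2 by blast
qed

typedef (overloaded) 'v fseries = "{f :: ('v::linorder \<Rightarrow>\<^sub>0 complex) \<Rightarrow> complex. admissible {e. f e \<noteq> 0}}"
  morphisms fcoeff series
  by (rule exI[of _ "\<lambda>_. 0"]) simp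

lemma admissible_fcoeff: "admissible {e. fcoeff f e \<noteq> 0}"
  using fcoeff by auto

lemma fseries_eqI:
  fixes f g :: "'v::linorder fseries"
  shows "(\<And>e. fcoeff f e = fcoeff g e) \<Longrightarrow> f = g"
  by (simp add: fcoeff_inject[symmetric] fun_eq_iff)

lemma fcoeff_series: "admissible {e. f e \<noteq> 0} \<Longrightarrow> fcoeff (series f) = f"
  by (simp add: series_inverse)

definition conv_pairs where
  "conv_pairs f g e = {(a, b). fcoeff f a \<noteq> 0 \<and> fcoeff g b \<noteq> 0 \<and> a + b = e}"

lemma finite_conv_pairs [simp]: "finite (conv_pairs f g e)"
  using finite_sum_pairs[OF admissible_fcoeff[of f] admissible_fcoeff[of g], of e]
  by (simp add: conv_pairs_def)

instantiation fseries :: (linorder) comm_ring_1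
begin

definition "0 = series (\<lambda>_. 0)"
definition "1 = series (\<lambda>e. if e = 0 then 1 else 0)"
definition "f + g = series (\<lambda>e. fcoeff f e + fcoeff g e)"
definition "- f = series (\<lambda>e. - fcoeff f e)"
definition "(f :: 'a fseries) - g = f + (- g)"
definition "f * g = series (\<lambda>e. \<Sum>(a, b)\<in>conv_pairs f g e. fcoeff f a * fcoeff g b)"

lemma fcoeff_0 [simp]: "fcoeff 0 e = 0"
  by (simp add: zero_fseries_def fcoeff_series)

lemma fcoeff_1: "fcoeff 1 e = (if e = 0 then 1 else 0)"
  by (simp add: one_fseries_def fcoeff_series)

lemma fcoeff_add [simp]: "fcoeff (f + g) e = fcoeff f e + fcoeff g e"
proof -
  have "admissible {e. fcoeff f e + fcoeff g e \<noteq> 0}"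
    by (rule admissible_subset[OF admissible_Un[OF admissible_fcoeff[of f] admissible_fcoeff[of g]]])
       auto
  then show ?thesis by (simp add: plus_fseries_def fcoeff_series)
qed

lemma fcoeff_uminus [simp]: "fcoeff (- f) e = - fcoeff f e"
  by (simp add: uminus_fseries_def fcoeff_series admissible_fcoeff)

lemma fcoeff_mult: "fcoeff (f * g) e = (\<Sum>(a, b)\<in>conv_pairs f g e. fcoeff f a * fcoeff g b)"
proof -
  have "{e. (\<Sum>(a, b)\<in>conv_pairs f g e. fcoeff f a * fcoeff g b) \<noteq> 0} \<subseteq>
      {a + b | a b. a \<in> {e. fcoeff f e \<noteq> 0} \<and> b \<in> {e. fcoeff g e \<noteq> 0}}" (is "?A \<subseteq> ?B")
  proof
    fix e assume "e \<in> ?A"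
    then have "conv_pairs f g e \<noteq> {}" by auto
    then show "e \<in> ?B" by (auto simp: conv_pairs_def)
  qed
  then have "admissible ?A"
    using admissible_plus[OF admissible_fcoeff[of f] admissible_fcoeff[of g]] admissible_subset by blast
  then show ?thesis by (simp add: times_fseries_def fcoeff_series)
qed

lemma fcoeff_mult_superset:
  assumes "finite P" "conv_pairs f g e \<subseteq> P" "\<And>a b. (a, b) \<in> P \<Longrightarrow> a + b = e"
  shows "fcoeff (f * g) e = (\<Sum>(a, b)\<in>P. fcoeff f a * fcoeff g b)"
  unfolding fcoeff_mult
  by (rule sum.mono_neutral_left) (use assms in \<open>auto simp: conv_pairs_def\<close>)

lemma fseries_mult_commute: "f * g = g * (f :: 'a fseries)"
proof (rule fseries_eqI)
  fix e
  have "(\<Sum>(a, b)\<in>conv_pairs f g e. fcoeff f a * fcoeff g b) =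
        (\<Sum>(a, b)\<in>conv_pairs g f e. fcoeff g a * fcoeff f b)"
    by (rule sum.reindex_bij_witness[of _ prod.swap prod.swap])
       (auto simp: conv_pairs_def add.commute mult.commute)
  then show "fcoeff (f * g) e = fcoeff (g * f) e" by (simp add: fcoeff_mult)
qed

definition conv_triples where
  "conv_triples f g h e =
     {(a, b, c). fcoeff f a \<noteq> 0 \<and> fcoeff g b \<noteq> 0 \<and> fcoeff h c \<noteq> 0 \<and> a + b + c = e}"

lemma finite_conv_triples: "finite (conv_triples f g h e)"
proof -
  let ?T = "{a + b | a b. a \<in> {e. fcoeff f e \<noteq> 0} \<and> b \<in> {e. fcoeff g e \<noteq> 0}}"
  let ?P = "{(d, c). d \<in> ?T \<and> c \<in> {e. fcoeff h e \<noteq> 0} \<and> d + c = e}"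
  have "finite ?P"
    by (rule finite_sum_pairs[OF admissible_plus[OF admissible_fcoeff admissible_fcoeff] admissible_fcoeff])
  moreover have "conv_triples f g h e \<subseteq> (\<Union>(d, c)\<in>?P. (\<lambda>(a, b). (a, b, c)) ` conv_pairs f g d)"
    by (fastforce simp: conv_triples_def conv_pairs_def)
  ultimately show ?thesis by (rule_tac finite_subset) auto
qed

lemma fcoeff_mult3:
  "fcoeff (f * g * h) e = (\<Sum>(a, b, c)\<in>conv_triples f g h e. fcoeff f a * fcoeff g b * fcoeff h c)"
proof -
  let ?T = "conv_triples f g h e" and ?m = "\<lambda>(a, b, c). (a + b, c)"
  let ?t = "\<lambda>(a, b, c). fcoeff f a * fcoeff g b * fcoeff h c"
  have "fcoeff (f * g * h) e = (\<Sum>(d, c)\<in>?m ` ?T. fcoeff (f * g) d * fcoeff h c)"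
  proof (rule fcoeff_mult_superset)
    show "conv_pairs (f * g) h e \<subseteq> ?m ` ?T"
    proof clarify
      fix d c assume "(d, c) \<in> conv_pairs (f * g) h e"
      then have *: "fcoeff (f * g) d \<noteq> 0" "fcoeff h c \<noteq> 0" "d + c = e" by (auto simp: conv_pairs_def)
      from *(1) have "conv_pairs f g d \<noteq> {}" by (auto simp: fcoeff_mult)
      then obtain a b where "fcoeff f a \<noteq> 0" "fcoeff g b \<noteq> 0" "a + b = d"
        by (auto simp: conv_pairs_def)
      then show "(d, c) \<in> ?m ` ?T"
        using * by (auto simp: conv_triples_def intro!: image_eqI[of _ _ "(a, b, c)"])
    qed
  next
    show "finite (?m ` ?T)" by (rule finite_imageI[OF finite_conv_triples])
  qed (auto simp: conv_triples_def)
  also have "\<dots> = (\<Sum>y\<in>?m ` ?T. \<Sum>x\<in>{x\<in>?T. ?m x = y}. ?t x)"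
  proof (rule sum.cong[OF refl], clarify)
    fix a b c assume abc: "(a, b, c) \<in> ?T"
    have "fcoeff (f * g) (a + b) * fcoeff h c =
        (\<Sum>(x, y)\<in>conv_pairs f g (a + b). fcoeff f x * fcoeff g y * fcoeff h c)"
      by (simp add: fcoeff_mult sum_distrib_right case_prod_beta)
    also have "\<dots> = (\<Sum>x\<in>{x\<in>?T. ?m x = (a + b, c)}. ?t x)"
      by (rule sum.reindex_bij_witness[of _ "\<lambda>(x, y, z). (x, y)" "\<lambda>(x, y). (x, y, c)"])
         (use abc in \<open>auto simp: conv_triples_def conv_pairs_def\<close>)
    finally show "fcoeff (f * g) (a + b) * fcoeff h c = \<dots>" .
  qed
  also have "\<dots> = (\<Sum>x\<in>?T. ?t x)"
    by (rule sum.image_gen[OF finite_conv_triples, symmetric])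
  finally show ?thesis .
qed

instance
proof
  fix f g h :: "'a fseries"
  have "f * g * h = g * h * f"
  proof (rule fseries_eqI, unfold fcoeff_mult3)
    fix e
    show "(\<Sum>(a, b, c)\<in>conv_triples f g h e. fcoeff f a * fcoeff g b * fcoeff h c) =
          (\<Sum>(a, b, c)\<in>conv_triples g h f e. fcoeff g a * fcoeff h b * fcoeff f c)"
      by (rule sum.reindex_bij_witness[of _ "\<lambda>(b, c, a). (a, b, c)" "\<lambda>(a, b, c). (b, c, a)"])
         (auto simp: conv_triples_def ac_simps)
  qed
  then show "f * g * h = f * (g * h)" by (metis fseries_mult_commute)
  show "f * g = g * f" by (rule fseries_mult_commute)
  show "1 * f = f"
  proof (rule fseries_eqI)
    fix e
    have "fcoeff (1 * f) e = (\<Sum>(a, b)\<in>{(0, e)}. fcoeff 1 a * fcoeff f b)"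
      by (rule fcoeff_mult_superset) (auto simp: conv_pairs_def fcoeff_1 split: if_splits)
    then show "fcoeff (1 * f) e = fcoeff f e" by (simp add: fcoeff_1)
  qed
  show "(f + g) * h = f * h + g * h"
  proof (rule fseries_eqI)
    fix e
    let ?P = "conv_pairs f h e \<union> conv_pairs g h e \<union> conv_pairs (f + g) h e"
    have "fcoeff (u * h) e = (\<Sum>(a, b)\<in>?P. fcoeff u a * fcoeff h b)" if "u \<in> {f, g, f + g}" for u
    proof (rule fcoeff_mult_superset)
      show "finite ?P" by simp
    qed (use that in \<open>auto simp: conv_pairs_def\<close>)
    then have "fcoeff (f * h) e = (\<Sum>(a, b)\<in>?P. fcoeff f a * fcoeff h b)"
      "fcoeff (g * h) e = (\<Sum>(a, b)\<in>?P. fcoeff g a * fcoeff h b)"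
      "fcoeff ((f + g) * h) e = (\<Sum>(a, b)\<in>?P. fcoeff (f + g) a * fcoeff h b)" by auto
    then show "fcoeff ((f + g) * h) e = fcoeff (f * h + g * h) e"
      by (simp add: sum.distrib[symmetric] case_prod_beta algebra_simps)
  qed
  show "(0 :: 'a fseries) \<noteq> 1"
    by (metis fcoeff_0 fcoeff_1 zero_neq_one)
qed (auto intro!: fseries_eqI simp: minus_fseries_def)

end

text \<open>The monomial \<open>c v\<^sup>p\<close>, and the constant \<open>c\<close>.\<close>

definition vpow :: "'v::linorder \<Rightarrow> complex \<Rightarrow> 'v fseries" where
  "vpow v p = series (\<lambda>e. if e = Poly_Mapping.single v p then 1 else 0)"

definition fconst :: "complex \<Rightarrow> 'v::linorder fseries" where
  "fconst c = series (\<lambda>e. if e = 0 then c else 0)"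

text \<open>The formal partial derivative with respect to \<open>v\<close>.\<close>

definition pd :: "'v::linorder \<Rightarrow> 'v fseries \<Rightarrow> 'v fseries" where
  "pd v f = series (\<lambda>e. (Poly_Mapping.lookup e v + 1) * fcoeff f (e + Poly_Mapping.single v 1))"

text \<open>
  Infinite formal sums are taken coefficientwise; as usual in formal calculus they are only
  meaningful if each coefficient receives finitely many nonzero contributions.
\<close>

definition formal_sum :: "('i \<Rightarrow> 'v::linorder fseries) \<Rightarrow> 'i set \<Rightarrow> 'v fseries" where
  "formal_sum F I = series (\<lambda>e. \<Sum>i | i \<in> I \<and> fcoeff (F i) e \<noteq> 0. fcoeff (F i) e)"

text \<open>The expansion of \<open>1/(u - v)\<close> in the domain prescribed by the order of the variables.\<close>

definition recip_diff :: "'v::linorder \<Rightarrow> 'v \<Rightarrow> 'v fseries" where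
  "recip_diff u v =
     (if u < v then formal_sum (\<lambda>k::nat. vpow u (- of_nat k - 1) * vpow v (of_nat k)) UNIV
      else - formal_sum (\<lambda>k::nat. vpow v (- of_nat k - 1) * vpow u (of_nat k)) UNIV)"


section \<open>The formal variables\<close>

text \<open>
  \<open>X i\<close>, \<open>Z j\<close> and \<open>W a\<close> are the insertion points, \<open>Rho a\<close> the sewing parameters (\<open>\<rho>\<^sub>-\<^sub>a = \<rho>\<^sub>a\<close>) and
  \<open>A0\<close> the auxiliary point \<open>A\<^sub>0\<close>, on which none of the forms \<open>\<omega>\<close>, \<open>\<nu>\<^sub>a\<close>, \<open>\<omega>\<^sub>y\<^sub>-\<^sub>z\<close> depends. \<open>DX i\<close> and \<open>DZ j\<close>
  are the symbols \<open>dx\<^sub>i\<close> and \<open>dz\<^sub>j\<close>. The expansion order is that of the operator products: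
  \<open>|A\<^sub>0| > |x\<^sub>1| > |x\<^sub>2| > \<dots> > |z\<^sub>1| > |z\<^sub>2| > \<dots> > |w\<^sub>1| > |w\<^sub>-\<^sub>1| > |w\<^sub>2| > |w\<^sub>-\<^sub>2| > \<dots>\<close>, and all sewing parameters
  are smaller than any of these.
\<close>

datatype var = A0 | X nat | Z nat | W int | Rho nat | DX nat | DZ nat

fun var_class :: "var \<Rightarrow> nat" where
  "var_class A0 = 0"
| "var_class (X i) = 1"
| "var_class (Z j) = 2"
| "var_class (W a) = 3"
| "var_class (Rho a) = 4"
| "var_class (DX i) = 5"
| "var_class (DZ j) = 6"

fun var_index :: "var \<Rightarrow> nat" where
  "var_index A0 = 0"
| "var_index (X i) = i"
| "var_index (Z j) = j"
| "var_index (W a) = (if a > 0 then 2 * nat a else 2 * nat (- a) + 1)"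
| "var_index (Rho a) = a"
| "var_index (DX i) = i"
| "var_index (DZ j) = j"

lemma var_eqI: "var_class u = var_class v \<Longrightarrow> var_index u = var_index v \<Longrightarrow> u = v"
  apply (cases u; cases v)
                      apply (auto split: if_splits)
   apply (metis dvd_triv_left even_Suc)+
  done

instantiation var :: linorder
begin

definition "u \<le> v \<longleftrightarrow> var_class u < var_class v \<or>
  var_class u = var_class v \<and> var_index u \<le> var_index v"
definition "u < v \<longleftrightarrow> var_class u < var_class v \<or>
  var_class u = var_class v \<and> var_index u < var_index v"

instance
  by standard (auto simp: less_eq_var_def less_var_def intro: var_eqI)

end


section \<open>The Heisenberg vertex operator algebra and its modules\<close>

text \<open>
  \<open>M\<close> is the polynomial algebra in \<open>h(-1), h(-2), \<dots>\<close>; the multiset \<open>{#i\<^sub>1, \<dots>, i\<^sub>k#}\<close> stands for the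
  monomial \<open>h(-i\<^sub>1-1) \<cdots> h(-i\<^sub>k-1)\<one>\<close>, so \<open>1\<close> is the vacuum. All modules \<open>M\<^sub>\<alpha> = M \<otimes> e\<^sup>\<alpha>\<close> live on this
  space, \<open>u\<close> standing for \<open>u \<otimes> e\<^sup>\<alpha>\<close>; the charge \<open>\<alpha>\<close> is passed as a parameter.
\<close>

type_synonym fock = "nat multiset \<Rightarrow>\<^sub>0 complex"

definition fscale :: "complex \<Rightarrow> fock \<Rightarrow> fock" where
  "fscale c v = Poly_Mapping.single {#} c * v"

interpretation fock: vector_space fscale
proof
  have 1: "Poly_Mapping.single {#} (1::complex) = 1"
    using single_one[where 'a = "nat multiset" and 'b = complex] by simp
  have m: "Poly_Mapping.single {#} (a * b) = Poly_Mapping.single {#} a * Poly_Mapping.single {#} (b::complex)"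
    for a b by (simp add: mult_single)
  fix a b :: complex and x y :: fock
  show "fscale a (x + y) = fscale a x + fscale a y" by (simp add: fscale_def distrib_left)
  show "fscale (a + b) x = fscale a x + fscale b x"
    by (simp add: fscale_def single_add distrib_right)
  show "fscale a (fscale b x) = fscale (a * b) x" by (simp add: fscale_def m mult.assoc)
  show "fscale 1 x = x" by (simp add: fscale_def 1)
qed

text \<open>The operator \<open>h(n)\<close> on \<open>M\<^sub>\<beta>\<close>; for \<open>n > 0\<close> it is \<open>n \<partial>/\<partial>h(-n)\<close>.\<close>

definition heis :: "complex \<Rightarrow> int \<Rightarrow> fock \<Rightarrow> fock" where
  "heis \<beta> n v =
     (if n < 0 then Poly_Mapping.single {#nat (- n) - 1#} 1 * v
      else if n = 0 then fscale \<beta> v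
      else (\<Sum>\<mu>\<in>Poly_Mapping.keys v. Poly_Mapping.single (\<mu> - {#nat n - 1#})
              (of_int n * of_nat (count \<mu> (nat n - 1)) * Poly_Mapping.lookup v \<mu>)))"

text \<open>
  \<open>vertex \<beta> u k\<close> is the mode \<open>u\<^sub>(\<^sub>k\<^sub>)\<close> in \<open>Y\<^sub>\<beta>(u,z) = \<Sum>\<^sub>k u\<^sub>(\<^sub>k\<^sub>) z\<^sup>-\<^sup>k\<^sup>-\<^sup>1\<close> on \<open>M\<^sub>\<beta>\<close>. With \<open>N = i + 1\<close>, the recursion is
  \<open>Y(h(-N)u,z) = :\<partial>\<^sup>(\<^sup>N\<^sup>-\<^sup>1\<^sup>)h(z) Y(u,z):\<close>, i.e.
  \<open>(h(-N)u)\<^sub>(\<^sub>k\<^sub>) = \<Sum>\<^sub>j binom(N-1+j, j) (h(-N-j) u\<^sub>(\<^sub>k\<^sub>+\<^sub>j\<^sub>) - (-1)\<^sup>N u\<^sub>(\<^sub>k\<^sub>-\<^sub>N\<^sub>-\<^sub>j\<^sub>) h(j))\<close>.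
\<close>

primrec vertex_mono :: "complex \<Rightarrow> nat list \<Rightarrow> int \<Rightarrow> fock \<Rightarrow> fock" where
  "vertex_mono \<beta> [] k v = (if k = - 1 then v else 0)"
| "vertex_mono \<beta> (i # ns) k v =
     Sum_any (\<lambda>j::nat. fscale (of_nat ((i + j) choose j))
       (heis \<beta> (- int (i + 1) - int j) (vertex_mono \<beta> ns (k + int j) v) +
        fscale ((- 1) ^ i) (vertex_mono \<beta> ns (k - int (i + 1) - int j) (heis \<beta> (int j) v))))"

definition vertex :: "complex \<Rightarrow> fock \<Rightarrow> int \<Rightarrow> fock \<Rightarrow> fock" where
  "vertex \<beta> u k v = (\<Sum>\<mu>\<in>Poly_Mapping.keys u.
     fscale (Poly_Mapping.lookup u \<mu>) (vertex_mono \<beta> (sorted_list_of_multiset \<mu>) k v))"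

definition h_state :: fock where
  "h_state = Poly_Mapping.single {#0#} 1"

definition conformal_vector :: fock where
  "conformal_vector = Poly_Mapping.single {#0, 0#} (1 / 2)"

definition virasoro :: "complex \<Rightarrow> int \<Rightarrow> fock \<Rightarrow> fock" where
  "virasoro \<beta> n = vertex \<beta> conformal_vector (n + 1)"

text \<open>
  Degree in \<open>M\<close>: \<open>u \<otimes> e\<^sup>\<alpha>\<close> has weight \<open>k + \<alpha>\<^sup>2/2\<close> if \<open>u\<close> is homogeneous of degree \<open>k\<close>.
\<close>

definition homogeneous :: "nat \<Rightarrow> fock \<Rightarrow> bool" where
  "homogeneous k v \<longleftrightarrow> (\<forall>\<mu>\<in>Poly_Mapping.keys v. (\<Sum>i\<in>#\<mu>. Suc i) = k)"

definition fdegree :: "fock \<Rightarrow> nat" where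
  "fdegree v = (THE k. homogeneous k v)"

definition homogeneous_basis :: "fock set \<Rightarrow> bool" where
  "homogeneous_basis B \<longleftrightarrow>
     \<not> fock.dependent B \<and> fock.span B = UNIV \<and> (\<forall>b\<in>B. \<exists>k. homogeneous k b)"

text \<open>
  The canonical pairing of \<open>M\<^sub>\<alpha>\<close> with \<open>M\<^sub>-\<^sub>\<alpha>\<close> (the invariant form on \<open>M\<close> if \<open>\<alpha> = 0\<close>), normalised by
  \<open>\<langle>e\<^sup>\<alpha>, e\<^sup>-\<^sup>\<alpha>\<rangle> = 1\<close>. Invariance means that \<open>h(n)\<close> is adjoint to \<open>- h(-n)\<close>, which gives the
  same formula for all \<open>\<alpha>\<close>.
\<close>

definition pairing :: "fock \<Rightarrow> fock \<Rightarrow> complex" where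
  "pairing u v = (\<Sum>\<mu>\<in>Poly_Mapping.keys u. Poly_Mapping.lookup u \<mu> * Poly_Mapping.lookup v \<mu> *
     (\<Prod>i\<in>set_mset \<mu>. (- of_nat (i + 1)) ^ count \<mu> i * fact (count \<mu> i)))"

definition dual_vector :: "fock set \<Rightarrow> fock \<Rightarrow> fock" where
  "dual_vector B b = (THE v. \<forall>c\<in>B. pairing v c = (if c = b then 1 else 0))"


section \<open>Intertwiners\<close>

text \<open>
  An intertwiner of type \<open>(\<alpha>+\<beta>; \<alpha> \<beta>)\<close> is given by its modes: \<open>\<Y>(v,z)w = \<Sum>\<^sub>s J v s w z\<^sup>-\<^sup>s\<^sup>-\<^sup>1\<close>,
  \<open>s \<in> \<complex>\<close>. The last clause is the Jacobi identity in component form.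
\<close>

definition intertwiner :: "complex \<Rightarrow> complex \<Rightarrow> (fock \<Rightarrow> complex \<Rightarrow> fock \<Rightarrow> fock) \<Rightarrow> bool" where
  "intertwiner \<alpha> \<beta> J \<longleftrightarrow>
     (\<forall>s w. Vector_Spaces.linear fscale fscale (\<lambda>v. J v s w)) \<and>
     (\<forall>v s. Vector_Spaces.linear fscale fscale (J v s)) \<and>
     (\<forall>v w. \<exists>K::real. \<forall>s. Re s > K \<longrightarrow> J v s w = 0) \<and>
     (\<forall>v s w. J (virasoro \<alpha> (- 1) v) s w = fscale (- s) (J v (s - 1) w)) \<and>
     (\<forall>u v w (l::int) (m::int) s.
        Sum_any (\<lambda>i::nat. fscale (of_int m gchoose i)
          (J (vertex \<alpha> u (l + int i) v) (of_int m + s - of_nat i) w)) =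
        Sum_any (\<lambda>i::nat. fscale ((- 1) ^ i * (of_int l gchoose i))
          (vertex (\<alpha> + \<beta>) u (m + l - int i) (J v (s + of_nat i) w) -
           fscale ((- 1) powi l)
             (J v (of_int l + s - of_nat i) (vertex \<beta> u (m + int i) w)))))"

text \<open>
  A choice of a spanning intertwiner \<open>\<Y> \<alpha> \<beta>\<close> for every type \<open>(\<alpha>+\<beta>; \<alpha> \<beta>)\<close>, normalised by
  \<open>\<Y>(v,z) = Y\<^sub>\<beta>(v,z)\<close> if \<open>\<alpha> = 0\<close>, by \<open>\<Y>(v,z)u = e\<^sup>z\<^sup>L\<^sup>(\<^sup>-\<^sup>1\<^sup>)Y\<^sub>\<alpha>(u,-z)v\<close> if \<open>\<beta> = 0\<close>, and by
  \<open>\<langle>u, \<Y>(v,z)v'\<rangle> = \<langle>\<Y>(e\<^sup>z\<^sup>L\<^sup>(\<^sup>1\<^sup>)(-z\<^sup>-\<^sup>2)\<^sup>L\<^sup>(\<^sup>0\<^sup>)v, z\<^sup>-\<^sup>1)u, v'\<rangle>\<close> if \<open>\<beta> = -\<alpha>\<close>, each written out in modes. Here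
  \<open>(-z\<^sup>-\<^sup>2)\<^sup>\<Delta> = e\<^sup>i\<^sup>\<pi>\<^sup>N\<^sup>\<Delta> z\<^sup>-\<^sup>2\<^sup>\<Delta>\<close> for some fixed determination, i.e. an odd integer \<open>N\<close>. The scalars of all other
  types are left arbitrary.
\<close>

definition heisenberg_intertwiners ::
  "(complex \<Rightarrow> complex \<Rightarrow> fock \<Rightarrow> complex \<Rightarrow> fock \<Rightarrow> fock) \<Rightarrow> bool" where
  "heisenberg_intertwiners \<Y> \<longleftrightarrow>
     (\<forall>\<alpha> \<beta>. intertwiner \<alpha> \<beta> (\<Y> \<alpha> \<beta>) \<and> (\<exists>v s w. \<Y> \<alpha> \<beta> v s w \<noteq> 0)) \<and>
     (\<forall>\<beta> u w (k::int). \<Y> 0 \<beta> u (of_int k) w = vertex \<beta> u k w) \<and>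
     (\<forall>\<alpha> v u (k::int). \<Y> \<alpha> 0 v (of_int k) u =
        Sum_any (\<lambda>i::nat. fscale ((- 1) powi (k + int i + 1) / fact i)
          ((virasoro \<alpha> (- 1) ^^ i) (vertex \<alpha> u (k + int i) v)))) \<and>
     (\<forall>\<alpha> \<beta> v s w. \<alpha> = 0 \<or> \<beta> = 0 \<longrightarrow> s \<notin> \<int> \<longrightarrow> \<Y> \<alpha> \<beta> v s w = 0) \<and>
     (\<exists>N::int. odd N \<and> (\<forall>\<alpha> u v v' s k. homogeneous k v \<longrightarrow>
        (let \<Delta> = of_nat k + \<alpha>\<^sup>2 / 2 in
          pairing u (\<Y> \<alpha> (- \<alpha>) v s v') =
          exp (\<i> * pi * of_int N * \<Delta>) *
          (\<Sum>i\<le>k. pairing (\<Y> \<alpha> 0 ((virasoro \<alpha> 1 ^^ i) v) (2 * \<Delta> - of_nat i - s - 2) u) v' / fact i))))"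


section \<open>Correlation forms\<close>

text \<open>
  An entry \<open>(y, \<alpha>, v)\<close> of a list stands for the operator \<open>\<Y>(v, y)\<close> with \<open>v \<in> M\<^sub>\<alpha>\<close>; it acts on the
  module whose charge is the total charge of the operators to its right.
\<close>

type_synonym insertion = "var \<times> complex \<times> fock"

definition total_charge :: "insertion list \<Rightarrow> complex" where
  "total_charge ops = (\<Sum>(y, \<alpha>, v)\<leftarrow>ops. \<alpha>)"

text \<open>The coefficient at the monomial \<open>e\<close> of the product of the operators applied to the vacuum.\<close>

fun product_coeff ::
  "(complex \<Rightarrow> complex \<Rightarrow> fock \<Rightarrow> complex \<Rightarrow> fock \<Rightarrow> fock) \<Rightarrow> insertion list \<Rightarrow>
   (var \<Rightarrow>\<^sub>0 complex) \<Rightarrow> fock" where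
  "product_coeff \<Y> [] e = 1"
| "product_coeff \<Y> ((y, \<alpha>, v) # ops) e =
     \<Y> \<alpha> (total_charge ops) v (- Poly_Mapping.lookup e y - 1) (product_coeff \<Y> ops e)"

definition matrix_element ::
  "(complex \<Rightarrow> complex \<Rightarrow> fock \<Rightarrow> complex \<Rightarrow> fock \<Rightarrow> fock) \<Rightarrow> insertion list \<Rightarrow> var fseries" where
  "matrix_element \<Y> ops = series (\<lambda>e.
     if Poly_Mapping.keys e \<subseteq> fst ` set ops then pairing 1 (product_coeff \<Y> ops e) else 0)"

text \<open>
  \<open>B a\<close> is a homogeneous basis of \<open>M\<^sub>\<alpha>\<^sub>_\<^sub>a\<close>. The factors \<open>\<rho>\<^sub>a\<close> to the power \<open>wt(b\<^sub>a)\<close> contained in the \<open>b\<^sub>-\<^sub>a\<close> are taken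
  out of the matrix element by linearity.
\<close>

definition correlation_form ::
  "(complex \<Rightarrow> complex \<Rightarrow> fock \<Rightarrow> complex \<Rightarrow> fock \<Rightarrow> fock) \<Rightarrow> nat \<Rightarrow> (nat \<Rightarrow> complex) \<Rightarrow>
   (nat \<Rightarrow> fock set) \<Rightarrow> nat \<Rightarrow> nat \<Rightarrow> (nat \<Rightarrow> complex) \<Rightarrow> var fseries" where
  "correlation_form \<Y> g \<alpha> B n m \<gamma> =
     formal_sum (\<lambda>b.
       matrix_element \<Y>
         (map (\<lambda>i. (X i, 0, h_state)) [1..<n + 1] @
          map (\<lambda>j. (Z j, \<gamma> j, 1)) [1..<m + 1] @
          concat (map (\<lambda>a. [(W (int a), \<alpha> a, b a), (W (- int a), - \<alpha> a, dual_vector (B a) (b a))])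
            [1..<g + 1])) *
       (\<Prod>a=1..g. vpow (Rho a) (of_nat (fdegree (b a)) + (\<alpha> a)\<^sup>2 / 2)))
       (PiE {1..g} B) *
     (\<Prod>i=1..n. vpow (DX i) 1) * (\<Prod>j=1..m. vpow (DZ j) ((\<gamma> j)\<^sup>2 / 2))"


section \<open>Differential forms, expanded in the sewing parameters\<close>

definition pi1 :: "var \<Rightarrow> var \<Rightarrow> var fseries" where
  "pi1 x y = recip_diff x y - recip_diff x A0"

definition pi1_deriv :: "nat \<Rightarrow> nat \<Rightarrow> var \<Rightarrow> var \<Rightarrow> var fseries" where
  "pi1_deriv i j x y = fconst (1 / (fact i * fact j)) * (pd x ^^ i) ((pd y ^^ j) (pi1 x y))"

definition f0_deriv :: "nat \<Rightarrow> var \<Rightarrow> var fseries" where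
  "f0_deriv m x = fconst (1 / fact m) * (pd x ^^ m) (- recip_diff x A0)"

definition rho_pow :: "int \<Rightarrow> complex \<Rightarrow> var fseries" where
  "rho_pow a p = vpow (Rho (nat \<bar>a\<bar>)) p"

text \<open>Rows and columns are indexed by pairs \<open>(a, m)\<close> with \<open>a \<in> {\<plusminus>1, \<dots>, \<plusminus>g}\<close> and \<open>m \<ge> 0\<close>.\<close>

type_synonym fvector = "int \<times> nat \<Rightarrow> var fseries"
type_synonym fmatrix = "int \<times> nat \<Rightarrow> int \<times> nat \<Rightarrow> var fseries"

definition indices :: "nat \<Rightarrow> (int \<times> nat) set" where
  "indices g = {a. a \<noteq> 0 \<and> \<bar>a\<bar> \<le> int g} \<times> UNIV"

definition dot :: "nat \<Rightarrow> fvector \<Rightarrow> fvector \<Rightarrow> var fseries" where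
  "dot g u v = formal_sum (\<lambda>k. u k * v k) (indices g)"

definition row_mult :: "nat \<Rightarrow> fvector \<Rightarrow> fmatrix \<Rightarrow> fvector" where
  "row_mult g u P j = formal_sum (\<lambda>k. u k * P k j) (indices g)"

definition mat_mult :: "nat \<Rightarrow> fmatrix \<Rightarrow> fmatrix \<Rightarrow> fmatrix" where
  "mat_mult g P Q i j = formal_sum (\<lambda>k. P i k * Q k j) (indices g)"

primrec mat_power :: "nat \<Rightarrow> fmatrix \<Rightarrow> nat \<Rightarrow> fmatrix" where
  "mat_power g P 0 = (\<lambda>i j. if i = j then 1 else 0)"
| "mat_power g P (Suc k) = mat_mult g P (mat_power g P k)"

definition mat_geometric :: "nat \<Rightarrow> fmatrix \<Rightarrow> fmatrix" where
  "mat_geometric g P i j = formal_sum (\<lambda>k. mat_power g P k i j) UNIV"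

text \<open>The forms below in the variable \<open>x\<close> are taken at \<open>x = x\<^sub>i\<close> and include the symbol \<open>dx\<^sub>i\<close>.\<close>

definition L_row :: "nat \<Rightarrow> fvector" where
  "L_row i = (\<lambda>(b, n). rho_pow b (of_nat n / 2) * pi1_deriv 0 n (X i) (W b) * vpow (DX i) 1)"

definition R_col :: "var \<Rightarrow> fvector" where
  "R_col y = (\<lambda>(a, m). - (rho_pow a ((of_nat m + 1) / 2) * pi1_deriv m 0 (W (- a)) y))"

definition A_mat :: fmatrix where
  "A_mat = (\<lambda>(a, m) (b, n).
     if a = - b
     then - (rho_pow a ((of_nat m + of_nat n + 1) / 2) * (if n = 0 then 1 else 0) * f0_deriv m (W (- a)))
     else - (rho_pow a ((of_nat m + 1) / 2) * rho_pow b (of_nat n / 2) * pi1_deriv m n (W (- a)) (W b)))"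

definition Delta_mat :: fmatrix where
  "Delta_mat = (\<lambda>(a, m) (b, n). if m = n + 1 \<and> a = b then 1 else 0)"

definition L_tilde :: "nat \<Rightarrow> nat \<Rightarrow> fvector" where
  "L_tilde g i = row_mult g (L_row i) Delta_mat"

definition A_tilde :: "nat \<Rightarrow> fmatrix" where
  "A_tilde g = mat_mult g A_mat Delta_mat"

definition Psi1 :: "nat \<Rightarrow> nat \<Rightarrow> var \<Rightarrow> var fseries" where
  "Psi1 g i y = pi1 (X i) y * vpow (DX i) 1 +
     dot g (row_mult g (L_tilde g i) (mat_geometric g (A_tilde g))) (R_col y)"

definition T_form :: "nat \<Rightarrow> nat \<Rightarrow> int \<Rightarrow> var fseries" where
  "T_form g i a = L_row i (a, 0) +
     row_mult g (row_mult g (L_tilde g i) (mat_geometric g (A_tilde g))) A_mat (a, 0)"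

definition omega :: "nat \<Rightarrow> nat \<Rightarrow> nat \<Rightarrow> var fseries" where
  "omega g r s = pd (X s) (Psi1 g r (X s)) * vpow (DX s) 1"

definition nu :: "nat \<Rightarrow> nat \<Rightarrow> nat \<Rightarrow> var fseries" where
  "nu g i a = T_form g i (int a) - T_form g i (- int a)"

definition omega_diff :: "nat \<Rightarrow> nat \<Rightarrow> var \<Rightarrow> var \<Rightarrow> var fseries" where
  "omega_diff g i y z = Psi1 g i y - Psi1 g i z"

definition nu_total ::
  "nat \<Rightarrow> (nat \<Rightarrow> complex) \<Rightarrow> nat \<Rightarrow> (nat \<Rightarrow> complex) \<Rightarrow> var \<Rightarrow> nat \<Rightarrow> var fseries" where
  "nu_total g \<alpha> m \<gamma> z\<^sub>0 i =
     (\<Sum>a=1..g. fconst (\<alpha> a) * nu g i a) + (\<Sum>j=1..m. fconst (\<gamma> j) * omega_diff g i (Z j) z\<^sub>0)"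

text \<open>Fixed points of an involution contribute \<open>\<nu>\<close>; each 2-cycle \<open>(r s)\<close> is listed once, with \<open>r < s\<close>.\<close>

definition Sym :: "nat \<Rightarrow> (nat \<Rightarrow> nat \<Rightarrow> var fseries) \<Rightarrow> (nat \<Rightarrow> var fseries) \<Rightarrow> var fseries" where
  "Sym n \<omega> \<nu> = (\<Sum>\<phi> | \<phi> permutes {1..n} \<and> \<phi> \<circ> \<phi> = id.
     (\<Prod>q | q \<in> {1..n} \<and> \<phi> q = q. \<nu> q) * (\<Prod>r | r \<in> {1..n} \<and> r < \<phi> r. \<omega> r (\<phi> r)))"

end

theory Submission
  imports Defs
begin

text \<open>
  The Heisenberg field is free: the operator \<open>h(-p-1)\<close> acting on the state at a point \<open>y\<close> is a
  normally ordered product of the derivatives of the field \<open>h\<close> with the operator inserted at \<open>y\<close>.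
  Its creation part is moved to the left and its annihilation part to the right, and what remains
  are the commutators with the operators at the other points \<open>y'\<close>, that is, the states with \<open>h(j)\<close>,
  \<open>j \<ge> 0\<close>, acting at \<open>y'\<close>, multiplied by Taylor coefficients of the Cauchy kernel \<open>1/(y - y')\<close>
  (\<open>correlator_creation_mode\<close>). An insertion of \<open>h\<close> is the case \<open>p = 0\<close> for the vacuum inserted
  at \<open>x\<close>. At another \<open>h\<close> only \<open>j = 1\<close> contributes and removes this insertion; at \<open>e\<^sup>\<gamma>\<close> and at the ends
  of the handles \<open>j = 0\<close> multiplies by the charge. The modes \<open>j > 0\<close> at the ends of the handles are
  new quantities.

  Summed over dual bases, \<open>h(j)b \<otimes> b'\<close> equals \<open>- b \<otimes> h(-j)b'\<close> up to a power of the sewing parameter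
  (\<open>corr_mode_duality\<close>), so a mode \<open>j > 0\<close> at one end of a handle is a creation mode at the
  other end, and the same formula applies to it. The result is a linear system \<open>y = k + P y\<close> for
  the modes at the handles, with \<open>P = A\<Delta>\<close>, all entries of which have positive order in the
  sewing parameters; it is solved by the geometric series (\<open>neumann_dot\<close>). Inserting the solution, the
  kernels \<open>1/(x - y')\<close> turn into \<open>\<omega>\<close> at an insertion of \<open>h\<close>, into \<open>\<Psi>\<^sub>1\<close> at an insertion of \<open>e\<^sup>\<gamma>\<close>, and
  into \<open>T\<^sub>a\<close> at the end of a handle. As the charges add up to zero, the kernels may be normalised at
  \<open>A\<^sub>0\<close> and \<open>\<Psi>\<^sub>1\<close> at \<open>z\<^sub>0\<close> (\<open>diff_corr_Cons\<close>). The first label is thus either a fixed point, with the factor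
  \<open>\<nu>\<close>, or paired with another label, with the factor \<open>\<omega>\<close>, which is the recursion of the sum over
  involutions (\<open>Sym_on_insert\<close>).

  Convergence of all infinite sums is formal. The weights enter the sewing parameters as exponents, so
  at a given order in the sewing parameters all sums over bases and over the infinite
  matrices are finite (\<open>formal_sum_truncate\<close>). The exponents of the insertion points are controlled
  by the grading by \<open>L(0)\<close> (\<open>intertwiner_nonzero\<close>), so that products of intertwiners have expansions in
  the prescribed domain. The scalar normalisations of the intertwiners are common to both sides.
\<close>

section \<open>Coefficients of formal series\<close>

alias lookup = Poly_Mapping.lookup
alias single = Poly_Mapping.single
alias keys = Poly_Mapping.keys

lemma fcoeff_minus [simp]: "fcoeff (f - g) e = fcoeff f e - fcoeff g e"
  by (simp only: minus_fseries_def fcoeff_add fcoeff_uminus) simp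

lemma sum_nonzeroD: "sum f A \<noteq> 0 \<Longrightarrow> \<exists>a\<in>A. f a \<noteq> 0"
  by (rule ccontr) (simp add: sum.neutral)

lemma fcoeff_sum: "fcoeff (sum F I) e = (\<Sum>i\<in>I. fcoeff (F i) e)"
  by (induction I rule: infinite_finite_induct) simp_all

lemma fcoeff_vpow: "fcoeff (vpow v p) e = (if e = single v p then 1 else 0)"
  by (simp add: vpow_def fcoeff_series)

lemma fcoeff_fconst:
  fixes e :: "'v::linorder \<Rightarrow>\<^sub>0 complex"
  shows "fcoeff (fconst c) e = (if e = 0 then c else 0)"
proof -
  have "admissible {e :: 'v \<Rightarrow>\<^sub>0 complex. (if e = 0 then c else 0) \<noteq> (0::complex)}"
    by (rule admissible_subset[OF admissible_singleton[of 0]]) auto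
  from fcoeff_series[OF this] show ?thesis by (simp add: fconst_def)
qed

lemma fcoeff_monomial_mult:
  assumes "\<And>e. fcoeff p e = (if e = s then c else 0)"
  shows "fcoeff (p * f) e = c * fcoeff f (e - s)"
proof -
  have "fcoeff (p * f) e = (\<Sum>(a, b)\<in>{(s, e - s)}. fcoeff p a * fcoeff f b)"
    by (rule fcoeff_mult_superset) (auto simp: conv_pairs_def assms split: if_splits)
  then show ?thesis by (simp add: assms)
qed

lemma fcoeff_vpow_mult: "fcoeff (vpow v p * f) e = fcoeff f (e - single v p)"
  using fcoeff_monomial_mult[of "vpow v p", OF fcoeff_vpow] by simp

lemma fcoeff_fconst_mult: "fcoeff (fconst c * f) e = c * fcoeff f e"
  using fcoeff_monomial_mult[of "fconst c", OF fcoeff_fconst] by simp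

lemma vpow_0 [simp]: "vpow v 0 = 1"
  by (rule fseries_eqI) (simp add: fcoeff_vpow fcoeff_1)

lemma vpow_add: "vpow v (p + q) = vpow v p * vpow v q"
  by (rule fseries_eqI)
     (simp add: fcoeff_vpow_mult fcoeff_vpow single_add diff_eq_eq add.commute)

lemma fconst_0 [simp]: "fconst 0 = 0"
  by (rule fseries_eqI) (simp add: fcoeff_fconst)

lemma fconst_1 [simp]: "fconst 1 = 1"
  by (rule fseries_eqI) (simp add: fcoeff_fconst fcoeff_1)

lemma fconst_add: "fconst (a + b) = fconst a + fconst b"
  by (rule fseries_eqI) (simp add: fcoeff_fconst)

lemma fconst_uminus: "fconst (- a) = - fconst a"
  by (rule fseries_eqI) (simp add: fcoeff_fconst)

lemma fconst_sum: "fconst (sum f A) = (\<Sum>a\<in>A. fconst (f a))"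
  by (induction A rule: infinite_finite_induct) (simp_all add: fconst_add)

text \<open>
  The kernels expanded below are supported on a sequence of distinct monomials, so that
  multiplication by them is a sum over one index.
\<close>

lemma fcoeff_mult_indexed:
  assumes "inj E" "\<And>k. fcoeff S (E k) = c k" "\<And>e. e \<notin> range E \<Longrightarrow> fcoeff S e = 0"
  shows "finite {k. c k * fcoeff f (e - E k) \<noteq> 0}"
    and "fcoeff (S * f) e = Sum_any (\<lambda>k. c k * fcoeff f (e - E k))"
proof -
  let ?K = "{k. c k * fcoeff f (e - E k) \<noteq> 0}" and ?p = "\<lambda>k. (E k, e - E k)"
  have inj: "inj_on ?p A" for A using assms(1) by (auto simp: inj_on_def)
  have eq: "conv_pairs S f e = ?p ` ?K"
    using assms(2,3) by (fastforce simp: conv_pairs_def algebra_simps image_iff)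
  then have "finite (?p ` ?K)" using finite_conv_pairs by metis
  then show fin: "finite ?K" using inj by (rule finite_imageD)
  have "fcoeff (S * f) e = (\<Sum>k\<in>?K. fcoeff S (E k) * fcoeff f (e - E k))"
    unfolding fcoeff_mult eq by (subst sum.reindex[OF inj]) simp
  then show "fcoeff (S * f) e = Sum_any (\<lambda>k. c k * fcoeff f (e - E k))"
    by (simp add: assms(2) Sum_any.expand_set)
qed

lemma fcoeff_pd:
  "fcoeff (pd v f) e = (lookup e v + 1) * fcoeff f (e + single v 1)"
proof -
  have "{e. (lookup e v + 1) * fcoeff f (e + single v 1) \<noteq> 0} \<subseteq>
      {a + b | a b. a \<in> {e. fcoeff f e \<noteq> 0} \<and> b \<in> {- single v 1}}"
  proof clarify
    fix e assume "(lookup e v + 1) * fcoeff f (e + single v 1) \<noteq> 0"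
    then show "\<exists>a b. e = a + b \<and> a \<in> {e. fcoeff f e \<noteq> 0} \<and> b \<in> {- single v 1}"
      by (intro exI[of _ "e + single v 1"] exI[of _ "- single v 1"]) auto
  qed
  then have "admissible {e. (lookup e v + 1) * fcoeff f (e + single v 1) \<noteq> 0}"
    using admissible_subset[OF admissible_plus[OF admissible_fcoeff admissible_singleton]] by blast
  then show ?thesis by (simp add: pd_def fcoeff_series)
qed

lemma pd_add: "pd v (f + g) = pd v f + pd v g"
  by (rule fseries_eqI) (simp add: fcoeff_pd algebra_simps)

lemma pd_minus: "pd v (f - g) = pd v f - pd v g"
  by (rule fseries_eqI) (simp add: fcoeff_pd algebra_simps)

lemma pd_uminus: "pd v (- f) = - pd v f"
  by (rule fseries_eqI) (simp add: fcoeff_pd)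

lemma pd_sum: "pd v (sum F I) = (\<Sum>i\<in>I. pd v (F i))"
  by (rule fseries_eqI) (simp add: fcoeff_pd fcoeff_sum sum_distrib_left)

lemma pd_commute: "pd u (pd v f) = pd v (pd u f)"
  by (rule fseries_eqI) (auto simp: fcoeff_pd lookup_add lookup_single when_def ac_simps)

lemma pd_funpow_commute: "pd u ((pd v ^^ k) f) = (pd v ^^ k) (pd u f)"
  by (induction k) (simp_all add: pd_commute[of u v])

lemma pd_funpow_minus: "(pd v ^^ k) (f - g) = (pd v ^^ k) f - (pd v ^^ k) g"
  by (induction k) (simp_all add: pd_minus)

lemma pd_funpow_uminus: "(pd v ^^ k) (- f) = - (pd v ^^ k) f"
  by (induction k) (simp_all add: pd_uminus)

lemma pd_funpow_0 [simp]: "(pd v ^^ k) 0 = 0"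
  using pd_funpow_minus[of k v 0 0] by simp

lemma pd_eq_0:
  assumes "\<And>e. fcoeff f e \<noteq> 0 \<Longrightarrow> lookup e v = 0"
  shows "pd v f = 0"
proof (rule fseries_eqI)
  fix e
  show "fcoeff (pd v f) e = fcoeff 0 e"
    using assms[of "e + single v 1"] by (auto simp: fcoeff_pd lookup_add)
qed

text \<open>The Leibniz rule in the case where the first factor does not involve the variable.\<close>

lemma pd_mult_left:
  assumes "\<And>e. fcoeff f e \<noteq> 0 \<Longrightarrow> lookup e v = 0"
  shows "pd v (f * g) = f * pd v g"
proof (rule fseries_eqI)
  fix e
  let ?s = "single v (1::complex)" and ?q = "\<lambda>(a, b). (a, b + single v (1::complex))"
  let ?P = "conv_pairs f (pd v g) e \<union> (\<lambda>(a, b). (a, b - ?s)) ` conv_pairs f g (e + ?s)"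
  have sub: "conv_pairs f g (e + ?s) \<subseteq> ?q ` ?P"
    by (force simp: image_Un image_iff)
  have inj: "inj_on ?q A" for A by (auto simp: inj_on_def)
  have e: "a + b = e" if "(a, b) \<in> ?P" for a b
    using that by (auto simp: conv_pairs_def algebra_simps)
  have "fcoeff (pd v (f * g)) e = (lookup e v + 1) * (\<Sum>(a, b)\<in>?q ` ?P. fcoeff f a * fcoeff g b)"
    unfolding fcoeff_pd
  proof (subst fcoeff_mult_superset[OF _ sub])
    show "a + b = e + ?s" if ab: "(a, b) \<in> ?q ` ?P" for a b
    proof -
      obtain p where "p \<in> ?P" "(a, b) = ?q p" using ab by (rule imageE)
      then show ?thesis using e[of "fst p" "snd p"] by (simp add: case_prod_beta add.assoc[symmetric])
    qed
  qed simp_all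
  also have "\<dots> = (\<Sum>(a, b)\<in>?P. fcoeff f a * fcoeff (pd v g) b)"
    unfolding sum_distrib_left
  proof (subst sum.reindex[OF inj], rule sum.cong[OF refl])
    fix p assume p: "p \<in> ?P"
    obtain a b where ab: "p = (a, b)" by (cases p)
    have "lookup e v = lookup a v + lookup b v"
      using e[OF p[unfolded ab]] by (simp add: lookup_add[symmetric])
    then show "((\<lambda>p. (lookup e v + 1) * (case p of (a, b) \<Rightarrow> fcoeff f a * fcoeff g b)) \<circ> ?q) p =
        (case p of (a, b) \<Rightarrow> fcoeff f a * fcoeff (pd v g) b)"
      using assms[of a] by (cases "fcoeff f a = 0") (simp_all add: ab fcoeff_pd)
  qed
  also have "\<dots> = fcoeff (f * pd v g) e"
    by (rule fcoeff_mult_superset[symmetric, OF _ Un_upper1 e]) simp_all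
  finally show "fcoeff (pd v (f * g)) e = fcoeff (f * pd v g) e" .
qed

lemma fcoeff_pd_funpow:
  "fcoeff ((pd v ^^ m) f) e =
     pochhammer (lookup e v + 1) m * fcoeff f (e + single v (of_nat m))"
proof (induction m arbitrary: e)
  case (Suc m)
  have "single v 1 + single v (of_nat m) = single v (of_nat (Suc m) :: complex)"
    by (simp add: single_add[symmetric])
  then show ?case
    by (simp add: fcoeff_pd Suc lookup_add pochhammer_rec add.assoc)
qed simp

section \<open>The filtration by the degree in the sewing parameters\<close>

definition rho_degree :: "nat \<Rightarrow> (var \<Rightarrow>\<^sub>0 complex) \<Rightarrow> real" where
  "rho_degree g e = (\<Sum>a=1..g. Re (lookup e (Rho a)))"

text \<open>
  All forms in question become, after removal of finitely many monomials with complex exponents,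
  series in a fixed finite set \<open>V\<close> of variables whose exponents in the sewing parameters and the
  differentials lie in \<open>\<nat>/2\<close>. Such series form a ring which is filtered, and complete, with
  respect to the total degree \<open>q\<close> in the sewing parameters; infinite sums are limits in this sense.
\<close>

definition rho_order :: "nat \<Rightarrow> var set \<Rightarrow> real \<Rightarrow> var fseries \<Rightarrow> bool" where
  "rho_order g V q f \<longleftrightarrow> (\<forall>e. fcoeff f e \<noteq> 0 \<longrightarrow> keys e \<subseteq> V \<and>
     (\<forall>u. 4 \<le> var_class u \<longrightarrow> (\<exists>k::nat. lookup e u = of_nat k / 2)) \<and> q \<le> rho_degree g e)"

lemma rho_degree_add: "rho_degree g (a + b) = rho_degree g a + rho_degree g b"
  by (simp add: rho_degree_def lookup_add sum.distrib)

lemma rho_orderD: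
  assumes "rho_order g V q f" "fcoeff f e \<noteq> 0"
  shows "keys e \<subseteq> V" "4 \<le> var_class u \<Longrightarrow> \<exists>k::nat. lookup e u = of_nat k / 2"
    "q \<le> rho_degree g e"
  using assms unfolding rho_order_def by auto

lemma rho_order_mono: "rho_order g V q f \<Longrightarrow> r \<le> q \<Longrightarrow> V \<subseteq> V' \<Longrightarrow> rho_order g V' r f"
  unfolding rho_order_def by fastforce

lemma rho_order_le: "rho_order g V q f \<Longrightarrow> r \<le> q \<Longrightarrow> rho_order g V r f"
  by (rule rho_order_mono) auto

lemma rho_order_0 [simp]: "rho_order g V q 0"
  by (simp add: rho_order_def)

lemma rho_order_add: "rho_order g V q f \<Longrightarrow> rho_order g V q h \<Longrightarrow> rho_order g V q (f + h)"
  unfolding rho_order_def fcoeff_add by (metis add.right_neutral)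

lemma rho_order_uminus_iff [simp]: "rho_order g V q (- f) \<longleftrightarrow> rho_order g V q f"
  unfolding rho_order_def by simp

lemma rho_order_diff: "rho_order g V q f \<Longrightarrow> rho_order g V q h \<Longrightarrow> rho_order g V q (f - h)"
  using rho_order_add[of g V q f "- h"] by simp

lemma rho_order_sum: "(\<And>i. i \<in> I \<Longrightarrow> rho_order g V q (F i)) \<Longrightarrow> rho_order g V q (sum F I)"
  by (induction I rule: infinite_finite_induct) (auto intro: rho_order_add)

lemma rho_order_mult:
  assumes "rho_order g V p f" "rho_order g V q h"
  shows "rho_order g V (p + q) (f * h)"
  unfolding rho_order_def
proof (intro allI impI)
  fix e assume "fcoeff (f * h) e \<noteq> 0"
  then have "conv_pairs f h e \<noteq> {}" by (auto simp: fcoeff_mult)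
  then obtain a b where ab: "fcoeff f a \<noteq> 0" "fcoeff h b \<noteq> 0" "e = a + b"
    by (auto simp: conv_pairs_def)
  note a = rho_orderD[OF assms(1) ab(1)] and b = rho_orderD[OF assms(2) ab(2)]
  have "\<exists>k::nat. lookup e u = of_nat k / 2" if u: "4 \<le> var_class u" for u
  proof -
    obtain k l :: nat where kl: "lookup a u = of_nat k / 2" "lookup b u = of_nat l / 2"
      using a(2)[OF u] b(2)[OF u] by blast
    show ?thesis by (rule exI[of _ "k + l"]) (simp add: ab(3) lookup_add add_divide_distrib kl)
  qed
  then show "keys e \<subseteq> V \<and>
     (\<forall>u. 4 \<le> var_class u \<longrightarrow> (\<exists>k::nat. lookup e u = of_nat k / 2)) \<and> p + q \<le> rho_degree g e"
    using a(1,3) b(1,3) keys_add[of a b] by (auto simp: ab(3) rho_degree_add)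
qed

lemma rho_order_multI:
  "rho_order g V p f \<Longrightarrow> rho_order g V q h \<Longrightarrow> r \<le> p + q \<Longrightarrow> rho_order g V r (f * h)"
  by (rule rho_order_le[OF rho_order_mult])

lemma rho_order_prod:
  "(\<And>i. i \<in> I \<Longrightarrow> rho_order g V (q i) (F i)) \<Longrightarrow> rho_order g V (sum q I) (prod F I)"
proof (induction I rule: infinite_finite_induct)
  case (insert i I)
  then show ?case by (simp add: rho_order_mult)
qed (simp_all add: rho_order_def fcoeff_1 rho_degree_def exI[of _ "0::nat"])

lemma rho_order_fconst [simp]: "q \<le> 0 \<Longrightarrow> rho_order g V q (fconst c)"
  by (auto simp: rho_order_def fcoeff_fconst rho_degree_def intro: exI[of _ "0::nat"] split: if_splits)

lemma rho_order_1 [simp]: "q \<le> 0 \<Longrightarrow> rho_order g V q 1"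
  using rho_order_fconst[of q g V 1] by simp

lemma rho_order_vpow_Rho:
  assumes "a \<in> {1..g}" "Rho a \<in> V" "q \<le> of_nat k / 2"
  shows "rho_order g V q (vpow (Rho a) (of_nat k / 2))"
proof -
  have "rho_degree g (single (Rho a) (of_nat k / 2 :: complex)) = of_nat k / 2"
    using assms(1) by (simp add: rho_degree_def lookup_single when_def if_distrib sum.delta cong: if_cong)
  then show ?thesis using assms
    by (auto simp: rho_order_def fcoeff_vpow lookup_single when_def split: if_splits intro: exI[of _ "0::nat"])
qed

lemma rho_order_vpow_DX:
  assumes "DX i \<in> V" shows "rho_order g V 0 (vpow (DX i) 1)"
  using assms
  by (auto simp: rho_order_def fcoeff_vpow lookup_single when_def rho_degree_def
           intro: exI[of _ "0::nat"] exI[of _ "2::nat"] split: if_splits)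

lemma rho_order_pd:
  assumes "rho_order g V q f" "v \<in> V" "var_class v < 4"
  shows "rho_order g V q (pd v f)"
  unfolding rho_order_def
proof (intro allI impI)
  fix e assume "fcoeff (pd v f) e \<noteq> 0"
  then have "fcoeff f (e + single v 1) \<noteq> 0" by (auto simp: fcoeff_pd)
  note * = rho_orderD[OF assms(1) this]
  have "t \<in> V" if "t \<in> keys e" for t
    using *(1) assms(2) that by (cases "t = v") (auto simp: in_keys_iff lookup_add lookup_single when_def subset_iff)
  then have "keys e \<subseteq> V" by blast
  moreover have "\<forall>u. 4 \<le> var_class u \<longrightarrow> (\<exists>k::nat. lookup e u = of_nat k / 2)"
  proof (intro allI impI)
    fix u assume "4 \<le> var_class u"
    moreover from this have "u \<noteq> v" using assms(3) by auto
    ultimately show "\<exists>k::nat. lookup e u = of_nat k / 2"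
      using *(2)[of u] by (simp add: lookup_add lookup_single)
  qed
  moreover have "rho_degree g (single v 1) = 0"
    using assms(3) by (auto simp: rho_degree_def lookup_single when_def intro!: sum.neutral)
  ultimately show "keys e \<subseteq> V \<and>
     (\<forall>u. 4 \<le> var_class u \<longrightarrow> (\<exists>k::nat. lookup e u = of_nat k / 2)) \<and> q \<le> rho_degree g e"
    using *(3) by (simp add: rho_degree_add)
qed

lemma rho_order_pd_funpow:
  "rho_order g V q f \<Longrightarrow> v \<in> V \<Longrightarrow> var_class v < 4 \<Longrightarrow> rho_order g V q ((pd v ^^ k) f)"
  by (induction k) (auto intro: rho_order_pd)

lemma rho_order_all_imp_0:
  assumes "\<And>N::nat. rho_order g V (of_nat N) f" shows "f = 0"
proof (rule fseries_eqI, rule ccontr)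
  fix e assume "fcoeff f e \<noteq> fcoeff 0 e"
  then have "of_nat N \<le> rho_degree g e" for N :: nat using rho_orderD(3)[OF assms] by auto
  then show False using reals_Archimedean2 not_le by blast
qed

lemma eq_if_rho_order_diff:
  "(\<And>N::nat. rho_order g V (of_nat N) (f - h)) \<Longrightarrow> f = h"
  using rho_order_all_imp_0[of g V "f - h"] by simp


section \<open>Infinite sums\<close>

definition rho_summable :: "nat \<Rightarrow> var set \<Rightarrow> ('i \<Rightarrow> var fseries) \<Rightarrow> 'i set \<Rightarrow> bool" where
  "rho_summable g V F I \<longleftrightarrow> finite V \<and> (\<forall>i\<in>I. rho_order g V 0 (F i)) \<and>
     (\<forall>N::nat. finite {i\<in>I. \<not> rho_order g V (of_nat N) (F i)})"

lemma rho_summable_cong: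
  "(\<And>i. i \<in> I \<Longrightarrow> F i = G i) \<Longrightarrow> rho_summable g V F I = rho_summable g V G I"
  unfolding rho_summable_def by (simp cong: conj_cong)

lemma formal_sum_cong:
  assumes "\<And>i. i \<in> I \<Longrightarrow> F i = G i"
  shows "formal_sum F I = formal_sum G I"
proof -
  have "{i. i \<in> I \<and> fcoeff (F i) e \<noteq> 0} = {i. i \<in> I \<and> fcoeff (G i) e \<noteq> 0}" for e
    using assms by auto
  then show ?thesis unfolding formal_sum_def
    by (intro arg_cong[where f = series] ext sum.cong) (auto simp: assms)
qed

lemma admissible_UN: "finite I \<Longrightarrow> (\<And>i. i \<in> I \<Longrightarrow> admissible (S i)) \<Longrightarrow> admissible (\<Union>i\<in>I. S i)"
  by (induction I rule: finite_induct) (auto intro: admissible_Un)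

text \<open>
  The sewing parameters are smaller than all insertion points, so once their exponents are fixed
  only finitely many members of a summable family contribute, and these are admissible.
\<close>

lemma rho_summable_admissible:
  assumes "rho_summable g V F I"
  shows "admissible {e. \<exists>i\<in>I. fcoeff (F i) e \<noteq> 0}"
  unfolding admissible_def
proof (intro conjI allI)
  have fin: "finite {i\<in>I. \<not> rho_order g V (of_nat N) (F i)}" for N :: nat
    using assms by (simp add: rho_summable_def)
  have r0: "\<And>i. i \<in> I \<Longrightarrow> rho_order g V 0 (F i)" using assms by (simp add: rho_summable_def)
  show "\<exists>W. finite W \<and> (\<forall>e\<in>{e. \<exists>i\<in>I. fcoeff (F i) e \<noteq> 0}. keys e \<subseteq> W)"
    using assms rho_orderD(1)[OF r0] by (intro exI[of _ V]) (auto simp: rho_summable_def)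
  fix v c
  show "\<exists>B. finite B \<and> (\<forall>e\<in>{e. \<exists>i\<in>I. fcoeff (F i) e \<noteq> 0}. (\<forall>u>v. lookup e u = c u) \<longrightarrow>
           (\<exists>b\<in>B. \<exists>k::nat. lookup e v = b + of_nat k / 2))"
  proof (cases "4 \<le> var_class v")
    case True
    then show ?thesis using rho_orderD(2)[OF r0] by (intro exI[of _ "{0}"]) auto
  next
    case False
    obtain N :: nat where N: "(\<Sum>a=1..g. Re (c (Rho a))) < of_nat N" using reals_Archimedean2 by blast
    let ?S = "\<Union>i\<in>{i\<in>I. \<not> rho_order g V (of_nat N) (F i)}. {e. fcoeff (F i) e \<noteq> 0}"
    have "admissible ?S" by (rule admissible_UN[OF fin admissible_fcoeff])
    from admissible_bound[OF this, of v c] obtain B where B: "finite B"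
      "\<forall>e\<in>?S. (\<forall>u>v. lookup e u = c u) \<longrightarrow>
           (\<exists>b\<in>B. \<exists>k::nat. lookup e v = b + of_nat k / 2)" by auto
    have "e \<in> ?S" if "i \<in> I" "fcoeff (F i) e \<noteq> 0" "\<forall>u>v. lookup e u = c u" for e i
    proof -
      have "Rho a > v" for a using False by (simp add: less_var_def)
      then have "rho_degree g e < of_nat N" using that(3) N by (simp add: rho_degree_def)
      then have "\<not> rho_order g V (of_nat N) (F i)"
        using rho_orderD(3)[OF _ that(2), of g V "of_nat N"] by auto
      then show ?thesis using that by auto
    qed
    then show ?thesis using B by (intro exI[of _ B]) blast
  qed
qed

lemma rho_summable_finite_coeff:
  assumes "rho_summable g V F I" shows "finite {i\<in>I. fcoeff (F i) e \<noteq> 0}"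
proof -
  obtain N :: nat where N: "rho_degree g e < of_nat N" using reals_Archimedean2 by blast
  have "{i\<in>I. fcoeff (F i) e \<noteq> 0} \<subseteq> {i\<in>I. \<not> rho_order g V (of_nat N) (F i)}"
    using N rho_orderD(3)[of g V "of_nat N" _ e] by fastforce
  then show ?thesis using assms unfolding rho_summable_def by (meson finite_subset)
qed

lemma fcoeff_formal_sum:
  assumes "rho_summable g V F I"
  shows "fcoeff (formal_sum F I) e = (\<Sum>i | i \<in> I \<and> fcoeff (F i) e \<noteq> 0. fcoeff (F i) e)"
proof -
  have "{e. (\<Sum>i | i \<in> I \<and> fcoeff (F i) e \<noteq> 0. fcoeff (F i) e) \<noteq> 0} \<subseteq> {e. \<exists>i\<in>I. fcoeff (F i) e \<noteq> 0}"
    using sum_nonzeroD by blast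
  from admissible_subset[OF rho_summable_admissible[OF assms] this]
  show ?thesis by (simp add: formal_sum_def fcoeff_series)
qed

lemma formal_sum_single:
  assumes "i \<in> I" "\<And>j. j \<in> I \<Longrightarrow> j \<noteq> i \<Longrightarrow> F j = 0"
  shows "formal_sum F I = F i"
proof -
  have "(\<Sum>j | j \<in> I \<and> fcoeff (F j) e \<noteq> 0. fcoeff (F j) e) = fcoeff (F i) e" for e
  proof -
    have "(\<Sum>j | j \<in> I \<and> fcoeff (F j) e \<noteq> 0. fcoeff (F j) e) = (\<Sum>j\<in>{i}. fcoeff (F j) e)"
      by (rule sum.mono_neutral_left) (use assms in \<open>auto, metis fcoeff_0\<close>)
    then show ?thesis by simp
  qed
  then show ?thesis by (simp add: formal_sum_def fcoeff_inverse)
qed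

lemma rho_order_formal_sum:
  assumes "rho_summable g V F I" "\<And>i. i \<in> I \<Longrightarrow> rho_order g V q (F i)"
  shows "rho_order g V q (formal_sum F I)"
  unfolding rho_order_def
proof (intro allI impI)
  fix e assume "fcoeff (formal_sum F I) e \<noteq> 0"
  then obtain i where "i \<in> I" "fcoeff (F i) e \<noteq> 0"
    unfolding fcoeff_formal_sum[OF assms(1)] using sum_nonzeroD by blast
  then show "keys e \<subseteq> V \<and>
     (\<forall>u. 4 \<le> var_class u \<longrightarrow> (\<exists>k::nat. lookup e u = of_nat k / 2)) \<and> q \<le> rho_degree g e"
    using assms(2) unfolding rho_order_def by blast
qed

lemma rho_order_formal_sum_0: "rho_summable g V F I \<Longrightarrow> rho_order g V 0 (formal_sum F I)"
  by (rule rho_order_formal_sum) (auto simp: rho_summable_def)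

text \<open>Modulo high order an infinite sum is a finite one. All manipulations of infinite sums rest on this.\<close>

lemma formal_sum_truncate:
  assumes "rho_summable g V F I" "finite P" "P \<subseteq> I" "\<And>i. i \<in> I - P \<Longrightarrow> rho_order g V q (F i)"
  shows "rho_order g V q (formal_sum F I - sum F P)"
  unfolding rho_order_def
proof (intro allI impI)
  fix e assume ne: "fcoeff (formal_sum F I - sum F P) e \<noteq> 0"
  have "fcoeff (formal_sum F I - sum F P) e =
      (\<Sum>i\<in>{i. i \<in> I \<and> fcoeff (F i) e \<noteq> 0} \<union> P. fcoeff (F i) e) - (\<Sum>i\<in>P. fcoeff (F i) e)"
    unfolding fcoeff_minus fcoeff_sum fcoeff_formal_sum[OF assms(1)]
    by (intro arg_cong2[where f = "(-)"] refl sum.mono_neutral_left)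
       (use assms rho_summable_finite_coeff[OF assms(1), of e] in auto)
  also have "\<dots> = (\<Sum>i\<in>{i. i \<in> I \<and> fcoeff (F i) e \<noteq> 0} \<union> P - P. fcoeff (F i) e)"
    by (subst sum_diff) (use assms rho_summable_finite_coeff[OF assms(1), of e] in auto)
  finally obtain i where "i \<in> I - P" "fcoeff (F i) e \<noteq> 0"
    using ne sum_nonzeroD by fastforce
  then show "keys e \<subseteq> V \<and>
     (\<forall>u. 4 \<le> var_class u \<longrightarrow> (\<exists>k::nat. lookup e u = of_nat k / 2)) \<and> q \<le> rho_degree g e"
    using assms(4) unfolding rho_order_def by blast
qed

lemma rho_summable_finite:
  "finite V \<Longrightarrow> finite I \<Longrightarrow> (\<And>i. i \<in> I \<Longrightarrow> rho_order g V 0 (F i)) \<Longrightarrow> rho_summable g V F I"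
  by (simp add: rho_summable_def)

lemma formal_sum_finite:
  assumes "finite V" "finite I" "\<And>i. i \<in> I \<Longrightarrow> rho_order g V 0 (F i)"
  shows "formal_sum F I = sum F I"
  by (rule eq_if_rho_order_diff[of g V], rule formal_sum_truncate)
     (use assms in \<open>auto intro: rho_summable_finite\<close>)

lemma rho_summableI:
  assumes "finite V" "\<And>i. i \<in> I \<Longrightarrow> rho_order g V (q i) (F i)" "\<And>i. i \<in> I \<Longrightarrow> 0 \<le> q i"
    "\<And>N::nat. finite {i\<in>I. q i < of_nat N}"
  shows "rho_summable g V F I"
  unfolding rho_summable_def
proof (intro conjI ballI allI)
  fix N :: nat
  show "finite {i \<in> I. \<not> rho_order g V (of_nat N) (F i)}"
  proof (rule finite_subset[OF _ assms(4)[of N]], clarify)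
    fix i assume i: "i \<in> I" "\<not> rho_order g V (of_nat N) (F i)"
    then show "q i < of_nat N" using rho_order_le[OF assms(2)[OF i(1)], of "of_nat N"] by fastforce
  qed
qed (use assms rho_order_le in blast)+

lemma rho_summable_mult_left:
  assumes "rho_summable g V F I" "rho_order g V 0 c"
  shows "rho_summable g V (\<lambda>i. c * F i) I"
proof -
  have *: "rho_order g V q (F i) \<Longrightarrow> rho_order g V q (c * F i)" for q i
    using rho_order_mult[OF assms(2), of q "F i"] by simp
  have "{i \<in> I. \<not> rho_order g V (of_nat N) (c * F i)} \<subseteq> {i \<in> I. \<not> rho_order g V (of_nat N) (F i)}" for N :: nat
    using * by auto
  then show ?thesis using assms(1) * unfolding rho_summable_def by (meson finite_subset)
qed

lemma rho_summable_add:
  assumes "rho_summable g V F I" "rho_summable g V G I"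
  shows "rho_summable g V (\<lambda>i. F i + G i) I"
proof -
  have "{i \<in> I. \<not> rho_order g V (of_nat N) (F i + G i)} \<subseteq>
      {i \<in> I. \<not> rho_order g V (of_nat N) (F i)} \<union> {i \<in> I. \<not> rho_order g V (of_nat N) (G i)}" for N :: nat
    using rho_order_add by auto
  then show ?thesis using assms unfolding rho_summable_def by (meson finite_Un finite_subset rho_order_add)
qed

lemma formal_sum_mult_left:
  assumes "rho_summable g V F I" "rho_order g V 0 c"
  shows "formal_sum (\<lambda>i. c * F i) I = c * formal_sum F I"
proof (rule eq_if_rho_order_diff[of g V])
  fix N :: nat
  let ?P = "{i\<in>I. \<not> rho_order g V (of_nat N) (F i)}"
  have P: "finite ?P" using assms by (simp add: rho_summable_def)
  have *: "rho_order g V (of_nat N) f \<Longrightarrow> rho_order g V (of_nat N) (c * f)" for f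
    using rho_order_mult[OF assms(2), of "of_nat N" f] by simp
  have "rho_order g V (of_nat N) (formal_sum (\<lambda>i. c * F i) I - (\<Sum>i\<in>?P. c * F i))"
    by (rule formal_sum_truncate[OF rho_summable_mult_left[OF assms] P]) (auto intro: *)
  moreover have "rho_order g V (of_nat N) (c * (formal_sum F I - sum F ?P))"
    by (rule *, rule formal_sum_truncate[OF assms(1) P]) auto
  ultimately have "rho_order g V (of_nat N) ((formal_sum (\<lambda>i. c * F i) I - (\<Sum>i\<in>?P. c * F i)) -
      c * (formal_sum F I - sum F ?P))" by (rule rho_order_diff)
  then show "rho_order g V (of_nat N) (formal_sum (\<lambda>i. c * F i) I - c * formal_sum F I)"
    by (simp add: right_diff_distrib sum_distrib_left)
qed

lemma formal_sum_add:
  assumes "rho_summable g V F I" "rho_summable g V G I"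
  shows "formal_sum (\<lambda>i. F i + G i) I = formal_sum F I + formal_sum G I"
proof (rule eq_if_rho_order_diff[of g V])
  fix N :: nat
  let ?P = "{i\<in>I. \<not> rho_order g V (of_nat N) (F i)} \<union> {i\<in>I. \<not> rho_order g V (of_nat N) (G i)}"
  have P: "finite ?P" using assms by (simp add: rho_summable_def)
  have "rho_order g V (of_nat N) (formal_sum (\<lambda>i. F i + G i) I - (\<Sum>i\<in>?P. F i + G i))"
    by (rule formal_sum_truncate[OF rho_summable_add[OF assms] P]) (auto intro: rho_order_add)
  moreover have "rho_order g V (of_nat N) ((formal_sum F I - sum F ?P) + (formal_sum G I - sum G ?P))"
    by (intro rho_order_add formal_sum_truncate[OF assms(1) P] formal_sum_truncate[OF assms(2) P]) auto
  ultimately have "rho_order g V (of_nat N) ((formal_sum (\<lambda>i. F i + G i) I - (\<Sum>i\<in>?P. F i + G i)) -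
      ((formal_sum F I - sum F ?P) + (formal_sum G I - sum G ?P)))" by (rule rho_order_diff)
  then show "rho_order g V (of_nat N) (formal_sum (\<lambda>i. F i + G i) I - (formal_sum F I + formal_sum G I))"
    by (simp add: sum.distrib algebra_simps)
qed

lemma formal_sum_0: "formal_sum (\<lambda>i. 0) I = 0"
  by (simp add: formal_sum_def flip: zero_fseries_def)

lemma formal_sum_sum:
  assumes "finite T" "finite V" "\<And>t. t \<in> T \<Longrightarrow> rho_summable g V (F t) I"
  shows "formal_sum (\<lambda>i. \<Sum>t\<in>T. F t i) I = (\<Sum>t\<in>T. formal_sum (F t) I)
     \<and> rho_summable g V (\<lambda>i. \<Sum>t\<in>T. F t i) I"
  using assms(1,3)
proof (induction T rule: finite_induct)
  case empty
  then show ?case using assms(2) by (simp add: formal_sum_0 rho_summable_def)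
next
  case (insert t T)
  then show ?case
    by (simp add: formal_sum_add[where g = g and V = V] rho_summable_add)
qed

lemma rho_summable_Pair:
  assumes "rho_summable g V (case_prod f) (I \<times> J)" "i \<in> I"
  shows "rho_summable g V (f i) J"
proof -
  have "(\<lambda>j. (i, j)) ` {j\<in>J. \<not> rho_order g V (of_nat N) (f i j)} \<subseteq>
      {p \<in> I \<times> J. \<not> rho_order g V (of_nat N) (case_prod f p)}" for N :: nat using assms(2) by auto
  then have "finite ((\<lambda>j. (i, j)) ` {j\<in>J. \<not> rho_order g V (of_nat N) (f i j)})" for N :: nat
    using assms(1) unfolding rho_summable_def by (meson finite_subset)
  then show ?thesis using assms unfolding rho_summable_def
    by (auto simp: finite_image_iff inj_on_def)
qed

lemma rho_summable_formal_sum: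
  assumes "rho_summable g V (case_prod f) (I \<times> J)"
  shows "rho_summable g V (\<lambda>i. formal_sum (f i) J) I"
proof -
  have s: "rho_summable g V (f i) J" if "i \<in> I" for i using rho_summable_Pair[OF assms that] .
  have "{i\<in>I. \<not> rho_order g V (of_nat N) (formal_sum (f i) J)} \<subseteq>
      fst ` {p \<in> I \<times> J. \<not> rho_order g V (of_nat N) (case_prod f p)}" for N :: nat
  proof clarify
    fix i assume i: "i \<in> I" "\<not> rho_order g V (of_nat N) (formal_sum (f i) J)"
    then obtain j where "j \<in> J" "\<not> rho_order g V (of_nat N) (f i j)"
      using rho_order_formal_sum[OF s[OF i(1)]] by blast
    then show "i \<in> fst ` {p \<in> I \<times> J. \<not> rho_order g V (of_nat N) (case_prod f p)}"
      using i(1) by (auto intro!: image_eqI[of _ _ "(i, j)"])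
  qed
  then have "finite {i\<in>I. \<not> rho_order g V (of_nat N) (formal_sum (f i) J)}" for N :: nat
    using assms unfolding rho_summable_def by (meson finite_subset finite_imageI)
  then show ?thesis
    using assms rho_order_formal_sum_0[OF s] unfolding rho_summable_def by blast
qed

text \<open>
  Outside finitely many rows and columns all terms have high order, so both sides agree with the
  same finite double sum.
\<close>

lemma formal_sum_Sigma:
  assumes "rho_summable g V (case_prod f) (I \<times> J)"
  shows "formal_sum (\<lambda>i. formal_sum (f i) J) I = formal_sum (case_prod f) (I \<times> J)"
proof (rule eq_if_rho_order_diff[of g V])
  fix N :: nat
  let ?P = "{p \<in> I \<times> J. \<not> rho_order g V (of_nat N) (case_prod f p)}"
  let ?A = "fst ` ?P" and ?B = "snd ` ?P"
  have P: "finite ?P" using assms by (simp add: rho_summable_def)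
  have o: "rho_order g V (of_nat N) (f i j)" if "i \<in> I" "j \<in> J" "i \<notin> ?A \<or> j \<notin> ?B" for i j
    using that imageI[of "(i, j)" ?P fst] imageI[of "(i, j)" ?P snd] by auto
  have AB: "?A \<subseteq> I" "?B \<subseteq> J" by auto
  have s: "rho_summable g V (f i) J" if "i \<in> I" for i using rho_summable_Pair[OF assms that] .
  have 1: "rho_order g V (of_nat N) (formal_sum (\<lambda>i. formal_sum (f i) J) I - (\<Sum>i\<in>?A. formal_sum (f i) J))"
    by (rule formal_sum_truncate[OF rho_summable_formal_sum[OF assms]])
       (use P AB o in \<open>auto intro!: rho_order_formal_sum s\<close>)
  have 2: "rho_order g V (of_nat N) (\<Sum>i\<in>?A. formal_sum (f i) J - (\<Sum>j\<in>?B. f i j))"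
    by (rule rho_order_sum, rule formal_sum_truncate) (use P AB o s in auto)
  have 3: "rho_order g V (of_nat N) (formal_sum (case_prod f) (I \<times> J) - (\<Sum>p\<in>?A \<times> ?B. case_prod f p))"
  proof (rule formal_sum_truncate[OF assms])
    show "finite (?A \<times> ?B)" using P by blast
    show "?A \<times> ?B \<subseteq> I \<times> J" using AB by blast
    fix p assume "p \<in> I \<times> J - ?A \<times> ?B"
    then show "rho_order g V (of_nat N) (case_prod f p)" using o by (cases p) auto
  qed
  show "rho_order g V (of_nat N) (formal_sum (\<lambda>i. formal_sum (f i) J) I - formal_sum (case_prod f) (I \<times> J))"
    using rho_order_diff[OF rho_order_add[OF 1 2] 3]
    by (simp add: sum_subtractf sum.cartesian_product)
qed

lemma formal_sum_bij:
  assumes "bij_betw h I J"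
  shows "formal_sum (\<lambda>i. F (h i)) I = formal_sum F J"
proof -
  have "(\<Sum>i | i \<in> I \<and> fcoeff (F (h i)) e \<noteq> 0. fcoeff (F (h i)) e) =
      (\<Sum>j | j \<in> J \<and> fcoeff (F j) e \<noteq> 0. fcoeff (F j) e)" for e
    by (rule sum.reindex_bij_betw[of h], rule bij_betw_subset[OF assms])
       (use assms in \<open>auto simp: bij_betw_def\<close>)
  then show ?thesis by (simp add: formal_sum_def)
qed

lemma rho_summable_swap:
  assumes "rho_summable g V (case_prod f) (I \<times> J)"
  shows "rho_summable g V (\<lambda>(j, i). f i j) (J \<times> I)"
proof -
  have "{p \<in> J \<times> I. \<not> rho_order g V (of_nat N) (case p of (j, i) \<Rightarrow> f i j)} =
      prod.swap ` {p \<in> I \<times> J. \<not> rho_order g V (of_nat N) (case_prod f p)}" for N :: nat by force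
  then show ?thesis using assms unfolding rho_summable_def by auto
qed

lemma formal_sum_swap:
  assumes "rho_summable g V (case_prod f) (I \<times> J)"
  shows "formal_sum (\<lambda>i. formal_sum (f i) J) I = formal_sum (\<lambda>j. formal_sum (\<lambda>i. f i j) I) J"
proof -
  have "formal_sum (\<lambda>j. formal_sum (\<lambda>i. f i j) I) J = formal_sum (\<lambda>(j, i). f i j) (J \<times> I)"
    by (rule formal_sum_Sigma[OF rho_summable_swap[OF assms]])
  also have "\<dots> = formal_sum (\<lambda>p. case_prod f (prod.swap p)) (J \<times> I)"
    by (rule formal_sum_cong) auto
  also have "\<dots> = formal_sum (case_prod f) (I \<times> J)"
    by (rule formal_sum_bij) (simp add: bij_betw_def product_swap)
  finally show ?thesis by (simp add: formal_sum_Sigma[OF assms])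
qed

section \<open>The geometric series of a matrix\<close>

definition index_order :: "int \<times> nat \<Rightarrow> real" where
  "index_order k = (of_nat (snd k) + 1) / 2"

lemma index_order_nonneg: "0 \<le> index_order k" and index_order_half: "1 / 2 \<le> index_order k"
  by (simp_all add: index_order_def)

lemma finite_index_order: "finite {k \<in> indices g. index_order k < of_nat N}"
proof (rule finite_subset)
  show "{k \<in> indices g. index_order k < of_nat N} \<subseteq> {- int g..int g} \<times> {..<2 * N}"
    by (auto simp: indices_def index_order_def)
qed simp

lemma rho_summable_indices:
  assumes "finite V" "\<And>k. k \<in> indices g \<Longrightarrow> rho_order g V (index_order k) (F k)"
  shows "rho_summable g V F (indices g)"
  by (rule rho_summableI[OF assms index_order_nonneg finite_index_order])

lemma rho_summable_TimesI:
  assumes "finite V" "\<And>i j. i \<in> I \<Longrightarrow> j \<in> J \<Longrightarrow> rho_order g V (p i + q j) (f i j)"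
    "\<And>i. i \<in> I \<Longrightarrow> 0 \<le> p i" "\<And>j. j \<in> J \<Longrightarrow> 0 \<le> q j"
    "\<And>N::nat. finite {i\<in>I. p i < of_nat N}" "\<And>N::nat. finite {j\<in>J. q j < of_nat N}"
  shows "rho_summable g V (case_prod f) (I \<times> J)"
proof (rule rho_summableI[where q = "\<lambda>(i, j). p i + q j"])
  fix N :: nat
  have "{k \<in> I \<times> J. (case k of (i, j) \<Rightarrow> p i + q j) < of_nat N} \<subseteq>
      {i\<in>I. p i < of_nat N} \<times> {j\<in>J. q j < of_nat N}"
    using assms(3,4) by (auto, smt (verit), smt (verit))
  then show "finite {k \<in> I \<times> J. (case k of (i, j) \<Rightarrow> p i + q j) < of_nat N}"
    using assms(5,6) finite_subset by blast
qed (use assms in auto)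

lemma formal_sum_mult_right:
  assumes "rho_summable g V F I" "rho_order g V 0 c"
  shows "formal_sum (\<lambda>i. F i * c) I = formal_sum F I * c"
  using formal_sum_mult_left[OF assms] by (simp add: mult.commute)

lemma finite_real_less: "finite {k \<in> A. real k < of_nat N}"
  by (rule finite_subset[of _ "{..<N}"]) auto

text \<open>
  Each factor \<open>P\<close> raises the order by at least one, so iterating \<open>y = k + P y\<close> determines \<open>y\<close>.
\<close>

context
  fixes g :: nat and V :: "var set" and P :: fmatrix
  assumes V: "finite V"
    and P: "\<And>i j. i \<in> indices g \<Longrightarrow> j \<in> indices g \<Longrightarrow> rho_order g V (index_order i + index_order j) (P i j)"
begin

lemma rho_order_mat_power:
  "i \<in> indices g \<Longrightarrow> j \<in> indices g \<Longrightarrow> rho_order g V (of_nat k) (mat_power g P k i j)"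
proof (induction k arbitrary: i j)
  case (Suc k)
  have o: "rho_order g V (index_order i + index_order l + of_nat k) (P i l * mat_power g P k l j)"
    if "l \<in> indices g" for l
    by (rule rho_order_mult[OF P Suc.IH]) (use Suc.prems that in auto)
  show ?case unfolding mat_power.simps mat_mult_def
  proof (rule rho_order_formal_sum)
    show "rho_summable g V (\<lambda>l. P i l * mat_power g P k l j) (indices g)"
      by (rule rho_summable_indices[OF V], rule rho_order_le[OF o]) (use index_order_nonneg in \<open>auto simp: add_increasing\<close>)
    show "rho_order g V (of_nat (Suc k)) (P i l * mat_power g P k l j)" if "l \<in> indices g" for l
      by (rule rho_order_le[OF o[OF that]]) (use index_order_half[of i] index_order_half[of l] in simp)
  qed
qed simp

lemma rho_summable_mat_power:
  "i \<in> indices g \<Longrightarrow> j \<in> indices g \<Longrightarrow> rho_summable g V (\<lambda>k. mat_power g P k i j) UNIV"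
  by (rule rho_summableI[where q = of_nat]) (use V rho_order_mat_power finite_real_less in auto)

lemma rho_order_mat_geometric:
  "i \<in> indices g \<Longrightarrow> j \<in> indices g \<Longrightarrow> rho_order g V 0 (mat_geometric g P i j)"
  unfolding mat_geometric_def by (rule rho_order_formal_sum_0[OF rho_summable_mat_power])

context
  fixes y k :: fvector
  assumes y: "\<And>i. i \<in> indices g \<Longrightarrow> rho_order g V 0 (y i)"
    and k: "\<And>i. i \<in> indices g \<Longrightarrow> rho_order g V (index_order i) (k i)"
    and eq: "\<And>i. i \<in> indices g \<Longrightarrow> y i = k i + formal_sum (\<lambda>j. P i j * y j) (indices g)"
begin

definition neumann_term :: "nat \<Rightarrow> fvector" where
  "neumann_term n i = formal_sum (\<lambda>j. mat_power g P n i j * k j) (indices g)"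

primrec neumann_rest :: "nat \<Rightarrow> fvector" where
  "neumann_rest 0 = y"
| "neumann_rest (Suc n) = (\<lambda>i. formal_sum (\<lambda>l. P i l * neumann_rest n l) (indices g))"

lemma rho_summable_neumann_term:
  assumes "i \<in> indices g"
  shows "rho_summable g V (\<lambda>j. mat_power g P n i j * k j) (indices g)"
  by (rule rho_summable_indices[OF V], rule rho_order_multI[OF rho_order_mat_power k]) (use assms in auto)

lemma rho_order_neumann_term:
  assumes "i \<in> indices g" shows "rho_order g V (of_nat n) (neumann_term n i)"
  unfolding neumann_term_def
  by (rule rho_order_formal_sum[OF rho_summable_neumann_term[OF assms]],
      rule rho_order_multI[OF rho_order_mat_power k]) (use assms index_order_nonneg in auto)

lemma rho_summable_P_mult:
  assumes "\<And>l. l \<in> indices g \<Longrightarrow> rho_order g V 0 (z l)" "i \<in> indices g"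
  shows "rho_summable g V (\<lambda>l. P i l * z l) (indices g)"
  by (rule rho_summable_indices[OF V], rule rho_order_multI[OF P assms(1)])
     (use assms(2) index_order_nonneg in auto)

lemma rho_order_neumann_rest:
  "i \<in> indices g \<Longrightarrow> rho_order g V (of_nat n) (neumann_rest n i)"
proof (induction n arbitrary: i)
  case (Suc n)
  have "rho_order g V 0 (neumann_rest n l)" if "l \<in> indices g" for l
    by (rule rho_order_le[OF Suc.IH]) (use that in auto)
  then show ?case unfolding neumann_rest.simps
    by (intro rho_order_formal_sum rho_summable_P_mult Suc.prems rho_order_multI[OF P Suc.IH])
       (use Suc.prems index_order_half[of i] in \<open>auto, smt (verit) index_order_half field_sum_of_halves\<close>)
qed (simp add: y)

lemma neumann_term_0: "i \<in> indices g \<Longrightarrow> neumann_term 0 i = k i"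
  unfolding neumann_term_def by (subst formal_sum_single[of i]) auto

lemma neumann_term_Suc:
  assumes "i \<in> indices g"
  shows "neumann_term (Suc n) i = formal_sum (\<lambda>l. P i l * neumann_term n l) (indices g)"
proof -
  let ?I = "indices g" and ?M = "mat_power g P n"
  have s: "rho_summable g V (\<lambda>(j, l). P i l * ?M l j * k j) (?I \<times> ?I)"
  proof (rule rho_summable_TimesI[OF V])
    show "rho_order g V (index_order j + index_order l) (P i l * ?M l j * k j)"
      if "j \<in> ?I" "l \<in> ?I" for j l
      by (rule rho_order_multI[OF rho_order_mult[OF P rho_order_mat_power] k])
         (use that assms index_order_nonneg[of i] in auto)
  qed (use index_order_nonneg finite_index_order in auto)
  have "neumann_term (Suc n) i = formal_sum (\<lambda>j. formal_sum (\<lambda>l. P i l * ?M l j * k j) ?I) ?I"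
    unfolding neumann_term_def mat_power.simps mat_mult_def
  proof (rule formal_sum_cong, rule formal_sum_mult_right[symmetric])
    fix j assume j: "j \<in> ?I"
    show "rho_summable g V (\<lambda>l. P i l * ?M l j) ?I"
      by (rule rho_summable_P_mult[OF _ assms], rule rho_order_le[OF rho_order_mat_power]) (use j in auto)
    show "rho_order g V 0 (k j)" by (rule rho_order_le[OF k[OF j] index_order_nonneg])
  qed
  also have "\<dots> = formal_sum (\<lambda>l. formal_sum (\<lambda>j. P i l * ?M l j * k j) ?I) ?I"
    by (rule formal_sum_swap[OF s])
  also have "\<dots> = formal_sum (\<lambda>l. P i l * neumann_term n l) ?I"
    unfolding neumann_term_def mult.assoc
    by (rule formal_sum_cong, rule formal_sum_mult_left[OF rho_summable_neumann_term],
        assumption, rule rho_order_le[OF P])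
       (use assms index_order_nonneg in \<open>auto simp: add_nonneg_nonneg\<close>)
  finally show ?thesis .
qed

lemma neumann_expansion:
  "i \<in> indices g \<Longrightarrow> y i = (\<Sum>m<n. neumann_term m i) + neumann_rest n i"
proof (induction n arbitrary: i)
  case (Suc n)
  let ?I = "indices g"
  have t: "rho_order g V 0 (neumann_term m l)" if "l \<in> ?I" for m l
    by (rule rho_order_le[OF rho_order_neumann_term[OF that]]) simp
  have r: "rho_order g V 0 (neumann_rest n l)" if "l \<in> ?I" for l
    by (rule rho_order_le[OF rho_order_neumann_rest[OF that]]) simp
  have st: "rho_summable g V (\<lambda>l. P i l * neumann_term m l) ?I" for m
    by (rule rho_summable_P_mult[OF t Suc.prems])
  note ss = formal_sum_sum[where T = "{..<n}" and F = "\<lambda>m l. P i l * neumann_term m l" and V = V, OF _ V st]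
  have "y i = k i + formal_sum (\<lambda>l. P i l * y l) ?I" by (rule eq[OF Suc.prems])
  also have "formal_sum (\<lambda>l. P i l * y l) ?I =
      formal_sum (\<lambda>l. (\<Sum>m<n. P i l * neumann_term m l) + P i l * neumann_rest n l) ?I"
    by (rule formal_sum_cong, subst Suc.IH) (simp_all add: distrib_left sum_distrib_left)
  also have "\<dots> = formal_sum (\<lambda>l. \<Sum>m<n. P i l * neumann_term m l) ?I + neumann_rest (Suc n) i"
    using formal_sum_add[OF conjunct2[OF ss] rho_summable_P_mult[OF r Suc.prems]] by simp
  also have "formal_sum (\<lambda>l. \<Sum>m<n. P i l * neumann_term m l) ?I = (\<Sum>m<n. neumann_term (Suc m) i)"
    using ss by (simp add: neumann_term_Suc Suc.prems)
  finally show ?case using Suc.prems by (simp add: sum.lessThan_Suc_shift neumann_term_0 del: sum.lessThan_Suc)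
qed simp

lemma mat_geometric_solves:
  assumes "i \<in> indices g"
  shows "formal_sum (\<lambda>j. mat_geometric g P i j * k j) (indices g) = y i"
proof -
  let ?I = "indices g"
  have s: "rho_summable g V (\<lambda>(j, n). mat_power g P n i j * k j) (?I \<times> UNIV)"
    by (rule rho_summable_TimesI[where p = index_order and q = of_nat, OF V],
        rule rho_order_multI[OF rho_order_mat_power k])
       (use assms index_order_nonneg finite_index_order finite_real_less in auto)
  have st: "rho_summable g V (\<lambda>n. neumann_term n i) UNIV"
    by (rule rho_summableI[where q = of_nat])
       (use V rho_order_neumann_term[OF assms] finite_real_less in auto)
  have "formal_sum (\<lambda>j. mat_geometric g P i j * k j) ?I =
      formal_sum (\<lambda>j. formal_sum (\<lambda>n. mat_power g P n i j * k j) UNIV) ?I"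
    unfolding mat_geometric_def
    by (rule formal_sum_cong, rule formal_sum_mult_right[symmetric, OF rho_summable_mat_power rho_order_le[OF k]])
       (use assms index_order_nonneg in auto)
  also have "\<dots> = formal_sum (\<lambda>n. neumann_term n i) UNIV"
    unfolding neumann_term_def by (rule formal_sum_swap[OF s])
  also have "\<dots> = y i"
  proof (rule eq_if_rho_order_diff[of g V])
    fix N :: nat
    have "rho_order g V (of_nat N) (formal_sum (\<lambda>n. neumann_term n i) UNIV - (\<Sum>n<N. neumann_term n i))"
      by (rule formal_sum_truncate[OF st]) (auto intro: rho_order_le[OF rho_order_neumann_term[OF assms]])
    from rho_order_diff[OF this rho_order_neumann_rest[OF assms, of N]]
    show "rho_order g V (of_nat N) (formal_sum (\<lambda>n. neumann_term n i) UNIV - y i)"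
      by (subst neumann_expansion[OF assms, of N]) (simp add: diff_diff_eq)
  qed
  finally show ?thesis .
qed

end

lemma rho_order_row_mult_geometric:
  assumes u: "\<And>i. i \<in> indices g \<Longrightarrow> rho_order g V (index_order i) (u i)" and "j \<in> indices g"
  shows "rho_summable g V (\<lambda>i. u i * mat_geometric g P i j) (indices g)"
    and "rho_order g V 0 (row_mult g u (mat_geometric g P) j)"
proof -
  show *: "rho_summable g V (\<lambda>i. u i * mat_geometric g P i j) (indices g)"
    by (rule rho_summable_indices[OF V], rule rho_order_multI[OF u rho_order_mat_geometric]) (use assms in auto)
  show "rho_order g V 0 (row_mult g u (mat_geometric g P) j)"
    unfolding row_mult_def by (rule rho_order_formal_sum_0[OF *])
qed

text \<open>
  A solution \<open>y\<close> is the geometric series applied to \<open>k\<close>. That the row vector may be multiplied with the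
  series first is an interchange of two infinite sums.
\<close>

theorem neumann_dot:
  assumes u: "\<And>i. i \<in> indices g \<Longrightarrow> rho_order g V (index_order i) (u i)"
    and y: "\<And>i. i \<in> indices g \<Longrightarrow> rho_order g V 0 (y i)"
    and k: "\<And>i. i \<in> indices g \<Longrightarrow> rho_order g V (index_order i) (k i)"
    and eq: "\<And>i. i \<in> indices g \<Longrightarrow> y i = k i + formal_sum (\<lambda>j. P i j * y j) (indices g)"
  shows "dot g (row_mult g u (mat_geometric g P)) k = dot g u y"
proof -
  let ?I = "indices g" and ?G = "mat_geometric g P"
  have s: "rho_summable g V (\<lambda>(j, i). u i * ?G i j * k j) (?I \<times> ?I)"
    by (rule rho_summable_TimesI[where p = index_order and q = index_order, OF V],
        rule rho_order_multI[OF rho_order_mult[OF u rho_order_mat_geometric] k])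
       (use index_order_nonneg finite_index_order in auto)
  have "dot g (row_mult g u ?G) k = formal_sum (\<lambda>j. formal_sum (\<lambda>i. u i * ?G i j * k j) ?I) ?I"
    unfolding dot_def row_mult_def
    by (rule formal_sum_cong, rule formal_sum_mult_right[symmetric, OF rho_order_row_mult_geometric(1)[OF u]
          rho_order_le[OF k]]) (use index_order_nonneg in auto)
  also have "\<dots> = formal_sum (\<lambda>i. formal_sum (\<lambda>j. u i * ?G i j * k j) ?I) ?I"
    by (rule formal_sum_swap[OF s])
  also have "\<dots> = dot g u y"
    unfolding dot_def
  proof (rule formal_sum_cong)
    fix i assume i: "i \<in> ?I"
    have "formal_sum (\<lambda>j. u i * (?G i j * k j)) ?I = u i * formal_sum (\<lambda>j. ?G i j * k j) ?I"
      by (rule formal_sum_mult_left, rule rho_summable_indices[OF V],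
          rule rho_order_multI[OF rho_order_mat_geometric k])
         (use i rho_order_le[OF u[OF i] index_order_nonneg] in auto)
    then show "formal_sum (\<lambda>j. u i * ?G i j * k j) ?I = u i * y i"
      using mat_geometric_solves[OF y k eq i] by (simp add: mult.assoc)
  qed
  finally show ?thesis .
qed

end

section \<open>Expansions of the Cauchy kernel\<close>

text \<open>Coefficient \<open>m\<close>, \<open>j\<close> of the Taylor expansion of \<open>1/(u - v)\<close> in shifts of \<open>u\<close> and of \<open>v\<close>.\<close>

definition cauchy :: "nat \<Rightarrow> nat \<Rightarrow> var \<Rightarrow> var \<Rightarrow> var fseries" where
  "cauchy m j u v = fconst (1 / (fact m * fact j)) * (pd u ^^ m) ((pd v ^^ j) (recip_diff u v))"

lemma admissible_geometric:
  assumes "u < (v::var)"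
  shows "admissible {single u (- of_nat k - 1) + single v (of_nat k) | k::nat. True}"
    (is "admissible ?S")
  unfolding admissible_def
proof (intro conjI allI)
  show "\<exists>V. finite V \<and> (\<forall>e\<in>?S. keys e \<subseteq> V)"
    by (rule exI[of _ "{u, v}"]) (auto simp: in_keys_iff lookup_add lookup_single when_def split: if_splits)
  show "\<exists>B. finite B \<and> (\<forall>e\<in>?S. (\<forall>t>w. lookup e t = c t) \<longrightarrow>
           (\<exists>b\<in>B. \<exists>k::nat. lookup e w = b + of_nat k / 2))" for w c
  proof (cases "w = v")
    case True
    have "\<exists>l::nat. of_nat k = of_nat l / (2::complex)" for k :: nat by (rule exI[of _ "2 * k"]) simp
    then show ?thesis using assms True
      by (intro exI[of _ "{0}"]) (auto simp: lookup_add lookup_single)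
  next
    case False
    have "lookup e w \<in> {0, - c v - 1}" if e: "e \<in> ?S" "\<forall>t>w. lookup e t = c t" for e
    proof -
      obtain k :: nat where k: "e = single u (- of_nat k - 1) + single v (of_nat k)"
        using e(1) by blast
      show ?thesis
      proof (cases "w = u")
        case True
        then have "c v = of_nat k" using e(2)[rule_format, of v] assms by (simp add: k lookup_add lookup_single)
        then show ?thesis using True False by (simp add: k lookup_add lookup_single)
      qed (use False in \<open>simp add: k lookup_add lookup_single\<close>)
    qed
    then show ?thesis by (intro exI[of _ "{0, - c v - 1}"]) (force intro: exI[of _ "0::nat"])
  qed
qed

lemma fcoeff_recip_diff:
  assumes "u < (v::var)"
  shows "fcoeff (recip_diff u v) e =
    (if \<exists>k::nat. e = single u (- of_nat k - 1) + single v (of_nat k) then 1 else 0)"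
proof -
  let ?E = "\<lambda>k::nat. single u (- of_nat k - 1) + single v (of_nat k :: complex)"
  let ?F = "\<lambda>k::nat. vpow u (- of_nat k - 1) * vpow v (of_nat k)"
  have F: "fcoeff (?F k) e = (if e = ?E k then 1 else 0)" for k e
    by (simp add: fcoeff_vpow_mult fcoeff_vpow diff_eq_eq add.commute)
  have inj: "k = l" if "?E k = ?E l" for k l
    using arg_cong[OF that, of "\<lambda>e. lookup e v"] assms by (simp add: lookup_add lookup_single)
  have sum: "(\<Sum>i | i \<in> UNIV \<and> fcoeff (?F i) e \<noteq> 0. fcoeff (?F i) e) = (if \<exists>k. e = ?E k then 1 else 0)" for e
  proof (cases "\<exists>k. e = ?E k")
    case True
    then obtain k where k: "e = ?E k" by blast
    have "{i. i \<in> UNIV \<and> fcoeff (?F i) e \<noteq> 0} = {k}" using inj by (auto simp: F k)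
    then show ?thesis using True by (simp add: F k)
  qed (simp add: F)
  have "admissible {e. (if \<exists>k. e = ?E k then 1 else (0::complex)) \<noteq> 0}"
    by (rule admissible_subset[OF admissible_geometric[OF assms]]) auto
  then show ?thesis using assms unfolding recip_diff_def formal_sum_def sum
    by (simp add: fcoeff_series)
qed

lemma recip_diff_swap: "v < (u::var) \<Longrightarrow> recip_diff u v = - recip_diff v u"
  by (auto simp: recip_diff_def)

lemma fcoeff_recip_diff_keys:
  assumes "u \<noteq> (v::var)" "fcoeff (recip_diff u v) e \<noteq> 0" shows "keys e \<subseteq> {u, v}"
proof -
  have *: "keys e \<subseteq> {u, v}" if "u < v" "fcoeff (recip_diff u v) e \<noteq> 0" for u v :: var
    using that by (auto simp: fcoeff_recip_diff in_keys_iff lookup_add lookup_single when_def split: if_splits)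
  show ?thesis
  proof (cases "u < v")
    case False
    then have "v < u" using assms(1) by simp
    then show ?thesis using *[of v u] assms(2) by (auto simp: recip_diff_swap)
  qed (use * assms in blast)
qed

lemma lookup_eq_0_if_var: "keys e \<subseteq> A \<Longrightarrow> v \<notin> A \<Longrightarrow> lookup e v = 0"
  by (auto simp: in_keys_iff)

lemma rho_order_recip_diff:
  assumes "u \<noteq> v" "u \<in> V" "v \<in> V" "var_class u < 4" "var_class v < 4"
  shows "rho_order g V 0 (recip_diff u v)"
  unfolding rho_order_def
proof (intro allI impI)
  fix e assume "fcoeff (recip_diff u v) e \<noteq> 0"
  then have k: "keys e \<subseteq> {u, v}" by (rule fcoeff_recip_diff_keys[OF assms(1)])
  have 0: "lookup e t = 0" if "4 \<le> var_class t" for t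
    by (rule lookup_eq_0_if_var[OF k]) (use that assms in auto)
  then show "keys e \<subseteq> V \<and>
     (\<forall>u. 4 \<le> var_class u \<longrightarrow> (\<exists>k::nat. lookup e u = of_nat k / 2)) \<and> 0 \<le> rho_degree g e"
    using k assms by (auto simp: rho_degree_def intro: exI[of _ "0::nat"])
qed

lemma rho_order_cauchy:
  assumes "u \<noteq> v" "u \<in> V" "v \<in> V" "var_class u < 4" "var_class v < 4"
  shows "rho_order g V 0 (cauchy m j u v)"
  unfolding cauchy_def
  by (rule rho_order_multI[OF rho_order_fconst rho_order_pd_funpow[OF rho_order_pd_funpow[OF rho_order_recip_diff]]])
     (use assms in auto)

lemma fcoeff_cauchy:
  assumes "u \<noteq> v"
  shows "fcoeff (cauchy m j u v) e =
    ((lookup e u + of_nat m) gchoose m) * ((lookup e v + of_nat j) gchoose j) *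
    fcoeff (recip_diff u v) (e + single u (of_nat m) + single v (of_nat j))"
  using assms
  by (simp add: cauchy_def fcoeff_fconst_mult fcoeff_pd_funpow lookup_add lookup_single gbinomial_pochhammer' ac_simps)

text \<open>
  The index \<open>k\<close> is the exponent of the smaller variable in the geometric series, before
  differentiation. The two lemmas differ in which of the variables is the smaller one.
\<close>

lemma fcoeff_cauchy_mult_less:
  fixes u v :: var and m j :: nat
  assumes "u < v"
  defines "E \<equiv> \<lambda>k::nat. single u (- of_nat k - 1 - of_nat m) + single v (of_nat k - of_nat j)"
    and "c \<equiv> \<lambda>k::nat. ((- of_nat k - 1) gchoose m) * (of_nat k gchoose j) :: complex"
  shows "finite {k. c k * fcoeff f (e - E k) \<noteq> 0}"
    and "fcoeff (cauchy m j u v * f) e = Sum_any (\<lambda>k. c k * fcoeff f (e - E k))"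
proof -
  have ne: "u \<noteq> v" using assms(1) by simp
  have inj: "inj E"
  proof (rule injI)
    fix k l assume "E k = E l"
    from arg_cong[OF this, of "\<lambda>e. lookup e v"] show "k = l"
      using ne by (simp add: E_def lookup_add lookup_single)
  qed
  have shift: "e + single u (of_nat m) + single v (of_nat j) =
      single u (- of_nat k - 1) + single v (of_nat k) \<longleftrightarrow> e = E k" for e k
  proof -
    have "E k + single u (of_nat m) + single v (of_nat j) =
        single u (- of_nat k - 1) + single v (of_nat k)"
      by (simp add: E_def single_diff)
    from this[symmetric] show ?thesis by (simp only: add_right_cancel)
  qed
  have 1: "fcoeff (cauchy m j u v) (E k) = c k" for k
  proof -
    have "fcoeff (recip_diff u v) (E k + single u (of_nat m) + single v (of_nat j)) = 1"
      unfolding fcoeff_recip_diff[OF assms(1)] shift using inj by (auto simp: inj_def)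
    then show ?thesis unfolding fcoeff_cauchy[OF ne] using ne
      by (simp add: c_def E_def lookup_add lookup_single)
  qed
  have 2: "fcoeff (cauchy m j u v) e = 0" if "e \<notin> range E" for e
    unfolding fcoeff_cauchy[OF ne] fcoeff_recip_diff[OF assms(1)] shift using that by auto
  show "finite {k. c k * fcoeff f (e - E k) \<noteq> 0}"
    "fcoeff (cauchy m j u v * f) e = Sum_any (\<lambda>k. c k * fcoeff f (e - E k))"
    by (rule fcoeff_mult_indexed[OF inj 1 2]; simp)+
qed

lemma fcoeff_cauchy_mult_greater:
  fixes u v :: var and m j :: nat
  assumes "v < u"
  defines "E \<equiv> \<lambda>k::nat. single u (of_nat k - of_nat m) + single v (- of_nat k - 1 - of_nat j)"
    and "c \<equiv> \<lambda>k::nat. - ((of_nat k gchoose m) * ((- of_nat k - 1) gchoose j)) :: complex"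
  shows "finite {k. c k * fcoeff f (e - E k) \<noteq> 0}"
    and "fcoeff (cauchy m j u v * f) e = Sum_any (\<lambda>k. c k * fcoeff f (e - E k))"
proof -
  have "cauchy m j u v = - cauchy j m v u"
    by (rule fseries_eqI)
       (use assms(1) in \<open>simp add: fcoeff_cauchy recip_diff_swap ac_simps\<close>)
  then have eq: "fcoeff (cauchy m j u v * f) e = - fcoeff (cauchy j m v u * f) e" by simp
  note * = fcoeff_cauchy_mult_less[OF assms(1), of j m f e]
  have c: "c k * fcoeff f (e - E k) = - (((- of_nat k - 1) gchoose j) * (of_nat k gchoose m) *
      fcoeff f (e - (single v (- of_nat k - 1 - of_nat j) + single u (of_nat k - of_nat m))))" for k
    by (simp add: c_def E_def ac_simps)
  show "finite {k. c k * fcoeff f (e - E k) \<noteq> 0}" unfolding c using *(1) by simp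
  show "fcoeff (cauchy m j u v * f) e = Sum_any (\<lambda>k. c k * fcoeff f (e - E k))"
    unfolding c eq *(2) using *(1) by (simp add: Sum_any.expand_set sum_negf)
qed

lemma pi1_deriv_0:
  assumes "x \<noteq> A0"
  shows "pi1_deriv m 0 x y = cauchy m 0 x y - cauchy m 0 x A0"
  by (simp add: pi1_deriv_def cauchy_def pi1_def pd_funpow_minus right_diff_distrib)

lemma pi1_deriv_Suc:
  assumes "x \<noteq> A0" "y \<noteq> A0" "x \<noteq> y"
  shows "pi1_deriv m (Suc j) x y = cauchy m (Suc j) x y"
proof -
  have "pd y (recip_diff x A0) = 0"
    by (rule pd_eq_0, rule lookup_eq_0_if_var[OF fcoeff_recip_diff_keys[of x A0]]) (use assms in auto)
  then have "(pd y ^^ Suc j) (recip_diff x A0) = 0" by (simp only: funpow_Suc_right o_def) simp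
  then show ?thesis
    unfolding pi1_deriv_def cauchy_def pi1_def pd_funpow_minus[of "Suc j"] by simp
qed

lemma f0_deriv_eq: "f0_deriv m x = - cauchy m 0 x A0"
  by (simp add: f0_deriv_def cauchy_def pd_funpow_uminus)

lemma rho_order_pi1_deriv:
  assumes "x \<noteq> y" "x \<noteq> A0" "y \<noteq> A0" "{x, y, A0} \<subseteq> V" "var_class x < 4" "var_class y < 4"
  shows "rho_order g V 0 (pi1_deriv m j x y)"
  by (cases j) (use assms in \<open>auto simp: pi1_deriv_0 pi1_deriv_Suc intro!: rho_order_diff rho_order_cauchy\<close>)

lemma rho_order_f0_deriv:
  assumes "x \<noteq> A0" "{x, A0} \<subseteq> V" "var_class x < 4"
  shows "rho_order g V 0 (f0_deriv m x)"
  using assms by (auto simp: f0_deriv_eq intro!: rho_order_cauchy)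

section \<open>The Heisenberg action on Fock space\<close>

definition mdeg :: "nat multiset \<Rightarrow> nat" where
  "mdeg \<mu> = (\<Sum>i\<in>#\<mu>. Suc i)"

lemma mdeg_empty [simp]: "mdeg {#} = 0" and mdeg_add_mset [simp]: "mdeg (add_mset i \<mu>) = Suc i + mdeg \<mu>"
  by (simp_all add: mdeg_def)

lemma homogeneous_iff: "homogeneous k v \<longleftrightarrow> (\<forall>\<mu>. lookup v \<mu> \<noteq> 0 \<longrightarrow> mdeg \<mu> = k)"
  by (auto simp: homogeneous_def mdeg_def in_keys_iff)

lemma finite_mdeg_le: "finite {\<mu>. mdeg \<mu> \<le> d}"
proof (induction d)
  case 0
  have "{\<mu>. mdeg \<mu> \<le> 0} \<subseteq> {{#}}"
  proof (rule subsetI)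
    fix \<mu> :: "nat multiset" assume "\<mu> \<in> {\<mu>. mdeg \<mu> \<le> 0}"
    then show "\<mu> \<in> {{#}}" by (cases \<mu>) auto
  qed
  then show ?case by (rule finite_subset) simp
next
  case (Suc d)
  have "{\<mu>. mdeg \<mu> \<le> Suc d} \<subseteq> insert {#} (\<Union>i\<le>d. add_mset i ` {\<mu>. mdeg \<mu> \<le> d})"
  proof (rule subsetI)
    fix \<mu> :: "nat multiset" assume \<mu>: "\<mu> \<in> {\<mu>. mdeg \<mu> \<le> Suc d}"
    show "\<mu> \<in> insert {#} (\<Union>i\<le>d. add_mset i ` {\<mu>. mdeg \<mu> \<le> d})"
    proof (cases \<mu>)
      case (add i \<nu>)
      then have "i \<in> {..d}" "\<nu> \<in> {\<mu>. mdeg \<mu> \<le> d}" using \<mu> by auto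
      then show ?thesis unfolding add by blast
    qed simp
  qed
  then show ?case by (rule finite_subset) (use Suc in auto)
qed

lemma finite_mdeg: "finite {\<mu>. mdeg \<mu> = d}"
  by (rule finite_subset[OF _ finite_mdeg_le[of d]]) auto

lemma fock_expansion: "v = (\<Sum>\<nu>\<in>keys v. single \<nu> (lookup v \<nu>))"
proof (rule poly_mapping_eqI)
  fix \<mu>
  show "lookup v \<mu> =
      lookup (\<Sum>\<nu>\<in>keys v. single \<nu> (lookup v \<nu>)) \<mu>"
    by (simp add: lookup_sum lookup_single when_def sum.delta' in_keys_iff)
qed

lemma lookup_single_mult:
  fixes v :: fock
  shows "lookup (single \<kappa> c * v) \<mu> =
    (if \<kappa> \<subseteq># \<mu> then c * lookup v (\<mu> - \<kappa>) else 0)"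
proof -
  have eq: "\<kappa> + \<nu> = \<mu> \<longleftrightarrow> \<kappa> \<subseteq># \<mu> \<and> \<nu> = \<mu> - \<kappa>" for \<nu>
    by (metis add_diff_cancel_left' mset_subset_eq_add_left subset_mset.add_diff_inverse)
  have "single \<kappa> c * v =
      (\<Sum>\<nu>\<in>keys v. single (\<kappa> + \<nu>) (c * lookup v \<nu>))"
    by (subst fock_expansion[of v]) (simp add: sum_distrib_left mult_single)
  then have "lookup (single \<kappa> c * v) \<mu> =
      (\<Sum>\<nu>\<in>keys v. if \<kappa> \<subseteq># \<mu> \<and> \<nu> = \<mu> - \<kappa> then c * lookup v \<nu> else 0)"
    by (simp add: lookup_sum lookup_single when_def eq)
  also have "\<dots> = (if \<kappa> \<subseteq># \<mu> then c * lookup v (\<mu> - \<kappa>) else 0)"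
    by (auto simp: sum.delta in_keys_iff)
  finally show ?thesis .
qed

lemma lookup_fscale [simp]: "lookup (fscale c v) \<mu> = c * lookup v \<mu>"
  by (simp add: fscale_def lookup_single_mult)

lemma fscale_single: "fscale c (single \<mu> d) = single \<mu> (c * d)"
  by (simp add: fscale_def mult_single)

lemma lookup_heis_neg:
  "n < 0 \<Longrightarrow> lookup (heis \<beta> n v) \<mu> =
    (if nat (- n) - 1 \<in># \<mu> then lookup v (\<mu> - {#nat (- n) - 1#}) else 0)"
  by (simp add: heis_def lookup_single_mult)

lemma lookup_heis_0: "lookup (heis \<beta> 0 v) \<mu> = \<beta> * lookup v \<mu>"
  by (simp add: heis_def)

lemma lookup_heis_pos:
  assumes "n > 0"
  shows "lookup (heis \<beta> n v) \<mu> =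
    of_int n * of_nat (Suc (count \<mu> (nat n - 1))) * lookup v (add_mset (nat n - 1) \<mu>)"
proof -
  let ?k = "nat n - 1"
  let ?f = "\<lambda>\<nu>. if \<nu> - {#?k#} = \<mu> then of_int n * of_nat (count \<nu> ?k) * lookup v \<nu> else 0"
  have "lookup (heis \<beta> n v) \<mu> = (\<Sum>\<nu>\<in>keys v. ?f \<nu>)"
    using assms by (simp add: heis_def lookup_sum lookup_single when_def cong: if_cong)
  also have "\<dots> = (\<Sum>\<nu>\<in>insert (add_mset ?k \<mu>) (keys v). ?f \<nu>)"
    by (rule sum.mono_neutral_left) (auto simp: in_keys_iff)
  also have "\<dots> = (\<Sum>\<nu>\<in>{add_mset ?k \<mu>}. ?f \<nu>)"
  proof (rule sum.mono_neutral_right)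
    show "\<forall>\<nu>\<in>insert (add_mset ?k \<mu>) (keys v) - {add_mset ?k \<mu>}. ?f \<nu> = 0"
    proof
      fix \<nu> assume "\<nu> \<in> insert (add_mset ?k \<mu>) (keys v) - {add_mset ?k \<mu>}"
      then show "?f \<nu> = 0" by (cases "?k \<in># \<nu>") (auto simp: not_in_iff)
    qed
  qed auto
  finally show ?thesis by simp
qed

lemmas lookup_heis = lookup_heis_neg lookup_heis_0 lookup_heis_pos

lemma heis_fscale: "heis \<beta> n (fscale c v) = fscale c (heis \<beta> n v)"
  by (rule poly_mapping_eqI, cases n "0::int" rule: linorder_cases)
     (simp_all add: lookup_heis)

lemma heis_zero [simp]: "heis \<beta> n 0 = 0"
  using heis_fscale[of \<beta> n 0 0] by simp

lemma lookup_heis_imp: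
  assumes "lookup (heis \<beta> n v) \<mu> \<noteq> 0"
  obtains \<nu> where "lookup v \<nu> \<noteq> 0" "int (mdeg \<mu>) + n = int (mdeg \<nu>)"
proof (cases n "0::int" rule: linorder_cases)
  case less
  then have n: "nat (- n) - 1 \<in># \<mu>" "lookup v (\<mu> - {#nat (- n) - 1#}) \<noteq> 0"
    using assms by (auto simp: lookup_heis split: if_splits)
  then have "mdeg \<mu> = Suc (nat (- n) - 1) + mdeg (\<mu> - {#nat (- n) - 1#})"
    using mdeg_add_mset[of "nat (- n) - 1" "\<mu> - {#nat (- n) - 1#}"] by simp
  then show ?thesis using that[OF n(2)] less by linarith
next
  case equal
  then show ?thesis using that[of \<mu>] assms by (simp add: lookup_heis)
next
  case greater
  then have "lookup v (add_mset (nat n - 1) \<mu>) \<noteq> 0" using assms by (simp add: lookup_heis)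
  from that[OF this] show ?thesis using greater by simp
qed

lemma homogeneous_heis:
  "homogeneous d v \<Longrightarrow> int d' = int d - n \<Longrightarrow> homogeneous d' (heis \<beta> n v)"
  unfolding homogeneous_iff by (force elim!: lookup_heis_imp)

lemma heis_eq_0:
  assumes "\<And>\<mu>. lookup v \<mu> \<noteq> 0 \<Longrightarrow> int (mdeg \<mu>) < n" shows "heis \<beta> n v = 0"
proof (rule poly_mapping_eqI, rule ccontr)
  fix \<mu> assume "lookup (heis \<beta> n v) \<mu> \<noteq> lookup 0 \<mu>"
  then have "lookup (heis \<beta> n v) \<mu> \<noteq> 0" by simp
  then show False by (rule lookup_heis_imp) (use assms in force)
qed

lemma heis_eventually_0: "\<exists>J. \<forall>j\<ge>J. heis \<beta> (int j) v = 0"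
proof (intro exI allI impI heis_eq_0)
  fix j \<mu> assume *: "j \<ge> Suc (\<Sum>\<nu>\<in>keys v. mdeg \<nu>)" "lookup v \<mu> \<noteq> 0"
  have "mdeg \<mu> \<le> (\<Sum>\<nu>\<in>keys v. mdeg \<nu>)"
    by (rule member_le_sum) (use * in \<open>auto simp: in_keys_iff\<close>)
  then show "int (mdeg \<mu>) < int j" using * by simp
qed

lemma Sum_any_eq_single:
  assumes "\<And>j. j \<noteq> i \<Longrightarrow> f j = 0" shows "Sum_any f = f i"
  by (subst Sum_any.expand_superset[of "{i}"]) (use assms in auto)

lemma vertex_mono_h: "vertex_mono \<beta> [0] k v = heis \<beta> k v"
proof -
  let ?f = "\<lambda>j::nat. heis \<beta> (- 1 - int j) (if k + int j = - 1 then v else 0) +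
      (if k - 1 - int j = - 1 then heis \<beta> (int j) v else 0)"
  have "vertex_mono \<beta> [0] k v = Sum_any ?f" by simp
  also have "\<dots> = heis \<beta> k v"
  proof (cases "k \<ge> 0")
    case True
    have "Sum_any ?f = ?f (nat k)" by (rule Sum_any_eq_single) (use True in auto)
    then show ?thesis using True by simp
  next
    case False
    have "Sum_any ?f = ?f (nat (- k - 1))" by (rule Sum_any_eq_single) (use False in auto)
    then show ?thesis using False by simp
  qed
  finally show ?thesis .
qed

lemma vertex_h_state: "vertex \<beta> h_state k v = heis \<beta> k v"
  by (simp add: vertex_def h_state_def vertex_mono_h del: vertex_mono.simps)

lemma vertex_vacuum: "vertex \<beta> 1 k v = (if k = -1 then v else 0)"
  by (simp add: vertex_def lookup_one)

lemma mdeg_eq_sum: "set_mset \<mu> \<subseteq> {..<J} \<Longrightarrow> mdeg \<mu> = (\<Sum>i<J. count \<mu> i * Suc i)"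
proof (induction \<mu>)
  case (add i \<mu>)
  have "(\<Sum>l<J. count (add_mset i \<mu>) l * Suc l) = (\<Sum>l<J. count \<mu> l * Suc l + (if l = i then Suc i else 0))"
    by (rule sum.cong) auto
  then show ?case using add by (simp add: sum.distrib)
qed simp

text \<open>
  Normal ordering gives \<open>L(0) = h(0)\<^sup>2/2 + \<Sum>\<^sub>j h(-j)h(j)\<close> with \<open>j > 0\<close>, and on a monomial \<open>h(-j)h(j)\<close>
  is \<open>j\<close> times the number of factors \<open>h(-j)\<close>.
\<close>

lemma lookup_virasoro_0:
  "lookup (virasoro \<beta> 0 v) \<mu> = (\<beta>\<^sup>2 / 2 + of_nat (mdeg \<mu>)) * lookup v \<mu>"
proof -
  obtain J0 where J0: "\<And>j. j \<ge> J0 \<Longrightarrow> heis \<beta> (int j) v = 0" using heis_eventually_0 by blast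
  define J where "J = J0 + Suc (\<Sum>i\<in>#\<mu>. i)"
  have J: "heis \<beta> (int j) v = 0" if "j \<ge> J" for j using J0 that by (simp add: J_def)
  have "\<forall>i\<in>#\<mu>. i \<le> (\<Sum>i\<in>#\<mu>. i)" by (induction \<mu>) auto
  then have set: "set_mset \<mu> \<subseteq> {..<J}" by (auto simp: J_def less_Suc_eq_le trans_le_add2)
  have hh: "lookup (heis \<beta> (- int (Suc j)) (heis \<beta> (int (Suc j)) v)) \<mu> =
      of_nat (count \<mu> j * Suc j) * lookup v \<mu>" for j
  proof -
    have "nat (1 + int j) = Suc j" "nat (int j + 1) = Suc j" by simp_all
    then show ?thesis by (auto simp: lookup_heis not_in_iff algebra_simps)
  qed
  let ?t = "\<lambda>j::nat. heis \<beta> (- 1 - int j) (heis \<beta> (1 + int j) v) + heis \<beta> (- int j) (heis \<beta> (int j) v)"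
  have sum1: "(\<Sum>j<Suc J. lookup (heis \<beta> (- 1 - int j) (heis \<beta> (1 + int j) v)) \<mu>) =
      of_nat (mdeg \<mu>) * lookup v \<mu>"
  proof -
    have "(\<Sum>j<Suc J. lookup (heis \<beta> (- 1 - int j) (heis \<beta> (1 + int j) v)) \<mu>) =
        (\<Sum>j<Suc J. of_nat (count \<mu> j * Suc j) * lookup v \<mu>)"
      by (rule sum.cong[OF refl]) (use hh in \<open>simp add: algebra_simps\<close>)
    also have "\<dots> = of_nat (mdeg \<mu>) * lookup v \<mu>"
      unfolding sum_distrib_right[symmetric] of_nat_sum[symmetric]
      by (subst mdeg_eq_sum[of \<mu> "Suc J"]) (use set in auto)
    finally show ?thesis .
  qed
  have sum2: "(\<Sum>j<Suc J. lookup (heis \<beta> (- int j) (heis \<beta> (int j) v)) \<mu>) =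
      (\<beta>\<^sup>2 + of_nat (mdeg \<mu>)) * lookup v \<mu>"
  proof -
    have "(\<Sum>j<J. lookup (heis \<beta> (- int (Suc j)) (heis \<beta> (int (Suc j)) v)) \<mu>) =
        of_nat (mdeg \<mu>) * lookup v \<mu>"
      unfolding hh sum_distrib_right[symmetric] of_nat_sum[symmetric]
      by (subst mdeg_eq_sum[of \<mu> J]) (use set in auto)
    then show ?thesis
      by (subst sum.lessThan_Suc_shift) (simp add: lookup_heis_0 power2_eq_square algebra_simps)
  qed
  have "virasoro \<beta> 0 v = fscale (1 / 2) (vertex_mono \<beta> [0, 0] 1 v)"
    by (simp add: virasoro_def vertex_def conformal_vector_def)
  also have "vertex_mono \<beta> [0, 0] 1 v = Sum_any ?t"
    by (subst vertex_mono.simps) (simp only: vertex_mono_h, simp)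
  also have "Sum_any ?t = (\<Sum>j<Suc J. ?t j)"
  proof (rule Sum_any.expand_superset)
    show "{j. ?t j \<noteq> 0} \<subseteq> {..<Suc J}"
    proof (rule subsetI, rule ccontr)
      fix j assume "j \<in> {j. ?t j \<noteq> 0}" "j \<notin> {..<Suc J}"
      then show False using J[of j] J[of "Suc j"] by simp
    qed
  qed simp
  finally show ?thesis
    by (simp only: lookup_fscale lookup_sum lookup_add sum.distrib sum1 sum2) (simp add: field_simps)
qed

section \<open>The pairing and dual bases\<close>

text \<open>The pairing is diagonal in the monomials; these are its diagonal entries.\<close>

definition mono_norm :: "nat multiset \<Rightarrow> complex" where
  "mono_norm \<mu> = (\<Prod>i\<in>set_mset \<mu>. (- of_nat (i + 1)) ^ count \<mu> i * fact (count \<mu> i))"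

lemma mono_norm_nonzero: "mono_norm \<mu> \<noteq> 0"
proof -
  have "- of_nat (i + 1) \<noteq> (0 :: complex)" for i by (metis neg_equal_0_iff_equal of_nat_eq_0_iff Suc_eq_plus1 nat.simps(3))
  then show ?thesis by (simp add: mono_norm_def)
qed

lemma mono_norm_add_mset:
  "mono_norm (add_mset k \<mu>) = - of_nat (k + 1) * of_nat (Suc (count \<mu> k)) * mono_norm \<mu>"
proof -
  let ?f = "\<lambda>\<mu> i. (- of_nat (i + 1)) ^ count \<mu> i * fact (count \<mu> i) :: complex"
  have *: "mono_norm \<nu> = ?f \<nu> k * (\<Prod>i\<in>set_mset \<nu> - {k}. ?f \<nu> i)" for \<nu>
    by (cases "k \<in># \<nu>") (simp_all add: mono_norm_def prod.remove not_in_iff)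
  have "(\<Prod>i\<in>set_mset (add_mset k \<mu>) - {k}. ?f (add_mset k \<mu>) i) = (\<Prod>i\<in>set_mset \<mu> - {k}. ?f \<mu> i)"
    by (rule prod.cong) auto
  then show ?thesis unfolding *[of "add_mset k \<mu>"] *[of \<mu>]
    by (simp add: algebra_simps)
qed

lemma pairing_superset:
  assumes "finite S" "keys u \<subseteq> S"
  shows "pairing u v = (\<Sum>\<mu>\<in>S. lookup u \<mu> * lookup v \<mu> * mono_norm \<mu>)"
  unfolding pairing_def mono_norm_def[symmetric]
  by (rule sum.mono_neutral_left) (use assms in \<open>auto simp: in_keys_iff\<close>)

lemma pairing_commute: "pairing u v = pairing v u"
proof -
  let ?S = "keys u \<union> keys v"
  have "pairing u v = (\<Sum>\<mu>\<in>?S. lookup u \<mu> * lookup v \<mu> * mono_norm \<mu>)"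
    by (rule pairing_superset) auto
  moreover have "pairing v u = (\<Sum>\<mu>\<in>?S. lookup v \<mu> * lookup u \<mu> * mono_norm \<mu>)"
    by (rule pairing_superset) auto
  ultimately show ?thesis by (simp add: mult.commute)
qed

lemma pairing_add_right: "pairing u (v + w) = pairing u v + pairing u w"
  by (simp add: pairing_def lookup_add algebra_simps sum.distrib)

lemma pairing_fscale_right: "pairing u (fscale c v) = c * pairing u v"
  by (simp add: pairing_def sum_distrib_left ac_simps)

lemma pairing_zero_right [simp]: "pairing u 0 = 0"
  by (simp add: pairing_def)

lemma pairing_sum_right: "pairing u (sum f A) = (\<Sum>a\<in>A. pairing u (f a))"
  by (induction A rule: infinite_finite_induct) (simp_all add: pairing_add_right)

lemma pairing_vacuum: "pairing 1 v = lookup v {#}"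
  by (simp add: pairing_def lookup_one)

lemma pairing_eqI:
  assumes "\<And>v. pairing u v = pairing u' v" shows "u = u'"
proof (rule poly_mapping_eqI)
  fix \<mu>
  have "pairing w (single \<mu> 1) = lookup w \<mu> * mono_norm \<mu>" for w
    unfolding pairing_commute[of w] by (simp add: pairing_def mono_norm_def)
  then show "lookup u \<mu> = lookup u' \<mu>"
    using assms[of "single \<mu> 1"] mono_norm_nonzero by simp
qed

lemma pairing_heis_pos:
  assumes "n > 0" shows "pairing (heis \<alpha> n u) v = - pairing u (heis \<beta> (- n) v)"
proof -
  let ?k = "nat n - 1" and ?l = lookup
  let ?S = "{\<mu>. add_mset ?k \<mu> \<in> keys u}"
  have inj: "inj_on (add_mset ?k) A" for A by (auto simp: inj_on_def)
  have fin: "finite ?S"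
    by (rule finite_imageD[OF _ inj], rule finite_subset[OF _ finite_keys[of u]]) auto
  have n: "of_nat (?k + 1) = (of_int n :: complex)" using assms by (simp add: of_nat_diff)
  have "pairing (heis \<alpha> n u) v = (\<Sum>\<mu>\<in>?S. ?l (heis \<alpha> n u) \<mu> * ?l v \<mu> * mono_norm \<mu>)"
    by (rule pairing_superset[OF fin]) (use assms in \<open>auto simp: in_keys_iff lookup_heis\<close>)
  also have "\<dots> = - (\<Sum>\<mu>\<in>?S. ?l u (add_mset ?k \<mu>) * ?l (heis \<beta> (- n) v) (add_mset ?k \<mu>) * mono_norm (add_mset ?k \<mu>))"
    unfolding sum_negf[symmetric]
  proof (rule sum.cong[OF refl])
    fix \<mu>
    show "?l (heis \<alpha> n u) \<mu> * ?l v \<mu> * mono_norm \<mu> =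
        - (?l u (add_mset ?k \<mu>) * ?l (heis \<beta> (- n) v) (add_mset ?k \<mu>) * mono_norm (add_mset ?k \<mu>))"
      unfolding mono_norm_add_mset n using assms by (simp add: lookup_heis algebra_simps)
  qed
  also have "(\<Sum>\<mu>\<in>?S. ?l u (add_mset ?k \<mu>) * ?l (heis \<beta> (- n) v) (add_mset ?k \<mu>) * mono_norm (add_mset ?k \<mu>)) =
      (\<Sum>\<nu>\<in>add_mset ?k ` ?S. ?l u \<nu> * ?l (heis \<beta> (- n) v) \<nu> * mono_norm \<nu>)"
    by (subst sum.reindex[OF inj]) simp
  also have "\<dots> = pairing u (heis \<beta> (- n) v)"
    unfolding pairing_superset[OF finite_keys subset_refl, of u]
  proof (rule sum.mono_neutral_left)
    show "\<forall>\<nu>\<in>keys u - add_mset ?k ` ?S. ?l u \<nu> * ?l (heis \<beta> (- n) v) \<nu> * mono_norm \<nu> = 0"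
    proof
      fix \<nu> assume \<nu>: "\<nu> \<in> keys u - add_mset ?k ` ?S"
      have "?k \<notin># \<nu>"
      proof
        assume "?k \<in># \<nu>"
        then have "\<nu> = add_mset ?k (\<nu> - {#?k#})" by simp
        then show False using \<nu> by (metis (mono_tags, lifting) DiffE image_eqI mem_Collect_eq)
      qed
      then show "?l u \<nu> * ?l (heis \<beta> (- n) v) \<nu> * mono_norm \<nu> = 0" using assms by (simp add: lookup_heis)
    qed
  qed auto
  finally show ?thesis .
qed

lemma pairing_heis: "pairing (heis \<alpha> n u) v = - pairing u (heis (- \<alpha>) (- n) v)"
proof (cases n "0::int" rule: linorder_cases)
  case less
  then have "pairing (heis (- \<alpha>) (- n) v) u = - pairing v (heis \<alpha> n u)"
    using pairing_heis_pos[of "- n" "- \<alpha>" v u \<alpha>] by simp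
  then show ?thesis by (simp add: pairing_commute)
next
  case equal
  have "heis \<alpha> 0 u = fscale \<alpha> u" "heis (- \<alpha>) 0 v = fscale (- \<alpha>) v" by (simp_all add: heis_def)
  then show ?thesis using equal pairing_fscale_right[of v \<alpha> u] pairing_fscale_right[of u "- \<alpha>" v]
    by (simp add: pairing_commute)
qed (rule pairing_heis_pos)

context
  fixes B :: "fock set"
  assumes basis: "homogeneous_basis B"
begin

lemma basis_independent: "\<not> fock.dependent B" and basis_span: "v \<in> fock.span B"
  and basis_homogeneous: "b \<in> B \<Longrightarrow> \<exists>k. homogeneous k b"
  using basis by (auto simp: homogeneous_basis_def)

lemma basis_nonzero: "b \<in> B \<Longrightarrow> b \<noteq> 0"
  using basis_independent fock.dependent_zero by blast

lemma fdegree_eq: assumes "b \<in> B" "homogeneous k b" shows "fdegree b = k"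
proof -
  obtain \<mu> where "lookup b \<mu> \<noteq> 0"
    using basis_nonzero[OF assms(1)] by (metis lookup_zero poly_mapping_eqI)
  then show ?thesis using assms(2) unfolding fdegree_def
    by (intro the_equality) (auto simp: homogeneous_iff)
qed

lemma homogeneous_fdegree: "b \<in> B \<Longrightarrow> homogeneous (fdegree b) b"
  using basis_homogeneous fdegree_eq by metis

lemma finite_basis_degree: "finite {b\<in>B. fdegree b = d}"
proof -
  let ?T = "(\<lambda>\<mu>. single \<mu> (1::complex)) ` {\<mu>. mdeg \<mu> = d}"
  have "{b\<in>B. fdegree b = d} \<subseteq> fock.span ?T"
  proof (rule subsetI)
    fix b assume "b \<in> {b\<in>B. fdegree b = d}"
    then have b: "b \<in> B" "d = fdegree b" by auto
    have "fscale (lookup b \<mu>) (single \<mu> 1) \<in> fock.span ?T" if "\<mu> \<in> keys b" for \<mu>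
      by (rule fock.span_scale, rule fock.span_base)
         (use homogeneous_fdegree[OF b(1)] that b in \<open>auto simp: homogeneous_iff in_keys_iff\<close>)
    then have "(\<Sum>\<mu>\<in>keys b. fscale (lookup b \<mu>) (single \<mu> 1)) \<in> fock.span ?T"
      by (intro fock.span_sum) auto
    then show "b \<in> fock.span ?T" using fock_expansion[of b] by (simp add: fscale_single)
  qed
  moreover have "\<not> fock.dependent {b\<in>B. fdegree b = d}"
    using fock.dependent_mono[of "{b\<in>B. fdegree b = d}" B] basis_independent by auto
  ultimately show ?thesis
    using fock.independent_span_bound[of ?T] finite_mdeg by blast
qed

lemma finite_basis_degree_le: "finite {b\<in>B. fdegree b \<le> d}"
proof -
  have "{b\<in>B. fdegree b \<le> d} = (\<Union>k\<le>d. {b\<in>B. fdegree b = k})" by auto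
  then show ?thesis using finite_basis_degree by simp
qed

abbreviation coord :: "fock \<Rightarrow> fock \<Rightarrow> complex" where "coord \<equiv> fock.representation B"

lemma coord_sum: "coord (\<Sum>a\<in>A. fscale (c a) (f a)) b = (\<Sum>a\<in>A. c a * coord (f a) b)"
proof -
  have "coord (sum h A) b = (\<Sum>a\<in>A. coord (h a) b)" for h
    using fock.representation_sum[OF basis_independent basis_span, where v = h and I = A] by simp
  then show ?thesis
    using fock.representation_scale[OF basis_independent basis_span] by simp
qed

lemma coord_basis: "c \<in> B \<Longrightarrow> coord c b = (if b = c then 1 else 0)"
  using fock.representation_basis[OF basis_independent] by simp

text \<open>
  Only the basis elements of degree \<open>d\<close> contribute: the components of other degrees cancel separately.
\<close>

lemma homogeneous_coord_expansion:
  assumes "homogeneous d v"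
  shows "v = (\<Sum>b | b \<in> B \<and> fdegree b = d. fscale (coord v b) b)"
proof (rule poly_mapping_eqI)
  fix \<mu>
  let ?R = "{b. coord v b \<noteq> 0}" and ?l = lookup
  have R: "finite ?R" "?R \<subseteq> B"
    using fock.finite_representation fock.representation_ne_zero by auto
  have v: "?l v \<mu> = (\<Sum>b\<in>?R. coord v b * ?l b \<mu>)"
    using arg_cong[OF fock.sum_nonzero_representation_eq[OF basis_independent basis_span, of v], of "\<lambda>v. ?l v \<mu>"]
    by (simp add: lookup_sum)
  have deg: "?l b \<mu> = 0" if "b \<in> B" "fdegree b \<noteq> mdeg \<mu>" for b
    using homogeneous_fdegree[OF that(1)] that(2) by (auto simp: homogeneous_iff)
  show "?l v \<mu> = ?l (\<Sum>b | b \<in> B \<and> fdegree b = d. fscale (coord v b) b) \<mu>"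
  proof (cases "mdeg \<mu> = d")
    case True
    have "(\<Sum>b\<in>?R. coord v b * ?l b \<mu>) = (\<Sum>b\<in>?R \<union> {b\<in>B. fdegree b = d}. coord v b * ?l b \<mu>)"
      by (rule sum.mono_neutral_left) (use R finite_basis_degree in auto)
    also have "\<dots> = (\<Sum>b\<in>{b\<in>B. fdegree b = d}. coord v b * ?l b \<mu>)"
      by (rule sum.mono_neutral_right) (use R finite_basis_degree deg True in auto)
    finally show ?thesis using v by (simp add: lookup_sum)
  next
    case False
    have "(\<Sum>b\<in>{b\<in>B. fdegree b = d}. coord v b * ?l b \<mu>) = 0"
      by (rule sum.neutral) (use deg False in auto)
    then show ?thesis using assms False by (auto simp: lookup_sum homogeneous_iff)
  qed
qed

lemma coord_eq_0:
  assumes "homogeneous d v" "b \<in> B" "fdegree b \<noteq> d" shows "coord v b = 0"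
proof -
  have "coord v b = (\<Sum>c | c \<in> B \<and> fdegree c = d. coord v c * coord c b)"
    by (subst homogeneous_coord_expansion[OF assms(1)]) (rule coord_sum)
  also have "\<dots> = 0" by (rule sum.neutral) (use assms in \<open>auto simp: coord_basis\<close>)
  finally show ?thesis .
qed

lemma coord_monomials: "coord v b = (\<Sum>\<mu>\<in>keys v. lookup v \<mu> * coord (single \<mu> 1) b)"
proof -
  have "v = (\<Sum>\<mu>\<in>keys v. fscale (lookup v \<mu>) (single \<mu> 1))"
    using fock_expansion[of v] by (simp add: fscale_single)
  then show ?thesis using coord_sum by metis
qed

text \<open>
  The pairing being diagonal, a functional that vanishes outside degree \<open>d\<close> is represented by a
  vector of degree \<open>d\<close>; the coordinates with respect to a homogeneous basis are such functionals.
\<close>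

lemma dual_vector_exists:
  assumes b: "b \<in> B"
  shows "\<exists>u. homogeneous (fdegree b) u \<and> (\<forall>v. pairing u v = coord v b)"
proof -
  let ?T = "{\<mu>. mdeg \<mu> = fdegree b}" and ?l = lookup
  let ?c = "\<lambda>\<mu>. coord (single \<mu> 1) b"
  let ?u = "\<Sum>\<mu>\<in>?T. single \<mu> (?c \<mu> / mono_norm \<mu>)"
  have lu: "?l ?u \<mu> = (if \<mu> \<in> ?T then ?c \<mu> / mono_norm \<mu> else 0)" for \<mu>
    by (simp add: lookup_sum lookup_single when_def finite_mdeg)
  have "pairing ?u v = coord v b" for v
  proof -
    have "pairing ?u v = (\<Sum>\<mu>\<in>?T. ?l ?u \<mu> * ?l v \<mu> * mono_norm \<mu>)"
    proof (rule pairing_superset[OF finite_mdeg], rule subsetI)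
      fix \<mu> assume "\<mu> \<in> keys ?u"
      then show "\<mu> \<in> ?T" unfolding in_keys_iff by (rule contrapos_np) (simp add: lu)
    qed
    also have "\<dots> = (\<Sum>\<mu>\<in>?T. ?l v \<mu> * ?c \<mu>)"
      by (rule sum.cong) (auto simp: lu mono_norm_nonzero)
    also have "\<dots> = (\<Sum>\<mu>\<in>?T \<union> keys v. ?l v \<mu> * ?c \<mu>)"
    proof (rule sum.mono_neutral_left)
      show "\<forall>\<mu>\<in>?T \<union> keys v - ?T. ?l v \<mu> * ?c \<mu> = 0"
        using coord_eq_0[OF _ b] by (auto simp: homogeneous_iff lookup_single when_def)
    qed (auto simp: finite_mdeg)
    also have "\<dots> = (\<Sum>\<mu>\<in>keys v. ?l v \<mu> * ?c \<mu>)"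
      by (rule sum.mono_neutral_right) (auto simp: finite_mdeg in_keys_iff)
    finally show ?thesis by (simp add: coord_monomials[of v])
  qed
  moreover have "homogeneous (fdegree b) ?u"
    unfolding homogeneous_iff
  proof (intro allI impI)
    fix \<mu> assume "?l ?u \<mu> \<noteq> 0"
    then show "mdeg \<mu> = fdegree b" by (rule contrapos_np) (simp add: lu)
  qed
  ultimately show ?thesis by blast
qed

lemma dual_vector:
  assumes b: "b \<in> B"
  shows "homogeneous (fdegree b) (dual_vector B b)" "pairing (dual_vector B b) v = coord v b"
proof -
  obtain u where u: "homogeneous (fdegree b) u" "\<And>v. pairing u v = coord v b"
    using dual_vector_exists[OF b] by blast
  have "dual_vector B b = u"
    unfolding dual_vector_def
  proof (rule the_equality)
    show "\<forall>c\<in>B. pairing u c = (if c = b then 1 else 0)" by (auto simp: u coord_basis)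
    fix w assume w: "\<forall>c\<in>B. pairing w c = (if c = b then 1 else 0)"
    show "w = u"
    proof (rule pairing_eqI)
      fix v
      have v: "v = (\<Sum>c | coord v c \<noteq> 0. fscale (coord v c) c)"
        using fock.sum_nonzero_representation_eq[OF basis_independent basis_span, of v] by simp
      have "pairing z v = (\<Sum>c | coord v c \<noteq> 0. coord v c * pairing z c)" for z
        by (subst v) (simp only: pairing_sum_right pairing_fscale_right)
      moreover have "pairing w c = pairing u c" if "coord v c \<noteq> 0" for c
      proof -
        have "c \<in> B" using fock.representation_ne_zero[of B v c] that by simp
        then show ?thesis using w by (auto simp: u coord_basis)
      qed
      ultimately show "pairing w v = pairing u v" by simp
    qed
  qed
  then show "homogeneous (fdegree b) (dual_vector B b)" "pairing (dual_vector B b) v = coord v b"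
    using u by simp_all
qed

lemma dual_vector_expansion:
  assumes "homogeneous d v"
  shows "v = (\<Sum>b | b \<in> B \<and> fdegree b = d. fscale (pairing v b) (dual_vector B b))"
proof (rule pairing_eqI)
  fix w
  let ?D = "{b. b \<in> B \<and> fdegree b = d}"
  have w: "w = (\<Sum>c | coord w c \<noteq> 0. fscale (coord w c) c)"
    using fock.sum_nonzero_representation_eq[OF basis_independent basis_span, of w] by simp
  have fin: "finite {c. coord w c \<noteq> 0}" using fock.finite_representation by auto
  have "pairing v c = 0" if "coord w c \<noteq> 0" "c \<notin> ?D" for c
  proof -
    have "c \<in> B" using fock.representation_ne_zero[of B w c] that by simp
    then have "\<And>\<mu>. lookup v \<mu> * lookup c \<mu> = 0"
      using homogeneous_fdegree[of c] assms that(2) by (auto simp: homogeneous_iff)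
    then show ?thesis unfolding pairing_def by (intro sum.neutral) (simp add: mult.assoc[symmetric])
  qed
  moreover have "pairing v w = (\<Sum>c | coord w c \<noteq> 0. coord w c * pairing v c)"
    by (subst w) (simp only: pairing_sum_right pairing_fscale_right)
  ultimately have "pairing v w = (\<Sum>c\<in>{c. coord w c \<noteq> 0} \<union> ?D. coord w c * pairing v c)"
    by (simp only:) (rule sum.mono_neutral_left, use fin finite_basis_degree in auto)
  also have "\<dots> = (\<Sum>c\<in>?D. coord w c * pairing v c)"
    by (rule sum.mono_neutral_right)
       (use fin finite_basis_degree \<open>\<And>c. coord w c \<noteq> 0 \<Longrightarrow> c \<notin> ?D \<Longrightarrow> pairing v c = 0\<close> in auto)
  also have "\<dots> = pairing (\<Sum>b\<in>?D. fscale (pairing v b) (dual_vector B b)) w"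
    unfolding pairing_commute[of _ w] pairing_sum_right pairing_fscale_right
    by (rule sum.cong) (auto simp: dual_vector(2) pairing_commute[of w] pairing_commute[of _ v])
  finally show "pairing v w = pairing (\<Sum>b\<in>?D. fscale (pairing v b) (dual_vector B b)) w" .
qed

text \<open>
  Expanding \<open>h(n)b\<close> in the basis and then \<open>h(-n)b'\<close> in the dual basis moves the mode across
  the sewing, with a sign from the pairing and a shift of the degree.
\<close>

lemma sum_basis_heis:
  fixes \<Phi> :: "fock \<Rightarrow> fock \<Rightarrow> var fseries"
  assumes add: "\<And>u v w. \<Phi> (u + v) w = \<Phi> u w + \<Phi> v w" "\<And>u v w. \<Phi> u (v + w) = \<Phi> u v + \<Phi> u w"
    and scale: "\<And>c u v. \<Phi> (fscale c u) v = fconst c * \<Phi> u v" "\<And>c u v. \<Phi> u (fscale c v) = fconst c * \<Phi> u v"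
    and n: "n = int d1 - int d2"
  shows "(\<Sum>b | b \<in> B \<and> fdegree b = d1. \<Phi> (heis \<alpha> n b) (dual_vector B b)) =
    - (\<Sum>c | c \<in> B \<and> fdegree c = d2. \<Phi> c (heis (- \<alpha>) (- n) (dual_vector B c)))"
proof -
  let ?D = "\<lambda>d. {b. b \<in> B \<and> fdegree b = d}" and ?d = "dual_vector B"
  have zero: "\<Phi> 0 w = 0" "\<Phi> u 0 = 0" for u w 
    using scale(1)[of 0 0 w] scale(2)[of u 0 0] by (simp_all add: fock.scale_zero_left)
  have lsum: "\<Phi> (\<Sum>a\<in>A. fscale (c a) (f a)) w = (\<Sum>a\<in>A. fconst (c a) * \<Phi> (f a) w)" for A c w and f :: "fock \<Rightarrow> fock"
    by (induction A rule: infinite_finite_induct) (simp_all add: zero add scale)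
  have rsum: "\<Phi> w (\<Sum>a\<in>A. fscale (c a) (f a)) = (\<Sum>a\<in>A. fconst (c a) * \<Phi> w (f a))" for A c w and f :: "fock \<Rightarrow> fock"
    by (induction A rule: infinite_finite_induct) (simp_all add: zero add scale)
  have 1: "\<Phi> (heis \<alpha> n b) (?d b) = (\<Sum>c\<in>?D d2. fconst (pairing (?d c) (heis \<alpha> n b)) * \<Phi> c (?d b))"
    if "b \<in> ?D d1" for b
  proof -
    have "homogeneous d2 (heis \<alpha> n b)"
      by (rule homogeneous_heis[of d1]) (use that homogeneous_fdegree n in auto)
    from homogeneous_coord_expansion[OF this]
    have "heis \<alpha> n b = (\<Sum>c\<in>?D d2. fscale (pairing (?d c) (heis \<alpha> n b)) c)"
      by (rule trans) (auto intro!: sum.cong simp: dual_vector(2))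
    from trans[OF arg_cong[OF this, of "\<lambda>u. \<Phi> u (?d b)"] lsum] show ?thesis .
  qed
  have 2: "\<Phi> c (heis (- \<alpha>) (- n) (?d c)) = (\<Sum>b\<in>?D d1. fconst (pairing (heis (- \<alpha>) (- n) (?d c)) b) * \<Phi> c (?d b))"
    if "c \<in> ?D d2" for c
  proof -
    have "homogeneous d1 (heis (- \<alpha>) (- n) (?d c))"
      by (rule homogeneous_heis[of d2]) (use that dual_vector(1) n in auto)
    from trans[OF arg_cong[OF dual_vector_expansion[OF this], of "\<Phi> c"] rsum] show ?thesis .
  qed
  have "(\<Sum>b\<in>?D d1. \<Phi> (heis \<alpha> n b) (?d b)) =
      (\<Sum>b\<in>?D d1. \<Sum>c\<in>?D d2. fconst (pairing (?d c) (heis \<alpha> n b)) * \<Phi> c (?d b))"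
    by (rule sum.cong) (use 1 in auto)
  also have "\<dots> = (\<Sum>c\<in>?D d2. \<Sum>b\<in>?D d1. fconst (pairing (?d c) (heis \<alpha> n b)) * \<Phi> c (?d b))"
    by (rule sum.swap)
  also have "\<dots> = (\<Sum>c\<in>?D d2. - \<Phi> c (heis (- \<alpha>) (- n) (?d c)))"
    by (rule sum.cong) (auto simp: 2 pairing_heis fconst_uminus sum_negf)
  finally show ?thesis by (simp add: sum_negf)
qed

end

section \<open>Intertwiners and the Heisenberg modes\<close>

lemma powi_minus_one_Suc: "- ((- 1) powi (- int (Suc p))) = ((- 1) ^ p :: complex)"
  by (simp add: power_int_def nat_add_distrib)

lemma gbinomial_neg_Suc: "((- of_nat k - 1) gchoose m :: complex) = (- 1) ^ m * of_nat ((k + m) choose m)"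
proof -
  have "((- (of_nat k + 1)) gchoose m :: complex) = (- 1) ^ m * ((of_nat k + 1 + of_nat m - 1) gchoose m)"
    by (rule gbinomial_minus)
  also have "- (of_nat k + 1) = (- of_nat k - 1 :: complex)" by simp
  finally show ?thesis by (simp add: binomial_gbinomial)
qed

context
  fixes \<alpha> \<beta> :: complex and J
  assumes J: "intertwiner \<alpha> \<beta> J"
begin

lemmas intertwiner_clauses = J[unfolded intertwiner_def Vector_Spaces.linear_iff]

lemma intertwiner_add_left: "J (u + v) s w = J u s w + J v s w"
  and intertwiner_scale_left: "J (fscale c v) s w = fscale c (J v s w)"
  using intertwiner_clauses[THEN conjunct1] by auto

lemma intertwiner_add_right: "J v s (u + w) = J v s u + J v s w"
  and intertwiner_scale_right: "J v s (fscale c w) = fscale c (J v s w)"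
  using intertwiner_clauses[THEN conjunct2, THEN conjunct1] by auto

lemma intertwiner_zero_left [simp]: "J 0 s w = 0" and intertwiner_zero_right [simp]: "J v s 0 = 0"
  using intertwiner_scale_left[of 0 0 s w] intertwiner_scale_right[of v s 0 0]
  by (simp_all add: fock.scale_zero_left)

lemma intertwiner_sum_left: "J (\<Sum>a\<in>A. fscale (c a) (u a)) s w = (\<Sum>a\<in>A. fscale (c a) (J (u a) s w))"
  by (induction A rule: infinite_finite_induct) (simp_all add: intertwiner_add_left intertwiner_scale_left)

lemma intertwiner_sum_right: "J v s (\<Sum>a\<in>A. fscale (c a) (u a)) = (\<Sum>a\<in>A. fscale (c a) (J v s (u a)))"
  by (induction A rule: infinite_finite_induct) (simp_all add: intertwiner_add_right intertwiner_scale_right)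

lemma intertwiner_eventually_0: "\<forall>\<^sub>F i in sequentially. J v (s + of_nat i) w = 0"
proof -
  obtain K :: real where K: "\<And>t. Re t > K \<Longrightarrow> J v t w = 0"
    using intertwiner_clauses[THEN conjunct2, THEN conjunct2, THEN conjunct1] by blast
  obtain N :: nat where N: "K - Re s < of_nat N" using reals_Archimedean2 by blast
  show ?thesis unfolding eventually_sequentially
    by (intro exI[of _ N] allI impI K) (use N in simp)
qed

lemma intertwiner_Jacobi:
  "Sum_any (\<lambda>i::nat. fscale (of_int m gchoose i)
      (J (vertex \<alpha> u (l + int i) v) (of_int m + s - of_nat i) w)) =
    Sum_any (\<lambda>i::nat. fscale ((- 1) ^ i * (of_int l gchoose i))
      (vertex (\<alpha> + \<beta>) u (m + l - int i) (J v (s + of_nat i) w) -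
       fscale ((- 1) powi l) (J v (of_int l + s - of_nat i) (vertex \<beta> u (m + int i) w))))"
  by (rule intertwiner_clauses[THEN conjunct2, THEN conjunct2, THEN conjunct2, THEN conjunct2, rule_format])

text \<open>The commutator formula is the case \<open>l = 0\<close> of the Jacobi identity.\<close>

lemma intertwiner_commutator_Sum_any:
  "vertex (\<alpha> + \<beta>) u m (J v s w) =
    J v s (vertex \<beta> u m w) +
    Sum_any (\<lambda>i::nat. fscale (of_int m gchoose i) (J (vertex \<alpha> u (int i) v) (of_int m + s - of_nat i) w))"
proof -
  have "Sum_any (\<lambda>i::nat. fscale ((- 1) ^ i * (of_int 0 gchoose i))
      (vertex (\<alpha> + \<beta>) u (m + 0 - int i) (J v (s + of_nat i) w) -
       fscale ((- 1) powi 0) (J v (of_int 0 + s - of_nat i) (vertex \<beta> u (m + int i) w)))) =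
    vertex (\<alpha> + \<beta>) u m (J v s w) - J v s (vertex \<beta> u m w)"
    by (subst Sum_any_eq_single[of 0]) (auto simp: gbinomial_0_left fock.scale_zero_left)
  then show ?thesis using intertwiner_Jacobi[of m u 0 v s w] by simp
qed

lemma intertwiner_commutator:
  assumes "\<And>j. j \<ge> K \<Longrightarrow> heis \<alpha> (int j) v = 0"
  shows "heis (\<alpha> + \<beta>) n (J v s w) = J v s (heis \<beta> n w) +
    (\<Sum>j<K. fscale (of_int n gchoose j) (J (heis \<alpha> (int j) v) (of_int n + s - of_nat j) w))"
  unfolding intertwiner_commutator_Sum_any[of h_state, unfolded vertex_h_state]
proof (intro arg_cong2[where f = "(+)"] refl Sum_any.expand_superset)
  show "{i. fscale (of_int n gchoose i) (J (heis \<alpha> (int i) v) (of_int n + s - of_nat i) w) \<noteq> 0} \<subseteq> {..<K}"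
    using assms by (force simp: not_le[symmetric])
qed simp

text \<open>The case \<open>m = 0\<close>: a creation mode on \<open>v\<close> is a normally ordered product.\<close>

lemma intertwiner_iterate:
  assumes "\<And>i. i \<ge> K \<Longrightarrow> J v (s + of_nat i) w = 0" "\<And>i. i \<ge> K \<Longrightarrow> heis \<beta> (int i) w = 0"
  shows "J (heis \<alpha> (- int (Suc p)) v) s w =
    (\<Sum>i<K. fscale (of_nat ((p + i) choose p))
      (heis (\<alpha> + \<beta>) (- int (Suc p) - int i) (J v (s + of_nat i) w) +
       fscale ((- 1) ^ p) (J v (s - of_nat (Suc p) - of_nat i) (heis \<beta> (int i) w))))"
proof -
  let ?l = "- int (Suc p)"
  let ?t = "\<lambda>i::nat. fscale ((- 1) ^ i * (of_int ?l gchoose i))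
      (heis (\<alpha> + \<beta>) (0 + ?l - int i) (J v (s + of_nat i) w) -
       fscale ((- 1) powi ?l) (J v (of_int ?l + s - of_nat i) (heis \<beta> (0 + int i) w)))"
  have c: "(- 1) ^ i * (of_int ?l gchoose i) = (of_nat ((p + i) choose p) :: complex)" for i
  proof -
    have "(of_int ?l :: complex) = - of_nat p - 1" by simp
    then have "(of_int ?l gchoose i :: complex) = (- 1) ^ i * of_nat ((p + i) choose i)"
      by (simp only: gbinomial_neg_Suc)
    then show ?thesis using binomial_symmetric[of i "p + i"] by (simp add: mult.assoc[symmetric] flip: power_add)
  qed
  have sub: "{i. ?t i \<noteq> 0} \<subseteq> {..<K}"
  proof (rule subsetI, rule ccontr)
    fix i assume "i \<in> {i. ?t i \<noteq> 0}" "i \<notin> {..<K}"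
    then show False by (simp add: assms)
  qed
  have "J (heis \<alpha> ?l v) s w = Sum_any (\<lambda>i::nat. fscale (of_int 0 gchoose i)
      (J (heis \<alpha> (?l + int i) v) (of_int 0 + s - of_nat i) w))"
    by (subst Sum_any_eq_single[of 0]) (auto simp: gbinomial_0_left fock.scale_zero_left)
  also have "\<dots> = Sum_any ?t"
    using intertwiner_Jacobi[of 0 h_state ?l v s w] unfolding vertex_h_state .
  also have "\<dots> = (\<Sum>i<K. ?t i)" by (rule Sum_any.expand_superset[OF _ sub]) simp
  also have "\<dots> = (\<Sum>i<K. fscale (of_nat ((p + i) choose p))
      (heis (\<alpha> + \<beta>) (?l - int i) (J v (s + of_nat i) w) +
       fscale ((- 1) ^ p) (J v (s - of_nat (Suc p) - of_nat i) (heis \<beta> (int i) w))))"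
  proof (rule sum.cong[OF refl])
    fix i
    have e: "(of_int ?l + s - of_nat i :: complex) = s - of_nat (Suc p) - of_nat i" by simp
    have m: "fscale ((- 1) ^ p) x = - fscale ((- 1) powi ?l) x" for x
      by (simp only: powi_minus_one_Suc[symmetric] fock.scale_minus_left)
    show "?t i = fscale (of_nat ((p + i) choose p))
      (heis (\<alpha> + \<beta>) (?l - int i) (J v (s + of_nat i) w) +
       fscale ((- 1) ^ p) (J v (s - of_nat (Suc p) - of_nat i) (heis \<beta> (int i) w)))"
      by (simp only: c m e add_0) simp
  qed
  finally show ?thesis .
qed

text \<open>
  The commutator with \<open>L(0)\<close>, in which the derivative property evaluates the term with \<open>L(-1)\<close>,
  says that intertwiners respect the grading by weights. This forces the exponents of \<open>\<Y>(v,z)w\<close>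
  into finitely many cosets of \<open>\<int>\<close>, without which products would have no expansion.
\<close>

lemma lookup_intertwiner_monomials:
  assumes "lookup (J (single \<mu> 1) s (single \<nu> 1)) \<kappa> \<noteq> 0"
  shows "s = of_nat (mdeg \<mu>) + of_nat (mdeg \<nu>) - \<alpha> * \<beta> - 1 - of_nat (mdeg \<kappa>)"
proof -
  let ?v = "single \<mu> (1::complex)" and ?w = "single \<nu> (1::complex)"
  let ?x = "J ?v s ?w"
  have L0: "virasoro \<gamma> 0 (single \<rho> 1) = fscale (\<gamma>\<^sup>2 / 2 + of_nat (mdeg \<rho>)) (single \<rho> 1)" for \<gamma> \<rho>
    by (rule poly_mapping_eqI) (simp add: lookup_virasoro_0 lookup_single when_def)
  have Lm1: "J (virasoro \<alpha> (- 1) ?v) (s + 1) ?w = fscale (- (s + 1)) ?x"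
  proof -
    have "J (virasoro \<alpha> (- 1) ?v) (s + 1) ?w = fscale (- (s + 1)) (J ?v ((s + 1) - 1) ?w)"
      by (rule intertwiner_clauses[THEN conjunct2, THEN conjunct2, THEN conjunct2, THEN conjunct1, rule_format])
    then show ?thesis by simp
  qed
  let ?t = "\<lambda>i::nat. fscale (of_int 1 gchoose i) (J (vertex \<alpha> conformal_vector (int i) ?v) (of_int 1 + s - of_nat i) ?w)"
  have "Sum_any ?t = (\<Sum>i<2. ?t i)"
  proof (rule Sum_any.expand_superset)
    have "(1::complex) gchoose i = 0" if "i \<ge> 2" for i
    proof -
      have "1 choose i = 0" by (rule binomial_eq_0) (use that in simp)
      moreover have "of_nat (1 choose i) = (of_nat 1 gchoose i :: complex)" by (rule binomial_gbinomial)
      ultimately show ?thesis by (simp only: of_nat_0 of_nat_1)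
    qed
    then show "{i. ?t i \<noteq> 0} \<subseteq> {..<2}" by (force simp: fock.scale_zero_left not_le[symmetric])
  qed simp
  also have "\<dots> = J (virasoro \<alpha> (- 1) ?v) (s + 1) ?w + J (virasoro \<alpha> 0 ?v) s ?w"
    by (simp add: numeral_2_eq_2 virasoro_def add.commute)
  also have "\<dots> = fscale (\<alpha>\<^sup>2 / 2 + of_nat (mdeg \<mu>) - s - 1) ?x"
    unfolding Lm1 L0 intertwiner_scale_left fock.scale_left_distrib[symmetric] by (simp add: algebra_simps)
  finally have "virasoro (\<alpha> + \<beta>) 0 ?x = J ?v s (virasoro \<beta> 0 ?w) + fscale (\<alpha>\<^sup>2 / 2 + of_nat (mdeg \<mu>) - s - 1) ?x"
    using intertwiner_commutator_Sum_any[of conformal_vector 1 ?v s ?w] by (simp add: virasoro_def)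
  then have "virasoro (\<alpha> + \<beta>) 0 ?x = fscale (\<beta>\<^sup>2 / 2 + of_nat (mdeg \<nu>) + (\<alpha>\<^sup>2 / 2 + of_nat (mdeg \<mu>) - s - 1)) ?x"
    by (simp only: L0 intertwiner_scale_right fock.scale_left_distrib[symmetric])
  from arg_cong[OF this, of "\<lambda>x. lookup x \<kappa>"] assms
  have "(\<alpha> + \<beta>)\<^sup>2 / 2 + of_nat (mdeg \<kappa>) = \<beta>\<^sup>2 / 2 + of_nat (mdeg \<nu>) + (\<alpha>\<^sup>2 / 2 + of_nat (mdeg \<mu>) - s - 1)"
    by (simp add: lookup_virasoro_0)
  then show ?thesis by (simp add: power2_eq_square field_simps) algebra
qed

lemma intertwiner_nonzero:
  assumes "J v s w \<noteq> 0"
  obtains \<mu> \<nu> d where "\<mu> \<in> keys v" "\<nu> \<in> keys w"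
    "s = of_nat (mdeg \<mu>) + of_nat (mdeg \<nu>) - \<alpha> * \<beta> - 1 - of_nat d"
proof -
  have exp: "u = (\<Sum>\<nu>\<in>keys u. fscale (lookup u \<nu>) (single \<nu> 1))" for u
    using fock_expansion[of u] by (simp add: fscale_single)
  have "J v s w = (\<Sum>\<mu>\<in>keys v. fscale (lookup v \<mu>) (J (single \<mu> 1) s w))"
    by (subst exp[of v]) (rule intertwiner_sum_left)
  then obtain \<mu> where \<mu>: "\<mu> \<in> keys v" "J (single \<mu> 1) s w \<noteq> 0"
    using assms sum_nonzeroD by (metis (no_types, lifting) fock.scale_zero_right)
  have "J (single \<mu> 1) s w =
      (\<Sum>\<nu>\<in>keys w. fscale (lookup w \<nu>) (J (single \<mu> 1) s (single \<nu> 1)))"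
    by (subst exp[of w]) (rule intertwiner_sum_right)
  then obtain \<nu> where \<nu>: "\<nu> \<in> keys w" "J (single \<mu> 1) s (single \<nu> 1) \<noteq> 0"
    using \<mu>(2) sum_nonzeroD by (metis (no_types, lifting) fock.scale_zero_right)
  then obtain \<kappa> where "lookup (J (single \<mu> 1) s (single \<nu> 1)) \<kappa> \<noteq> 0"
    by (metis lookup_zero poly_mapping_eqI)
  from that[OF \<mu>(1) \<nu>(1) lookup_intertwiner_monomials[OF this]] show ?thesis .
qed

end

section \<open>Products of intertwiners\<close>

text \<open>
  The insertions are described by the list of their positions, with the charge \<open>q y\<close> and the
  state \<open>f y\<close> at the position \<open>y\<close>, so that acting on the state at \<open>y\<close> is an update of \<open>f\<close>. The
  product acts on a vector \<open>w\<close> of charge \<open>c\<close>.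
\<close>

primrec op_product :: "(complex \<Rightarrow> complex \<Rightarrow> fock \<Rightarrow> complex \<Rightarrow> fock \<Rightarrow> fock) \<Rightarrow> (var \<Rightarrow> complex) \<Rightarrow>
    (var \<Rightarrow> fock) \<Rightarrow> complex \<Rightarrow> fock \<Rightarrow> var list \<Rightarrow> (var \<Rightarrow>\<^sub>0 complex) \<Rightarrow> fock" where
  "op_product \<Y> q f c w [] e = w"
| "op_product \<Y> q f c w (y # ys) e =
     \<Y> (q y) (sum_list (map q ys) + c) (f y) (- lookup e y - 1) (op_product \<Y> q f c w ys e)"

definition correlator :: "(complex \<Rightarrow> complex \<Rightarrow> fock \<Rightarrow> complex \<Rightarrow> fock \<Rightarrow> fock) \<Rightarrow> (var \<Rightarrow> complex) \<Rightarrow>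
    var list \<Rightarrow> (var \<Rightarrow> fock) \<Rightarrow> var fseries" where
  "correlator \<Y> q ys f = matrix_element \<Y> (map (\<lambda>y. (y, q y, f y)) ys)"

lemma product_coeff_op_product: "product_coeff \<Y> (map (\<lambda>y. (y, q y, f y)) ys) e = op_product \<Y> q f 0 1 ys e"
proof (induction ys)
  case (Cons y ys)
  have "total_charge (map (\<lambda>y. (y, q y, f y)) ys) = sum_list (map q ys)"
    by (simp add: total_charge_def o_def)
  then show ?case using Cons by simp
qed simp

lemma op_product_append:
  "op_product \<Y> q f c w (L @ R) e = op_product \<Y> q f (sum_list (map q R) + c) (op_product \<Y> q f c w R e) L e"
  by (induction L) (simp_all add: add.assoc)

lemma op_product_cong:
  "(\<And>y. y \<in> set ys \<Longrightarrow> f y = f' y \<and> lookup e y = lookup e' y) \<Longrightarrow>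
    op_product \<Y> q f c w ys e = op_product \<Y> q f' c w ys e'"
  by (induction ys) simp_all

lemma sorted_wrt_less_distinct: "sorted_wrt (<) (ys :: var list) \<Longrightarrow> distinct ys"
  using strict_sorted_iff by blast

lemma correlator_cong: "(\<And>y. y \<in> set ys \<Longrightarrow> f y = f' y) \<Longrightarrow> correlator \<Y> q ys f = correlator \<Y> q ys f'"
  unfolding correlator_def by (rule arg_cong[of _ _ "matrix_element \<Y>"]) auto

definition act :: "(var \<Rightarrow> complex) \<Rightarrow> var \<Rightarrow> int \<Rightarrow> (var \<Rightarrow> fock) \<Rightarrow> var \<Rightarrow> fock" where
  "act q y j f = f(y := heis (q y) j (f y))"

context
  fixes \<Y> :: "complex \<Rightarrow> complex \<Rightarrow> fock \<Rightarrow> complex \<Rightarrow> fock \<Rightarrow> fock"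
  assumes Y: "heisenberg_intertwiners \<Y>"
begin

lemma Y_intertwiner: "intertwiner \<alpha> \<beta> (\<Y> \<alpha> \<beta>)"
  using Y by (simp add: heisenberg_intertwiners_def)

lemma Y_vacuum: "\<Y> 0 \<beta> 1 s w = (if s = - 1 then w else 0)"
proof (cases "s \<in> \<int>")
  case True
  then obtain k where k: "s = of_int k" by (auto elim: Ints_cases)
  have "\<Y> 0 \<beta> 1 (of_int k) w = vertex \<beta> 1 k w"
    by (rule Y[unfolded heisenberg_intertwiners_def, THEN conjunct2, THEN conjunct1, rule_format])
  moreover have "of_int k = (- 1 :: complex) \<longleftrightarrow> k = - 1"
    by (metis of_int_eq_iff of_int_1 of_int_minus)
  ultimately show ?thesis by (simp add: k vertex_vacuum)
next
  case False
  then have "\<Y> 0 \<beta> 1 s w = 0"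
    using Y[unfolded heisenberg_intertwiners_def, THEN conjunct2, THEN conjunct2, THEN conjunct2, THEN conjunct1] by blast
  moreover have "s \<noteq> - 1" using False by auto
  ultimately show ?thesis by simp
qed

lemma op_product_sum:
  "op_product \<Y> q f c (\<Sum>a\<in>A. fscale (k a) (w a)) ys e = (\<Sum>a\<in>A. fscale (k a) (op_product \<Y> q f c (w a) ys e))"
  by (induction ys) (simp_all add: intertwiner_sum_right[OF Y_intertwiner])

lemma op_product_add: "op_product \<Y> q f c (v + w) ys e = op_product \<Y> q f c v ys e + op_product \<Y> q f c w ys e"
  by (induction ys) (simp_all add: intertwiner_add_right[OF Y_intertwiner])

lemma op_product_scale: "op_product \<Y> q f c (fscale k w) ys e = fscale k (op_product \<Y> q f c w ys e)"
  by (induction ys) (simp_all add: intertwiner_scale_right[OF Y_intertwiner])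

lemma op_product_zero: "op_product \<Y> q f c 0 ys e = 0"
  by (induction ys) (simp_all add: intertwiner_zero_right[OF Y_intertwiner])

text \<open>
  Repeated use of the commutator formula. Since the exponent of \<open>y\<close> belongs to the mode \<open>-e\<^sub>y - 1\<close>, the
  commutator term with \<open>h(j)\<close> at \<open>y\<close> appears with the exponent of \<open>y\<close> lowered by \<open>n - j\<close>.
\<close>

lemma heis_op_product:
  assumes "distinct ys" "\<And>y j. y \<in> set ys \<Longrightarrow> j \<ge> K \<Longrightarrow> heis (q y) (int j) (f y) = 0"
  shows "heis (sum_list (map q ys) + c) n (op_product \<Y> q f c w ys e) =
    op_product \<Y> q f c (heis c n w) ys e +
    (\<Sum>y\<in>set ys. \<Sum>j<K. fscale (of_int n gchoose j)
       (op_product \<Y> q (act q y (int j) f) c w ys (e - single y (of_int n - of_nat j))))"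
  using assms
proof (induction ys)
  case (Cons y ys)
  let ?C = "sum_list (map q ys) + c" and ?s = "- lookup e y - 1"
  let ?x = "op_product \<Y> q f c w ys e"
  let ?G = "\<lambda>ys y' j. op_product \<Y> q (act q y' (int j) f) c w ys (e - single y' (of_int n - of_nat j))"
  note lin = intertwiner_add_right[OF Y_intertwiner] intertwiner_sum_right[OF Y_intertwiner]
  have y: "y \<notin> set ys" using Cons.prems(1) by simp
  have IH: "heis ?C n ?x = op_product \<Y> q f c (heis c n w) ys e +
      (\<Sum>y\<in>set ys. \<Sum>j<K. fscale (of_int n gchoose j) (?G ys y j))"
    by (rule Cons.IH) (use Cons.prems in auto)
  have own: "?G (y # ys) y j = \<Y> (q y) ?C (heis (q y) (int j) (f y)) (of_int n + ?s - of_nat j) ?x" for j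
  proof -
    have "op_product \<Y> q (act q y (int j) f) c w ys (e - single y (of_int n - of_nat j)) = ?x"
      by (rule op_product_cong) (use y in \<open>auto simp: act_def lookup_minus lookup_single when_def\<close>)
    then show ?thesis by (simp add: act_def lookup_minus algebra_simps)
  qed
  have other: "?G (y # ys) y' j = \<Y> (q y) ?C (f y) ?s (?G ys y' j)" if "y' \<in> set ys" for y' j
  proof -
    have "y' \<noteq> y" using y that by auto
    then show ?thesis by (simp add: act_def lookup_minus lookup_single)
  qed
  have "heis (q y + ?C) n (\<Y> (q y) ?C (f y) ?s ?x) =
      \<Y> (q y) ?C (f y) ?s (heis ?C n ?x) +
      (\<Sum>j<K. fscale (of_int n gchoose j) (\<Y> (q y) ?C (heis (q y) (int j) (f y)) (of_int n + ?s - of_nat j) ?x))"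
    by (rule intertwiner_commutator[OF Y_intertwiner]) (use Cons.prems(2) in simp)
  also have "(\<Sum>j<K. fscale (of_int n gchoose j) (\<Y> (q y) ?C (heis (q y) (int j) (f y)) (of_int n + ?s - of_nat j) ?x)) =
      (\<Sum>j<K. fscale (of_int n gchoose j) (?G (y # ys) y j))"
    by (simp only: own)
  also have "\<Y> (q y) ?C (f y) ?s (heis ?C n ?x) = op_product \<Y> q f c (heis c n w) (y # ys) e +
      (\<Sum>y'\<in>set ys. \<Sum>j<K. fscale (of_int n gchoose j) (?G (y # ys) y' j))"
  proof -
    have "\<Y> (q y) ?C (f y) ?s (\<Sum>y\<in>set ys. \<Sum>j<K. fscale (of_int n gchoose j) (?G ys y j)) =
        (\<Sum>y'\<in>set ys. \<Y> (q y) ?C (f y) ?s (\<Sum>j<K. fscale (of_int n gchoose j) (?G ys y' j)))"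
      using intertwiner_sum_right[OF Y_intertwiner, where c = "\<lambda>_. 1"] by simp
    also have "\<dots> = (\<Sum>y'\<in>set ys. \<Sum>j<K. fscale (of_int n gchoose j) (?G (y # ys) y' j))"
      by (rule sum.cong[OF refl]) (simp only: lin other)
    finally show ?thesis unfolding IH lin(1) by simp
  qed
  finally show ?case using y by (simp add: ac_simps)
qed simp

text \<open>
  Once the exponents at the points to the right are fixed, the operators there produce a fixed
  vector, and the grading bounds the exponent at the next point from below.
\<close>

lemma admissible_correlator:
  assumes "sorted_wrt (<) ys"
  shows "admissible {e. (if keys e \<subseteq> set ys then lookup (op_product \<Y> q f 0 1 ys e) {#} else 0) \<noteq> 0}"
    (is "admissible ?S")
  unfolding admissible_def
proof (intro conjI allI)
  show "\<exists>V. finite V \<and> (\<forall>e\<in>?S. keys e \<subseteq> V)" by (rule exI[of _ "set ys"]) auto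
  fix v c
  show "\<exists>B. finite B \<and> (\<forall>e\<in>?S. (\<forall>u>v. lookup e u = c u) \<longrightarrow>
           (\<exists>b\<in>B. \<exists>k::nat. lookup e v = b + of_nat k / 2))"
  proof (cases "v \<in> set ys \<and> (\<exists>e0. \<forall>u>v. lookup e0 u = c u)")
    case False
    have "lookup e v = 0 + of_nat 0 / 2" if "e \<in> ?S" "\<forall>u>v. lookup e u = c u" for e
    proof -
      have "v \<notin> set ys" "keys e \<subseteq> set ys" using False that by (auto split: if_splits)
      then show ?thesis using lookup_eq_0_if_var by simp
    qed
    then show ?thesis by (intro exI[of _ "{0}"]) blast
  next
    case True
    then obtain e0 L R where e0: "\<And>u. u > v \<Longrightarrow> lookup e0 u = c u" and ys: "ys = L @ v # R"
      by (meson split_list)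
    let ?w = "op_product \<Y> q f 0 1 R e0" and ?C = "sum_list (map q R)"
    let ?B = "(\<lambda>(\<mu>, \<nu>). q v * ?C - of_nat (mdeg \<mu>) - of_nat (mdeg \<nu>)) ` (keys (f v) \<times> keys ?w)"
    have R: "u > v" if "u \<in> set R" for u using assms that by (simp add: ys sorted_wrt_append)
    have "\<exists>b\<in>?B. \<exists>k::nat. lookup e v = b + of_nat k / 2"
      if e: "e \<in> ?S" "\<forall>u>v. lookup e u = c u" for e
    proof -
      have w: "op_product \<Y> q f 0 1 R e = ?w" by (rule op_product_cong) (use R e e0 in auto)
      have "lookup (op_product \<Y> q f 0 1 ys e) {#} \<noteq> 0" using e(1) by (auto split: if_splits)
      then have "\<Y> (q v) ?C (f v) (- lookup e v - 1) ?w \<noteq> 0"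
        unfolding ys op_product_append using op_product_zero by (auto simp: w)
      then obtain \<mu> \<nu> d where *: "\<mu> \<in> keys (f v)" "\<nu> \<in> keys ?w"
        "- lookup e v - 1 = of_nat (mdeg \<mu>) + of_nat (mdeg \<nu>) - q v * ?C - 1 - of_nat d"
        by (rule intertwiner_nonzero[OF Y_intertwiner])
      have "lookup e v = (q v * ?C - of_nat (mdeg \<mu>) - of_nat (mdeg \<nu>)) + of_nat (2 * d) / 2"
        using *(3) by (simp add: algebra_simps eq_neg_iff_add_eq_0 minus_equation_iff)
      then show ?thesis
        by (intro bexI[OF _ imageI[of "(\<mu>, \<nu>)"]] exI[of _ "2 * d"]) (use *(1,2) in auto)
    qed
    then show ?thesis by (intro exI[of _ ?B]) auto
  qed
qed

lemma fcoeff_correlator: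
  assumes "sorted_wrt (<) ys"
  shows "fcoeff (correlator \<Y> q ys f) e =
    (if keys e \<subseteq> set ys then lookup (op_product \<Y> q f 0 1 ys e) {#} else 0)"
proof -
  have "fst ` set (map (\<lambda>y. (y, q y, f y)) ys) = set ys" by force
  then have "correlator \<Y> q ys f = series (\<lambda>e. if keys e \<subseteq> set ys
      then lookup (op_product \<Y> q f 0 1 ys e) {#} else 0)"
    unfolding correlator_def matrix_element_def product_coeff_op_product pairing_vacuum by simp
  then show ?thesis using fcoeff_series[OF admissible_correlator[OF assms, of q f]] by simp
qed

lemma rho_order_correlator:
  assumes "sorted_wrt (<) ys" "set ys \<subseteq> V" "\<And>y. y \<in> set ys \<Longrightarrow> var_class y < 4"
  shows "rho_order g V 0 (correlator \<Y> q ys f)"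
  unfolding rho_order_def
proof (intro allI impI)
  fix e assume "fcoeff (correlator \<Y> q ys f) e \<noteq> 0"
  then have k: "keys e \<subseteq> set ys" by (simp add: fcoeff_correlator[OF assms(1)] split: if_splits)
  have 0: "lookup e t = 0" if "4 \<le> var_class t" for t
    by (rule lookup_eq_0_if_var[OF k]) (use that assms(3) in force)
  then show "keys e \<subseteq> V \<and>
     (\<forall>u. 4 \<le> var_class u \<longrightarrow> (\<exists>k::nat. lookup e u = of_nat k / 2)) \<and> 0 \<le> rho_degree g e"
    using k assms(2) by (auto simp: rho_degree_def intro: exI[of _ "0::nat"])
qed

lemma op_product_update_add:
  "y \<in> set ys \<Longrightarrow> distinct ys \<Longrightarrow> op_product \<Y> q (f(y := u + v)) c w ys e =
     op_product \<Y> q (f(y := u)) c w ys e + op_product \<Y> q (f(y := v)) c w ys e"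
proof (induction ys)
  case (Cons x ys)
  show ?case
  proof (cases "x = y")
    case True
    then have "op_product \<Y> q (f(y := t)) c w ys e = op_product \<Y> q f c w ys e" for t
      by (intro op_product_cong) (use Cons.prems in auto)
    then show ?thesis by (simp only: op_product.simps True fun_upd_same intertwiner_add_left[OF Y_intertwiner])
  qed (use Cons in \<open>simp add: intertwiner_add_right[OF Y_intertwiner]\<close>)
qed simp

lemma op_product_update_scale:
  "y \<in> set ys \<Longrightarrow> distinct ys \<Longrightarrow> op_product \<Y> q (f(y := fscale k u)) c w ys e = fscale k (op_product \<Y> q (f(y := u)) c w ys e)"
proof (induction ys)
  case (Cons x ys)
  show ?case
  proof (cases "x = y")
    case True
    then have "op_product \<Y> q (f(y := t)) c w ys e = op_product \<Y> q f c w ys e" for t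
      by (intro op_product_cong) (use Cons.prems in auto)
    then show ?thesis by (simp only: op_product.simps True fun_upd_same intertwiner_scale_left[OF Y_intertwiner])
  qed (use Cons in \<open>simp add: intertwiner_scale_right[OF Y_intertwiner]\<close>)
qed simp

lemma correlator_update_add:
  assumes "sorted_wrt (<) ys" "y \<in> set ys"
  shows "correlator \<Y> q ys (f(y := u + v)) = correlator \<Y> q ys (f(y := u)) + correlator \<Y> q ys (f(y := v))"
  by (rule fseries_eqI)
     (simp add: fcoeff_correlator[OF assms(1)] op_product_update_add[OF assms(2) sorted_wrt_less_distinct[OF assms(1)]] lookup_add)

lemma correlator_update_scale:
  assumes "sorted_wrt (<) ys" "y \<in> set ys"
  shows "correlator \<Y> q ys (f(y := fscale k u)) = fconst k * correlator \<Y> q ys (f(y := u))"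
  by (rule fseries_eqI)
     (simp add: fcoeff_correlator[OF assms(1)] op_product_update_scale[OF assms(2) sorted_wrt_less_distinct[OF assms(1)]]
        fcoeff_fconst_mult)

lemma correlator_eq_0:
  assumes "sorted_wrt (<) ys" "y \<in> set ys" "f y = 0"
  shows "correlator \<Y> q ys f = 0"
  using correlator_update_scale[OF assms(1,2), of q f 0 0] assms(3) fun_upd_triv[of f y] by simp

lemma correlator_act_0:
  assumes "sorted_wrt (<) ys" "y \<in> set ys"
  shows "correlator \<Y> q ys (act q y 0 f) = fconst (q y) * correlator \<Y> q ys f"
  using correlator_update_scale[OF assms, of q f "q y" "f y"] by (simp add: act_def heis_def)

lemma correlator_vacuum:
  assumes "sorted_wrt (<) (L @ y # R)" "q y = 0" "f y = 1"
  shows "correlator \<Y> q (L @ y # R) f = correlator \<Y> q (L @ R) f"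
proof (rule fseries_eqI)
  fix e :: "var \<Rightarrow>\<^sub>0 complex"
  have s: "sorted_wrt (<) (L @ R)" using assms(1) by (auto simp: sorted_wrt_append)
  have y: "y \<notin> set (L @ R)" using sorted_wrt_less_distinct[OF assms(1)] by auto
  have k: "keys e \<subseteq> set (L @ R) \<longleftrightarrow> keys e \<subseteq> set (L @ y # R) \<and> lookup e y = 0"
    using y by (auto simp: in_keys_iff)
  have "- lookup e y - 1 = (- 1 :: complex) \<longleftrightarrow> lookup e y = 0" by simp
  then have "op_product \<Y> q f 0 1 (L @ y # R) e = (if lookup e y = 0 then op_product \<Y> q f 0 1 (L @ R) e else 0)"
    unfolding op_product_append by (simp add: assms(2,3) Y_vacuum op_product_zero)
  then show "fcoeff (correlator \<Y> q (L @ y # R) f) e = fcoeff (correlator \<Y> q (L @ R) f) e"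
    unfolding fcoeff_correlator[OF assms(1)] fcoeff_correlator[OF s] k by simp
qed

end

section \<open>Removing a Heisenberg mode from a correlation function\<close>

lemma heis_vacuum: "heis 0 (int i) 1 = 0"
  by (rule poly_mapping_eqI) (cases i, simp_all add: lookup_heis lookup_one)

lemma keys_shift_subset:
  fixes e :: "var \<Rightarrow>\<^sub>0 complex"
  assumes "y \<in> S" "y' \<in> S"
  shows "keys (e - (single y a + single y' b)) \<subseteq> S \<longleftrightarrow> keys e \<subseteq> S"
proof -
  have "keys d \<subseteq> S \<longleftrightarrow> (\<forall>x. x \<notin> S \<longrightarrow> lookup d x = 0)" for d :: "var \<Rightarrow>\<^sub>0 complex"
    by (auto simp: in_keys_iff)
  moreover have "lookup (e - (single y a + single y' b)) x = lookup e x"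
    if "x \<notin> S" for x
    using that assms by (auto simp: lookup_minus lookup_add lookup_single when_def)
  ultimately show ?thesis by auto
qed

lemma eventually_eq_0:
  fixes f :: "nat \<Rightarrow> 'a::zero"
  assumes "finite {k. f k \<noteq> 0}" shows "\<forall>\<^sub>F k in sequentially. f k = 0"
  using assms by (simp add: cofinite_eq_sequentially[symmetric] eventually_cofinite)

text \<open>
  If the total charge vanishes, the kernels may be normalised at the point \<open>A\<^sub>0\<close>: the terms added
  are proportional to the total charge. The value at the point itself compensates for the
  missing singular term.
\<close>

definition probe :: "nat \<Rightarrow> var \<Rightarrow> var \<Rightarrow> nat \<Rightarrow> var fseries" where
  "probe p y y' j = (if y' = y then if j = 0 then f0_deriv p y else 0 else pi1_deriv p j y y')"

context
  fixes \<Y> :: "complex \<Rightarrow> complex \<Rightarrow> fock \<Rightarrow> complex \<Rightarrow> fock \<Rightarrow> fock"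
  assumes Y: "heisenberg_intertwiners \<Y>"
begin

text \<open>
  By the iterate formula \<open>h(-p-1)\<close> at \<open>y\<close> is a sum of creation modes, to be moved to the left, and
  of annihilation modes, to be moved to the right. The former vanish against the dual vacuum and
  the latter on the vacuum; the commutators with the operator at \<open>y'\<close> add up to the Taylor
  coefficients of \<open>1/(y - y')\<close>, expanded according to the position of \<open>y'\<close>.
\<close>

lemma correlator_creation_mode:
  assumes sorted: "sorted_wrt (<) ys" and y: "y \<in> set ys"
    and K: "\<And>t j. t \<in> set ys \<Longrightarrow> j \<ge> K \<Longrightarrow> heis (q t) (int j) (f t) = 0"
  shows "correlator \<Y> q ys (act q y (- int (Suc p)) f) =
    (\<Sum>y'\<in>set ys - {y}. \<Sum>j<K. cauchy p j y y' * correlator \<Y> q ys (act q y' (int j) f))"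
proof (rule fseries_eqI)
  fix e :: "var \<Rightarrow>\<^sub>0 complex"
  obtain L R where ys: "ys = L @ y # R" using y by (meson split_list)
  have dist: "distinct ys" by (rule sorted_wrt_less_distinct[OF sorted])
  have L: "y' < y" if "y' \<in> set L" for y' using sorted that by (simp add: ys sorted_wrt_append)
  have R: "y < y'" if "y' \<in> set R" for y' using sorted that by (simp add: ys sorted_wrt_append)
  have split: "set ys - {y} = set L \<union> set R" "set L \<inter> set R = {}" using dist by (auto simp: ys)
  let ?corr = "\<lambda>y' j. correlator \<Y> q ys (act q y' (int j) f)"
  define EL where "EL y' j k = single y (of_nat k - of_nat p) + single y' (- of_nat k - 1 - of_nat j :: complex)"
    for y' and j k :: nat
  define ER where "ER y' j k = single y (- of_nat k - 1 - of_nat p) + single y' (of_nat k - of_nat j :: complex)"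
    for y' and j k :: nat
  define cL where "cL y' j k = - ((of_nat k gchoose p) * ((- of_nat k - 1) gchoose j)) * fcoeff (?corr y' j) (e - EL y' j k)"
    for y' j k
  define cR where "cR y' j k = ((- of_nat k - 1) gchoose p) * (of_nat k gchoose j) * fcoeff (?corr y' j) (e - ER y' j k)"
    for y' j k
  have SL: "finite {k. cL y' j k \<noteq> 0}" "fcoeff (cauchy p j y y' * ?corr y' j) e = Sum_any (cL y' j)"
    if "y' \<in> set L" for y' j
    using fcoeff_cauchy_mult_greater[OF L[OF that], of p j "?corr y' j" e] by (simp_all add: cL_def EL_def)
  have SR: "finite {k. cR y' j k \<noteq> 0}" "fcoeff (cauchy p j y y' * ?corr y' j) e = Sum_any (cR y' j)"
    if "y' \<in> set R" for y' j
    using fcoeff_cauchy_mult_less[OF R[OF that], of p j "?corr y' j" e] by (simp_all add: cR_def ER_def)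
  have rhs: "fcoeff (\<Sum>y'\<in>set ys - {y}. \<Sum>j<K. cauchy p j y y' * ?corr y' j) e =
      (\<Sum>y'\<in>set L. \<Sum>j<K. Sum_any (cL y' j)) + (\<Sum>y'\<in>set R. \<Sum>j<K. Sum_any (cR y' j))"
    unfolding split(1) fcoeff_sum
    by (subst sum.union_disjoint) (use split(2) SL(2) SR(2) in auto)
  show "fcoeff (correlator \<Y> q ys (act q y (- int (Suc p)) f)) e =
    fcoeff (\<Sum>y'\<in>set ys - {y}. \<Sum>j<K. cauchy p j y y' * ?corr y' j) e"
  proof (cases "keys e \<subseteq> set ys")
    case False
    have "y' \<in> set ys" if "y' \<in> set L \<union> set R" for y' using that by (auto simp: ys)
    then have "fcoeff (?corr y' j) (e - (single y a + single y' b)) = 0"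
      if "y' \<in> set L \<union> set R" for y' j a b
      using False keys_shift_subset[OF y, of y' e] that by (simp add: fcoeff_correlator[OF Y sorted])
    then have "cL y' j k = 0" if "y' \<in> set L" for y' j k using that by (simp add: cL_def EL_def)
    moreover have "cR y' j k = 0" if "y' \<in> set R" for y' j k
      using \<open>\<And>y' j a b. y' \<in> set L \<union> set R \<Longrightarrow>
        fcoeff (?corr y' j) (e - (single y a + single y' b)) = 0\<close> that
      by (simp add: cR_def ER_def)
    ultimately show ?thesis using False unfolding rhs by (simp add: fcoeff_correlator[OF Y sorted])
  next
    case True
    let ?l = "\<lambda>v. lookup v ({#} :: nat multiset)"
    let ?G = "\<lambda>y' j d. ?l (op_product \<Y> q (act q y' (int j) f) 0 1 ys d)"
    have G: "fcoeff (?corr y' j) (e - (single y a + single y' b)) =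
        ?G y' j (e - (single y a + single y' b))" if "y' \<in> set L \<union> set R" for y' j a b
    proof -
      have "y' \<in> set ys" using that by (auto simp: ys)
      then show ?thesis using True keys_shift_subset[OF y, of y' e] by (simp add: fcoeff_correlator[OF Y sorted])
    qed
    define C where "C = sum_list (map q R) + 0"
    define x where "x = op_product \<Y> q f 0 1 R e"
    define s where "s = - lookup e y - 1"
    let ?J = "\<Y> (q y) C" and ?n = "\<lambda>i. - int (Suc p) - int i"
    have ev: "\<forall>\<^sub>F i in sequentially. ?J (f y) (s + of_nat i) x = 0 \<and> heis C (int i) x = 0 \<and>
        (\<forall>y'\<in>set L. \<forall>j\<in>{..<K}. cL y' j (p + i) = 0) \<and> (\<forall>y'\<in>set R. \<forall>j\<in>{..<K}. cR y' j i = 0)"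
    proof (intro eventually_conj eventually_ball_finite ballI finite_set finite_lessThan)
      show "\<forall>\<^sub>F i in sequentially. ?J (f y) (s + of_nat i) x = 0"
        by (rule intertwiner_eventually_0[OF Y_intertwiner[OF Y]])
      show "\<forall>\<^sub>F i in sequentially. heis C (int i) x = 0"
        using heis_eventually_0[of C x] by (simp add: eventually_sequentially)
      show "\<forall>\<^sub>F i in sequentially. cL y' j (p + i) = 0" if "y' \<in> set L" for y' j
        using eventually_eq_0[OF SL(1)[OF that, of j]] eventually_sequentially_seg[of "\<lambda>k. cL y' j k = 0" p]
        by (simp add: add.commute)
      show "\<forall>\<^sub>F i in sequentially. cR y' j i = 0" if "y' \<in> set R" for y' j
        by (rule eventually_eq_0[OF SR(1)[OF that]])
    qed
    then obtain T where "\<forall>i\<ge>T. ?J (f y) (s + of_nat i) x = 0 \<and> heis C (int i) x = 0 \<and>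
        (\<forall>y'\<in>set L. \<forall>j\<in>{..<K}. cL y' j (p + i) = 0) \<and> (\<forall>y'\<in>set R. \<forall>j\<in>{..<K}. cR y' j i = 0)"
      unfolding eventually_sequentially by (rule exE)
    then have T: "\<And>i. i \<ge> T \<Longrightarrow> ?J (f y) (s + of_nat i) x = 0" "\<And>i. i \<ge> T \<Longrightarrow> heis C (int i) x = 0"
      "\<And>i y' j. i \<ge> T \<Longrightarrow> y' \<in> set L \<Longrightarrow> j < K \<Longrightarrow> cL y' j (p + i) = 0"
      "\<And>i y' j. i \<ge> T \<Longrightarrow> y' \<in> set R \<Longrightarrow> j < K \<Longrightarrow> cR y' j i = 0"
      by auto
    have CL: "sum_list (map q (y # R)) + 0 = q y + C" by (simp add: C_def)
    \<comment> \<open>the operators at \<open>y\<close> and to its right, applied to the vacuum with shifted exponents\<close>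
    have glue: "op_product \<Y> q f' (q y + C) (?J (f' y) (- lookup d y - 1) (op_product \<Y> q f' 0 1 R d)) L d =
        op_product \<Y> q f' 0 1 ys d" for f' d
      unfolding ys op_product_append CL by (simp add: C_def)
    have lhs: "op_product \<Y> q (act q y (- int (Suc p)) f) 0 1 ys e =
        op_product \<Y> q f (q y + C) (?J (heis (q y) (- int (Suc p)) (f y)) s x) L e"
    proof -
      have "op_product \<Y> q (act q y (- int (Suc p)) f) 0 1 R e = x" unfolding x_def
        by (rule op_product_cong) (use dist in \<open>auto simp: ys act_def\<close>)
      moreover have "op_product \<Y> q (act q y (- int (Suc p)) f) c w L e = op_product \<Y> q f c w L e" for c w
        by (rule op_product_cong) (use dist in \<open>auto simp: ys act_def\<close>)
      ultimately show ?thesis unfolding glue[symmetric] by (simp add: act_def s_def)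
    qed
    have creation: "?l (op_product \<Y> q f (q y + C) (heis (q y + C) (?n i) (?J (f y) (s + of_nat i) x)) L e) =
        - (\<Sum>y'\<in>set L. \<Sum>j<K. ((- of_nat (p + i) - 1) gchoose j) * ?G y' j (e - EL y' j (p + i)))" for i
    proof -
      let ?w = "?J (f y) (s + of_nat i) x"
      have shifted: "op_product \<Y> q (act q y' (int j) f) (q y + C) ?w L (e - single y' (of_int (?n i) - of_nat j)) =
          op_product \<Y> q (act q y' (int j) f) 0 1 ys (e - EL y' j (p + i))" if y': "y' \<in> set L" for y' j
      proof -
        have ne: "y' \<noteq> y" "y' \<notin> set R" using y' dist by (auto simp: ys)
        have 1: "op_product \<Y> q (act q y' (int j) f) 0 1 R (e - EL y' j (p + i)) = x" unfolding x_def
          by (rule op_product_cong) (use ne dist in \<open>auto simp: act_def EL_def ys lookup_minus lookup_add lookup_single when_def\<close>)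
        have 2: "- lookup (e - EL y' j (p + i)) y - 1 = s + of_nat i"
          using ne by (simp add: EL_def s_def lookup_minus lookup_add lookup_single)
        have 3: "act q y' (int j) f y = f y" using ne by (simp add: act_def)
        have "(of_int (?n i) - of_nat j :: complex) = - of_nat (p + i) - 1 - of_nat j" by simp
        then have 4: "op_product \<Y> q (act q y' (int j) f) c w L (e - single y' (of_int (?n i) - of_nat j)) =
            op_product \<Y> q (act q y' (int j) f) c w L (e - EL y' j (p + i))" for c w
          by (intro op_product_cong) (use dist in \<open>auto simp: EL_def ys lookup_minus lookup_add lookup_single when_def\<close>)
        show ?thesis unfolding glue[symmetric] 1 2 3 4 ..
      qed
      have "heis (sum_list (map q L) + (q y + C)) (?n i) (op_product \<Y> q f (q y + C) ?w L e) =
          op_product \<Y> q f (q y + C) (heis (q y + C) (?n i) ?w) L e +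
          (\<Sum>y'\<in>set L. \<Sum>j<K. fscale (of_int (?n i) gchoose j)
            (op_product \<Y> q (act q y' (int j) f) (q y + C) ?w L (e - single y' (of_int (?n i) - of_nat j))))"
        by (rule heis_op_product[OF Y]) (use dist K in \<open>auto simp: ys\<close>)
      also have "(\<Sum>y'\<in>set L. \<Sum>j<K. fscale (of_int (?n i) gchoose j)
            (op_product \<Y> q (act q y' (int j) f) (q y + C) ?w L (e - single y' (of_int (?n i) - of_nat j)))) =
          (\<Sum>y'\<in>set L. \<Sum>j<K. fscale ((- of_nat (p + i) - 1) gchoose j)
            (op_product \<Y> q (act q y' (int j) f) 0 1 ys (e - EL y' j (p + i))))"
      proof (intro sum.cong refl arg_cong2[where f = fscale])
        have "(of_int (?n i) :: complex) = - of_nat (p + i) - 1" by simp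
        then show "(of_int (?n i) gchoose j) = ((- of_nat (p + i) - 1) gchoose j :: complex)" for j by (simp only:)
      qed (rule shifted)
      finally have "?l (heis (sum_list (map q L) + (q y + C)) (?n i) (op_product \<Y> q f (q y + C) ?w L e)) =
          ?l (op_product \<Y> q f (q y + C) (heis (q y + C) (?n i) ?w) L e) +
          (\<Sum>y'\<in>set L. \<Sum>j<K. ((- of_nat (p + i) - 1) gchoose j) * ?G y' j (e - EL y' j (p + i)))"
        by (simp add: lookup_add lookup_sum)
      moreover have "?l (heis c (?n i) w) = 0" for c w by (subst lookup_heis_neg) auto
      ultimately show ?thesis by (simp add: eq_neg_iff_add_eq_0)
    qed
    have annihilation: "?l (op_product \<Y> q f (q y + C) (?J (f y) (s - of_nat (Suc p) - of_nat i) (heis C (int i) x)) L e) =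
        (\<Sum>y'\<in>set R. \<Sum>j<K. (of_nat i gchoose j) * ?G y' j (e - ER y' j i))" for i
    proof -
      have shifted: "op_product \<Y> q f (q y + C) (?J (f y) (s - of_nat (Suc p) - of_nat i)
            (op_product \<Y> q (act q y' (int j) f) 0 1 R (e - single y' (of_int (int i) - of_nat j)))) L e =
          op_product \<Y> q (act q y' (int j) f) 0 1 ys (e - ER y' j i)" if y': "y' \<in> set R" for y' j
      proof -
        have ne: "y' \<noteq> y" "y' \<notin> set L" using y' dist by (auto simp: ys)
        have 1: "op_product \<Y> q (act q y' (int j) f) 0 1 R (e - single y' (of_int (int i) - of_nat j)) =
            op_product \<Y> q (act q y' (int j) f) 0 1 R (e - ER y' j i)"
          by (rule op_product_cong) (use dist in \<open>auto simp: ER_def ys lookup_minus lookup_add lookup_single when_def\<close>)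
        have 2: "s - of_nat (Suc p) - of_nat i = - lookup (e - ER y' j i) y - 1"
          using ne by (simp add: ER_def s_def lookup_minus lookup_add lookup_single)
        have 3: "act q y' (int j) f y = f y" using ne by (simp add: act_def)
        have 4: "op_product \<Y> q f c w L e = op_product \<Y> q (act q y' (int j) f) c w L (e - ER y' j i)" for c w
          by (rule op_product_cong) (use ne dist in \<open>auto simp: act_def ER_def ys lookup_minus lookup_add lookup_single when_def\<close>)
        show ?thesis unfolding glue[symmetric] 1 2 3 4 ..
      qed
      have "heis C (int i) x = (\<Sum>y'\<in>set R. \<Sum>j<K. fscale (of_int (int i) gchoose j)
          (op_product \<Y> q (act q y' (int j) f) 0 1 R (e - single y' (of_int (int i) - of_nat j))))"
        unfolding C_def x_def
        by (subst heis_op_product[OF Y, where K = K]) (use dist K in \<open>auto simp: ys heis_vacuum op_product_zero[OF Y]\<close>)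
      also have "\<dots> = (\<Sum>(y', j)\<in>set R \<times> {..<K}. fscale (of_nat i gchoose j)
          (op_product \<Y> q (act q y' (int j) f) 0 1 R (e - single y' (of_int (int i) - of_nat j))))"
        by (simp add: sum.cartesian_product)
      finally have "op_product \<Y> q f (q y + C) (?J (f y) (s - of_nat (Suc p) - of_nat i) (heis C (int i) x)) L e =
          (\<Sum>(y', j)\<in>set R \<times> {..<K}. fscale (of_nat i gchoose j)
            (op_product \<Y> q f (q y + C) (?J (f y) (s - of_nat (Suc p) - of_nat i)
              (op_product \<Y> q (act q y' (int j) f) 0 1 R (e - single y' (of_int (int i) - of_nat j)))) L e))"
        by (simp only: case_prod_unfold intertwiner_sum_right[OF Y_intertwiner[OF Y]] op_product_sum[OF Y])
      also have "\<dots> = (\<Sum>(y', j)\<in>set R \<times> {..<K}. fscale (of_nat i gchoose j)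
          (op_product \<Y> q (act q y' (int j) f) 0 1 ys (e - ER y' j i)))"
        by (rule sum.cong[OF refl]) (use shifted in auto)
      finally show ?thesis by (simp add: lookup_sum sum.cartesian_product case_prod_unfold)
    qed
    have "op_product \<Y> q (act q y (- int (Suc p)) f) 0 1 ys e =
        (\<Sum>i<T. fscale (of_nat ((p + i) choose p))
          (op_product \<Y> q f (q y + C) (heis (q y + C) (?n i) (?J (f y) (s + of_nat i) x)) L e +
           fscale ((- 1) ^ p) (op_product \<Y> q f (q y + C) (?J (f y) (s - of_nat (Suc p) - of_nat i) (heis C (int i) x)) L e)))"
      unfolding lhs
      by (subst intertwiner_iterate[OF Y_intertwiner[OF Y], where K = T])
         (use T(1,2) in \<open>simp_all only: op_product_sum[OF Y] op_product_add[OF Y] op_product_scale[OF Y]\<close>)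
    then have "fcoeff (correlator \<Y> q ys (act q y (- int (Suc p)) f)) e =
        (\<Sum>i<T. of_nat ((p + i) choose p) *
          (- (\<Sum>y'\<in>set L. \<Sum>j<K. ((- of_nat (p + i) - 1) gchoose j) * ?G y' j (e - EL y' j (p + i))) +
           (- 1) ^ p * (\<Sum>y'\<in>set R. \<Sum>j<K. (of_nat i gchoose j) * ?G y' j (e - ER y' j i))))"
      using True by (simp only: fcoeff_correlator[OF Y sorted] if_True lookup_sum lookup_add lookup_fscale creation annihilation)
    also have "\<dots> = (\<Sum>i<T. (\<Sum>y'\<in>set L. \<Sum>j<K. cL y' j (p + i)) + (\<Sum>y'\<in>set R. \<Sum>j<K. cR y' j i))"
    proof (rule sum.cong[OF refl])
      fix i
      have "cL y' j (p + i) = - (of_nat ((p + i) choose p) * (((- of_nat (p + i) - 1) gchoose j) * ?G y' j (e - EL y' j (p + i))))"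
        if "y' \<in> set L" for y' j
        using G[of y'] that by (simp add: cL_def EL_def binomial_gbinomial)
      moreover have "cR y' j i = of_nat ((p + i) choose p) * ((- 1) ^ p * ((of_nat i gchoose j) * ?G y' j (e - ER y' j i)))"
        if "y' \<in> set R" for y' j
        using G[of y'] that by (simp add: cR_def ER_def gbinomial_neg_Suc add.commute[of i p])
      ultimately show "of_nat ((p + i) choose p) *
          (- (\<Sum>y'\<in>set L. \<Sum>j<K. ((- of_nat (p + i) - 1) gchoose j) * ?G y' j (e - EL y' j (p + i))) +
           (- 1) ^ p * (\<Sum>y'\<in>set R. \<Sum>j<K. (of_nat i gchoose j) * ?G y' j (e - ER y' j i))) =
          (\<Sum>y'\<in>set L. \<Sum>j<K. cL y' j (p + i)) + (\<Sum>y'\<in>set R. \<Sum>j<K. cR y' j i)"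
        by (simp add: distrib_left right_diff_distrib sum_distrib_left sum_negf)
    qed
    also have "\<dots> = (\<Sum>y'\<in>set L. \<Sum>j<K. \<Sum>i<T. cL y' j (p + i)) + (\<Sum>y'\<in>set R. \<Sum>j<K. \<Sum>i<T. cR y' j i)"
      by (simp add: sum.distrib sum.swap[of _ "{..<T}"])
    also have "(\<Sum>y'\<in>set L. \<Sum>j<K. \<Sum>i<T. cL y' j (p + i)) = (\<Sum>y'\<in>set L. \<Sum>j<K. Sum_any (cL y' j))"
    proof (intro sum.cong refl)
      fix y' j assume y': "y' \<in> set L" "j \<in> {..<K}"
      \<comment> \<open>creation modes start at \<open>h(-p-1)\<close>, the term \<open>k = p\<close> of the kernel; its earlier terms vanish\<close>
      have "k \<in> (+) p ` {..<T}" if "cL y' j k \<noteq> 0" for k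
      proof -
        have "p \<le> k"
        proof (rule ccontr)
          assume "\<not> p \<le> k"
          then have "(of_nat k gchoose p :: complex) = 0" by (simp flip: binomial_gbinomial)
          then show False using that by (simp add: cL_def)
        qed
        then have "k = p + (k - p)" by simp
        moreover have "k - p < T" using T(3)[of "k - p" y' j] y' that \<open>p \<le> k\<close> by fastforce
        ultimately show ?thesis by blast
      qed
      then have "Sum_any (cL y' j) = sum (cL y' j) ((+) p ` {..<T})"
        by (intro Sum_any.expand_superset) auto
      then show "(\<Sum>i<T. cL y' j (p + i)) = Sum_any (cL y' j)" by (simp add: sum.reindex)
    qed
    also have "(\<Sum>y'\<in>set R. \<Sum>j<K. \<Sum>i<T. cR y' j i) = (\<Sum>y'\<in>set R. \<Sum>j<K. Sum_any (cR y' j))"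
    proof (intro sum.cong refl)
      fix y' j assume "y' \<in> set R" "j \<in> {..<K}"
      then show "(\<Sum>i<T. cR y' j i) = Sum_any (cR y' j)"
        using T(4) by (intro Sum_any.expand_superset[symmetric]) (force simp: not_le[symmetric])+
    qed
    finally show ?thesis unfolding rhs .
  qed
qed

lemma correlator_creation_mode_pi1:
  assumes sorted: "sorted_wrt (<) ys" and y: "y \<in> set ys" and A0: "A0 \<notin> set ys"
    and charge: "sum_list (map q ys) = 0"
    and K: "\<And>t j. t \<in> set ys \<Longrightarrow> j \<ge> K \<Longrightarrow> heis (q t) (int j) (f t) = 0" and "K > 0"
  shows "correlator \<Y> q ys (act q y (- int (Suc p)) f) =
    (\<Sum>y'\<in>set ys. \<Sum>j<K. probe p y y' j * correlator \<Y> q ys (act q y' (int j) f))"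
proof -
  let ?c = "\<lambda>y' j. correlator \<Y> q ys (act q y' (int j) f)" and ?F = "correlator \<Y> q ys f"
  have ne: "y \<noteq> A0" "y' \<noteq> A0" if "y' \<in> set ys" for y' using A0 y that by auto
  let ?k = "\<lambda>y' j. if y' = y then 0 else cauchy p j y y'"
  have probe: "probe p y y' j = ?k y' j - (if j = 0 then cauchy p 0 y A0 else 0)" if "y' \<in> set ys" for y' j
    using ne[OF that] by (cases j) (auto simp: probe_def f0_deriv_eq pi1_deriv_0 pi1_deriv_Suc)
  have "(\<Sum>y'\<in>set ys. \<Sum>j<K. probe p y y' j * ?c y' j) =
      (\<Sum>y'\<in>set ys. (\<Sum>j<K. ?k y' j * ?c y' j) - cauchy p 0 y A0 * ?c y' 0)"
  proof (rule sum.cong[OF refl])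
    fix y' assume y': "y' \<in> set ys"
    have "(\<Sum>j<K. (if j = 0 then cauchy p 0 y A0 else 0) * ?c y' j) = cauchy p 0 y A0 * ?c y' 0"
      using \<open>K > 0\<close> by (subst sum.remove[of _ 0]) auto
    then show "(\<Sum>j<K. probe p y y' j * ?c y' j) = (\<Sum>j<K. ?k y' j * ?c y' j) - cauchy p 0 y A0 * ?c y' 0"
      by (simp only: probe[OF y'] left_diff_distrib sum_subtractf)
  qed
  also have "\<dots> = (\<Sum>y'\<in>set ys. \<Sum>j<K. ?k y' j * ?c y' j) - cauchy p 0 y A0 * (\<Sum>y'\<in>set ys. ?c y' 0)"
    by (simp only: sum_subtractf sum_distrib_left)
  also have "(\<Sum>y'\<in>set ys. ?c y' 0) = 0"
  proof -
    have "(\<Sum>y'\<in>set ys. ?c y' 0) = (\<Sum>y'\<in>set ys. fconst (q y')) * ?F"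
      using correlator_act_0[OF Y sorted] by (simp add: sum_distrib_right)
    also have "(\<Sum>y'\<in>set ys. fconst (q y')) = fconst (sum_list (map q ys))"
      using sum_list_distinct_conv_sum_set[OF sorted_wrt_less_distinct[OF sorted], of q] by (simp add: fconst_sum)
    finally show ?thesis by (simp add: charge)
  qed
  also have "(\<Sum>y'\<in>set ys. \<Sum>j<K. ?k y' j * ?c y' j) = (\<Sum>y'\<in>set ys - {y}. \<Sum>j<K. cauchy p j y y' * ?c y' j)"
    using y by (subst sum.remove[of _ y]) auto
  also have "\<dots> = correlator \<Y> q ys (act q y (- int (Suc p)) f)"
    by (rule correlator_creation_mode[symmetric]) (use sorted y K in auto)
  finally show ?thesis by simp
qed

end

section \<open>Traces over the sewn modules\<close>

definition charge :: "(nat \<Rightarrow> complex) \<Rightarrow> (nat \<Rightarrow> complex) \<Rightarrow> var \<Rightarrow> complex" where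
  "charge \<alpha> \<gamma> y = (case y of Z j \<Rightarrow> \<gamma> j | W a \<Rightarrow> (if a > 0 then \<alpha> (nat a) else - \<alpha> (nat (- a))) | _ \<Rightarrow> 0)"

definition state :: "(nat \<Rightarrow> fock set) \<Rightarrow> (nat \<Rightarrow> fock) \<Rightarrow> var \<Rightarrow> fock" where
  "state B b y = (case y of X i \<Rightarrow> h_state
     | W a \<Rightarrow> (if a > 0 then b (nat a) else dual_vector (B (nat (- a))) (b (nat (- a)))) | _ \<Rightarrow> 1)"

definition points :: "nat \<Rightarrow> nat \<Rightarrow> nat list \<Rightarrow> var list" where
  "points g m xs = map X xs @ map Z [1..<m + 1] @ concat (map (\<lambda>a. [W (int a), W (- int a)]) [1..<g + 1])"

definition weight :: "nat \<Rightarrow> (nat \<Rightarrow> fock) \<Rightarrow> var fseries" where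
  "weight g b = (\<Prod>a=1..g. vpow (Rho a) (of_nat (fdegree (b a))))"

definition total_degree :: "nat \<Rightarrow> (nat \<Rightarrow> fock) \<Rightarrow> nat" where
  "total_degree g b = (\<Sum>a=1..g. fdegree (b a))"

abbreviation handles :: "nat \<Rightarrow> int set" where
  "handles g \<equiv> {a. a \<noteq> 0 \<and> \<bar>a\<bar> \<le> int g}"

definition surface_vars :: "nat \<Rightarrow> var set" where
  "surface_vars g = insert A0 (W ` handles g \<union> Rho ` {1..g})"

lemma finite_handles: "finite (handles g)"
  by (rule finite_subset[of _ "{- int g..int g}"]) auto

lemma finite_surface_vars: "finite (surface_vars g)"
  by (simp add: surface_vars_def finite_handles)

lemma indices_handles: "indices g = handles g \<times> UNIV"
  by (simp add: indices_def)

lemma set_handle_points: "set (concat (map (\<lambda>a. [W (int a), W (- int a)]) [1..<g + 1])) = W ` handles g"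
proof (rule set_eqI)
  fix y
  show "y \<in> set (concat (map (\<lambda>a. [W (int a), W (- int a)]) [1..<g + 1])) \<longleftrightarrow> y \<in> W ` handles g"
  proof
    assume "y \<in> W ` handles g"
    then obtain a where a: "y = W a" "a \<noteq> 0" "\<bar>a\<bar> \<le> int g" by auto
    then have "nat \<bar>a\<bar> \<in> {1..<g + 1}" "y \<in> {W (int (nat \<bar>a\<bar>)), W (- int (nat \<bar>a\<bar>))}" by auto
    then show "y \<in> set (concat (map (\<lambda>a. [W (int a), W (- int a)]) [1..<g + 1]))" by force
  qed auto
qed

lemma set_points: "set (points g m xs) = X ` set xs \<union> Z ` {1..m} \<union> W ` handles g"
  unfolding points_def set_append set_handle_points by auto

lemma sorted_handle_points: "sorted_wrt (<) (concat (map (\<lambda>a. [W (int a), W (- int a)]) [1..<g + 1]))"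
proof (induction g)
  case (Suc g)
  have "W a < W b" if "a \<in> handles g" "b \<in> {int (Suc g), - int (Suc g)}" for a b
    using that by (auto simp: less_var_def)
  moreover have "W (int (Suc g)) < W (- int (Suc g))" by (simp add: less_var_def)
  moreover have "concat (map (\<lambda>a. [W (int a), W (- int a)]) [1..<Suc g + 1]) =
      concat (map (\<lambda>a. [W (int a), W (- int a)]) [1..<g + 1]) @ [W (int (Suc g)), W (- int (Suc g))]"
    by simp
  ultimately show ?case using Suc
    by (simp only: sorted_wrt_append set_handle_points) auto
qed simp

lemma sorted_points: "sorted_wrt (<) xs \<Longrightarrow> sorted_wrt (<) (points g m xs)"
proof -
  assume xs: "sorted_wrt (<) xs"
  have 1: "sorted_wrt (<) (map X xs)"
    using xs by (simp add: sorted_wrt_map less_var_def)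
  have 2: "sorted_wrt (<) (map Z [1..<m + 1])"
    using sorted_wrt_upt[of 1 "m + 1"] by (simp add: sorted_wrt_map less_var_def)
  show ?thesis unfolding points_def sorted_wrt_append set_handle_points set_append
    using 1 2 sorted_handle_points[of g] by (auto simp: less_var_def)
qed

lemma sum_list_charge_points: "sum_list (map (charge \<alpha> \<gamma>) (points g m xs)) = (\<Sum>j=1..m. \<gamma> j)"
proof -
  have "sum_list (map (charge \<alpha> \<gamma>) (map X xs)) = 0" by (induction xs) (simp_all add: charge_def)
  moreover have "sum_list (map (charge \<alpha> \<gamma>) (map Z [1..<m + 1])) = (\<Sum>j=1..m. \<gamma> j)"
    by (induction m) (simp_all add: charge_def)
  moreover have "sum_list (map (charge \<alpha> \<gamma>) (concat (map (\<lambda>a. [W (int a), W (- int a)]) [1..<g + 1]))) = 0"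
    by (induction g) (simp_all add: charge_def nat_add_distrib)
  ultimately show ?thesis by (simp add: points_def)
qed

lemma var_class_points: "y \<in> set (points g m xs) \<Longrightarrow> var_class y < 4 \<and> y \<noteq> A0"
  by (auto simp: set_points)

lemma formal_sum_finite_support:
  assumes "finite V" "finite P" "P \<subseteq> I" "\<And>i. i \<in> P \<Longrightarrow> rho_order g V 0 (F i)" "\<And>i. i \<in> I - P \<Longrightarrow> F i = 0"
  shows "formal_sum F I = sum F P" "rho_summable g V F I"
proof -
  have o: "rho_order g V 0 (F i)" if "i \<in> I" for i using assms(4,5) that by (cases "i \<in> P") auto
  have "{i \<in> I. \<not> rho_order g V (of_nat N) (F i)} \<subseteq> P" for N :: nat using assms(5) by force
  then show s: "rho_summable g V F I" using o assms(1,2) unfolding rho_summable_def by (meson finite_subset)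
  show "formal_sum F I = sum F P"
    by (rule eq_if_rho_order_diff[of g V], rule formal_sum_truncate[OF s assms(2,3)]) (simp add: assms(5))
qed

lemma formal_sum_Suc:
  assumes "rho_summable g V F (UNIV :: nat set)"
  shows "formal_sum F UNIV = F 0 + formal_sum (\<lambda>n. F (Suc n)) UNIV" "rho_summable g V (\<lambda>n. F (Suc n)) UNIV"
proof -
  have "Suc ` {n. \<not> rho_order g V (of_nat N) (F (Suc n))} \<subseteq> {n \<in> UNIV. \<not> rho_order g V (of_nat N) (F n)}" for N :: nat
    by auto
  then have "finite {n. \<not> rho_order g V (of_nat N) (F (Suc n))}" for N :: nat
    by (rule finite_imageD[OF finite_subset]) (use assms in \<open>auto simp: rho_summable_def\<close>)
  then show s: "rho_summable g V (\<lambda>n. F (Suc n)) UNIV" using assms unfolding rho_summable_def by auto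
  show "formal_sum F UNIV = F 0 + formal_sum (\<lambda>n. F (Suc n)) UNIV"
  proof (rule eq_if_rho_order_diff[of g V])
    fix N :: nat
    have "finite {n. \<not> rho_order g V (of_nat N) (F n)}" using assms by (simp add: rho_summable_def)
    from finite_nat_iff_bounded[THEN iffD1, OF this]
    obtain M where M: "{n. \<not> rho_order g V (of_nat N) (F n)} \<subseteq> {..<M}" by (rule exE)
    have o: "rho_order g V (of_nat N) (F n)" if "n \<ge> M" for n using M that by fastforce
    have "rho_order g V (of_nat N) (formal_sum F UNIV - (\<Sum>n<Suc M. F n))"
      by (rule formal_sum_truncate[OF assms]) (auto intro: o)
    moreover have "rho_order g V (of_nat N) (formal_sum (\<lambda>n. F (Suc n)) UNIV - (\<Sum>n<M. F (Suc n)))"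
      by (rule formal_sum_truncate[OF s]) (auto intro: o)
    ultimately have "rho_order g V (of_nat N) ((formal_sum F UNIV - (\<Sum>n<Suc M. F n)) -
        (formal_sum (\<lambda>n. F (Suc n)) UNIV - (\<Sum>n<M. F (Suc n))))" by (rule rho_order_diff)
    then show "rho_order g V (of_nat N) (formal_sum F UNIV - (F 0 + formal_sum (\<lambda>n. F (Suc n)) UNIV))"
      by (simp add: sum.lessThan_Suc_shift algebra_simps del: sum.lessThan_Suc)
  qed
qed

lemma heis_h_state: "heis 0 (int j) h_state = (if j = 1 then 1 else 0)"
proof (rule poly_mapping_eqI)
  fix \<mu> :: "nat multiset"
  show "lookup (heis 0 (int j) h_state) \<mu> = lookup (if j = 1 then 1 else 0) \<mu>"
  proof (cases "j = 0")
    case False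
    then show ?thesis
      by (auto simp: lookup_heis_pos h_state_def lookup_single when_def lookup_one add_mset_eq_single)
  qed (simp add: lookup_heis_0)
qed

lemma heis_creates_h_state: "heis 0 (- 1) 1 = h_state"
  by (simp add: heis_def h_state_def)

text \<open>
  The set \<open>V\<close> contains the variables of all series under consideration. Those of the surface are
  required here, those of the insertions where they occur.
\<close>

locale heisenberg_sewing =
  fixes \<Y> :: "complex \<Rightarrow> complex \<Rightarrow> fock \<Rightarrow> complex \<Rightarrow> fock \<Rightarrow> fock"
    and g m :: nat and \<alpha> \<gamma> :: "nat \<Rightarrow> complex" and B :: "nat \<Rightarrow> fock set" and V :: "var set"
  assumes Y: "heisenberg_intertwiners \<Y>"
    and basis: "\<And>a. a \<in> {1..g} \<Longrightarrow> homogeneous_basis (B a)"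
    and charge_0: "(\<Sum>j=1..m. \<gamma> j) = 0"
    and V: "finite V" "surface_vars g \<subseteq> V"
begin

abbreviation "q \<equiv> charge \<alpha> \<gamma>"
abbreviation "basis_choices \<equiv> PiE {1..g} B"

lemma V_Rho: "a \<in> {1..g} \<Longrightarrow> Rho a \<in> V" and V_A0: "A0 \<in> V" and V_W: "c \<in> handles g \<Longrightarrow> W c \<in> V"
  using V(2) by (auto simp: surface_vars_def)

text \<open>
  The states are arbitrary functions of the chosen basis elements, so that modes may act on these
  before the sum is taken.
\<close>

definition sewn :: "var list \<Rightarrow> ((nat \<Rightarrow> fock) \<Rightarrow> var \<Rightarrow> fock) \<Rightarrow> var fseries" where
  "sewn ys s = formal_sum (\<lambda>b. correlator \<Y> q ys (s b) * weight g b) basis_choices"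

lemma rho_order_weight: "rho_order g V (of_nat (total_degree g b)) (weight g b)"
proof -
  have "rho_order g V (of_nat (fdegree (b a))) (vpow (Rho a) (of_nat (fdegree (b a))))" if "a \<in> {1..g}" for a
    using rho_order_vpow_Rho[of a g V "of_nat (fdegree (b a))" "2 * fdegree (b a)"] that V_Rho by simp
  then have "rho_order g V (\<Sum>a=1..g. of_nat (fdegree (b a))) (weight g b)"
    unfolding weight_def by (rule rho_order_prod)
  then show ?thesis by (simp add: total_degree_def)
qed

lemma finite_choices_degree: "finite {b \<in> basis_choices. total_degree g b \<le> N}"
proof (rule finite_subset)
  show "{b \<in> basis_choices. total_degree g b \<le> N} \<subseteq> PiE {1..g} (\<lambda>a. {c \<in> B a. fdegree c \<le> N})"
  proof clarify
    fix b assume b: "b \<in> basis_choices" "total_degree g b \<le> N"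
    have "fdegree (b a) \<le> N" if "a \<in> {1..g}" for a
    proof -
      have "fdegree (b a) \<le> total_degree g b"
        unfolding total_degree_def by (rule member_le_sum) (use that in auto)
      then show ?thesis using b(2) by simp
    qed
    then show "b \<in> PiE {1..g} (\<lambda>a. {c \<in> B a. fdegree c \<le> N})" using b(1) by (auto simp: PiE_iff)
  qed
  show "finite (PiE {1..g} (\<lambda>a. {c \<in> B a. fdegree c \<le> N}))"
    by (rule finite_PiE) (use finite_basis_degree_le basis in auto)
qed

lemma rho_order_sewn_term:
  assumes "sorted_wrt (<) ys" "set ys \<subseteq> V" "\<And>y. y \<in> set ys \<Longrightarrow> var_class y < 4"
  shows "rho_order g V (of_nat (total_degree g b)) (correlator \<Y> q ys f * weight g b)"
  by (rule rho_order_multI[OF rho_order_correlator[OF Y assms] rho_order_weight]) auto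

lemma rho_summable_sewn:
  assumes "sorted_wrt (<) ys" "set ys \<subseteq> V" "\<And>y. y \<in> set ys \<Longrightarrow> var_class y < 4"
  shows "rho_summable g V (\<lambda>b. correlator \<Y> q ys (s b) * weight g b) basis_choices"
proof (rule rho_summableI[OF V(1) rho_order_sewn_term[OF assms]])
  show "finite {b \<in> basis_choices. real (total_degree g b) < real N}" for N
    by (rule finite_subset[OF _ finite_choices_degree[of N]]) auto
qed auto

lemma sewn_cong:
  assumes "\<And>b. b \<in> basis_choices \<Longrightarrow> correlator \<Y> q ys (s b) = correlator \<Y> q ys' (s' b)"
  shows "sewn ys s = sewn ys' s'"
  unfolding sewn_def by (rule formal_sum_cong) (simp add: assms)

text \<open>
  For given basis elements the number of contributing modes \<open>h(j)\<close> is bounded in terms of the degree,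
  and the degree is the order in the sewing parameters. Hence the double sum over bases and modes converges, and
  the sum over the bases may be taken first.
\<close>

lemma sewn_creation_mode:
  assumes sorted: "sorted_wrt (<) ys" and ys: "set ys \<subseteq> V" "\<And>y. y \<in> set ys \<Longrightarrow> var_class y < 4 \<and> y \<noteq> A0"
    and y: "y \<in> set ys" and charge: "sum_list (map q ys) = 0"
    and s: "\<And>b t j. b \<in> basis_choices \<Longrightarrow> t \<in> set ys \<Longrightarrow> j \<ge> total_degree g b + 2 \<Longrightarrow> heis (q t) (int j) (s b t) = 0"
  shows "sewn ys (\<lambda>b. act q y (- int (Suc p)) (s b)) =
      (\<Sum>y'\<in>set ys. formal_sum (\<lambda>j. probe p y y' j * sewn ys (\<lambda>b. act q y' (int j) (s b))) UNIV)"
    and "y' \<in> set ys \<Longrightarrow> rho_summable g V (\<lambda>j. probe p y y' j * sewn ys (\<lambda>b. act q y' (int j) (s b))) UNIV"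
proof -
  let ?c = "\<lambda>y' j b. correlator \<Y> q ys (act q y' (int j) (s b)) * weight g b"
  let ?f = "\<lambda>y' b j. probe p y y' j * ?c y' j b"
  have cls: "\<And>y. y \<in> set ys \<Longrightarrow> var_class y < 4" using ys(2) by blast
  have probe: "rho_order g V 0 (probe p y y' j)" if "y' \<in> set ys" for y' j
    using that y ys(1) ys(2)[OF that] ys(2)[OF y] V_A0
    by (auto simp: probe_def intro!: rho_order_f0_deriv rho_order_pi1_deriv)
  have zero: "?c y' j b = 0" if "y' \<in> set ys" "b \<in> basis_choices" "j \<ge> total_degree g b + 2" for y' j b
    using correlator_eq_0[OF Y sorted that(1)] s[OF that(2,1,3)] by (simp add: act_def)
  have fo: "rho_order g V (of_nat (total_degree g b)) (?f y' b j)" if "y' \<in> set ys" for y' b j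
    by (rule rho_order_multI[OF probe[OF that] rho_order_sewn_term[OF sorted ys(1) cls]]) auto
  have summable: "rho_summable g V (case_prod (?f y')) (basis_choices \<times> UNIV)" if "y' \<in> set ys" for y'
    unfolding rho_summable_def
  proof (intro conjI allI ballI V(1))
    fix N :: nat
    have "{k \<in> basis_choices \<times> UNIV. \<not> rho_order g V (of_nat N) (case_prod (?f y') k)} \<subseteq>
        {b \<in> basis_choices. total_degree g b \<le> N} \<times> {..<N + 2}"
    proof (rule subsetI)
      fix k assume k: "k \<in> {k \<in> basis_choices \<times> UNIV. \<not> rho_order g V (of_nat N) (case_prod (?f y') k)}"
      obtain b j where kbj: "k = (b, j)" by (cases k)
      have *: "b \<in> basis_choices" "\<not> rho_order g V (of_nat N) (case_prod (?f y') (b, j))"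
        using k by (simp_all add: kbj)
      have "total_degree g b < N"
      proof (rule ccontr)
        assume "\<not> total_degree g b < N"
        then show False using rho_order_le[OF fo[OF that], of "of_nat N" b j] *(2) by simp
      qed
      moreover have "j < total_degree g b + 2" using zero[OF that *(1), of j] *(2) by (cases "j < total_degree g b + 2") auto
      ultimately show "k \<in> {b \<in> basis_choices. total_degree g b \<le> N} \<times> {..<N + 2}"
        using *(1) by (simp add: kbj)
    qed
    then show "finite {k \<in> basis_choices \<times> UNIV. \<not> rho_order g V (of_nat N) (case_prod (?f y') k)}"
      by (rule finite_subset) (use finite_choices_degree in auto)
  next
    fix k assume "k \<in> basis_choices \<times> (UNIV :: nat set)"
    then show "rho_order g V 0 (case_prod (?f y') k)"
      using rho_order_le[OF fo[OF that]] by (cases k) auto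
  qed
  have per_choice: "correlator \<Y> q ys (act q y (- int (Suc p)) (s b)) * weight g b =
      (\<Sum>y'\<in>set ys. formal_sum (?f y' b) UNIV)" if b: "b \<in> basis_choices" for b
  proof -
    have "correlator \<Y> q ys (act q y (- int (Suc p)) (s b)) =
      (\<Sum>y'\<in>set ys. \<Sum>j<total_degree g b + 2. probe p y y' j * correlator \<Y> q ys (act q y' (int j) (s b)))"
      by (rule correlator_creation_mode_pi1[OF Y sorted y]) (use ys(2) charge s[OF b] in auto)
    then have "correlator \<Y> q ys (act q y (- int (Suc p)) (s b)) * weight g b =
        (\<Sum>y'\<in>set ys. \<Sum>j<total_degree g b + 2. ?f y' b j)"
      by (simp only: sum_distrib_right mult.assoc)
    also have "\<dots> = (\<Sum>y'\<in>set ys. formal_sum (?f y' b) UNIV)"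
    proof (rule sum.cong[OF refl], rule formal_sum_finite_support(1)[OF V(1), where g = g, symmetric])
      fix y' j assume "y' \<in> set ys" "j \<in> UNIV - {..<total_degree g b + 2}"
      then show "?f y' b j = 0" using zero[OF _ b, of y' j] by (simp only:) simp
    qed (use rho_order_le[OF fo] in auto)
    finally show ?thesis .
  qed
  have eq: "formal_sum (\<lambda>b. ?f y' b j) basis_choices = probe p y y' j * sewn ys (\<lambda>b. act q y' (int j) (s b))"
    if "y' \<in> set ys" for y' j
    unfolding sewn_def
    by (rule formal_sum_mult_left[OF rho_summable_sewn[OF sorted ys(1) cls] probe[OF that]])
  have "sewn ys (\<lambda>b. act q y (- int (Suc p)) (s b)) =
      formal_sum (\<lambda>b. \<Sum>y'\<in>set ys. formal_sum (?f y' b) UNIV) basis_choices"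
    unfolding sewn_def by (rule formal_sum_cong) (rule per_choice)
  also have "\<dots> = (\<Sum>y'\<in>set ys. formal_sum (\<lambda>b. formal_sum (?f y' b) UNIV) basis_choices)"
    using formal_sum_sum[OF _ V(1) rho_summable_formal_sum[OF summable], of "set ys" "\<lambda>y'. y'"] by simp
  also have "\<dots> = (\<Sum>y'\<in>set ys. formal_sum (\<lambda>j. formal_sum (\<lambda>b. ?f y' b j) basis_choices) UNIV)"
    by (rule sum.cong[OF refl], rule formal_sum_swap[OF summable])
  also have "\<dots> = (\<Sum>y'\<in>set ys. formal_sum (\<lambda>j. probe p y y' j * sewn ys (\<lambda>b. act q y' (int j) (s b))) UNIV)"
    by (rule sum.cong[OF refl], rule formal_sum_cong, rule eq)
  finally show "sewn ys (\<lambda>b. act q y (- int (Suc p)) (s b)) =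
      (\<Sum>y'\<in>set ys. formal_sum (\<lambda>j. probe p y y' j * sewn ys (\<lambda>b. act q y' (int j) (s b))) UNIV)" .
  show "rho_summable g V (\<lambda>j. probe p y y' j * sewn ys (\<lambda>b. act q y' (int j) (s b))) UNIV" if "y' \<in> set ys"
    using rho_summable_formal_sum[OF rho_summable_swap[OF summable[OF that]]] eq[OF that]
    by (simp cong: rho_summable_cong)
qed

text \<open>
  The correlation form without differentials and without the constant powers of the sewing
  parameters, with Heisenberg insertions labelled by \<open>xs\<close>; and the same with a mode \<open>h(j)\<close>
  acting on the state inserted at \<open>y\<close>.
\<close>

definition corr :: "nat list \<Rightarrow> var fseries" where
  "corr xs = sewn (points g m xs) (state B)"

definition corr_mode :: "nat list \<Rightarrow> var \<Rightarrow> int \<Rightarrow> var fseries" where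
  "corr_mode xs y j = sewn (points g m xs) (\<lambda>b. act q y j (state B b))"

lemma choice_basis:
  assumes "a \<in> handles g" "b \<in> basis_choices"
  shows "homogeneous_basis (B (nat \<bar>a\<bar>))" "b (nat \<bar>a\<bar>) \<in> B (nat \<bar>a\<bar>)" "nat \<bar>a\<bar> \<in> {1..g}"
proof -
  show a: "nat \<bar>a\<bar> \<in> {1..g}" using assms(1) by auto
  show "homogeneous_basis (B (nat \<bar>a\<bar>))" "b (nat \<bar>a\<bar>) \<in> B (nat \<bar>a\<bar>)" using basis[OF a] assms(2) a by auto
qed

lemma homogeneous_state:
  assumes "a \<in> handles g" "b \<in> basis_choices"
  shows "homogeneous (fdegree (b (nat \<bar>a\<bar>))) (state B b (W a))"
  using homogeneous_fdegree[OF choice_basis(1,2)[OF assms]] dual_vector(1)[OF choice_basis(1,2)[OF assms]]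
  by (cases "a > 0") (simp_all add: state_def)

lemma heis_state_eq_0:
  assumes "a \<in> handles g" "b \<in> basis_choices" "int (fdegree (b (nat \<bar>a\<bar>))) < n"
  shows "heis c n (state B b (W a)) = 0"
  by (rule heis_eq_0) (use homogeneous_state[OF assms(1,2)] assms(3) in \<open>auto simp: homogeneous_iff\<close>)

lemma fdegree_le_total: "a \<in> {1..g} \<Longrightarrow> fdegree (b a) \<le> total_degree g b"
  unfolding total_degree_def by (rule member_le_sum) auto

lemma heis_state_bound:
  assumes "b \<in> basis_choices" "y \<in> set (points g m xs)" "j \<ge> total_degree g b + 2"
  shows "heis (q y) (int j) (state B b y) = 0"
proof -
  consider i where "y = X i" | i where "y = Z i" | a where "y = W a" "a \<in> handles g"
    using assms(2) by (auto simp: set_points)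
  then show ?thesis
  proof cases
    case 1
    then show ?thesis using assms(3) by (simp add: charge_def state_def heis_h_state)
  next
    case 2
    have "heis (q y) (int j) 1 = 0" by (rule heis_eq_0) (use assms(3) in \<open>auto simp: lookup_one when_def split: if_splits\<close>)
    then show ?thesis using 2 by (simp add: state_def)
  next
    case 3
    show ?thesis unfolding 3(1)
      by (rule heis_state_eq_0[OF 3(2) assms(1)])
         (use fdegree_le_total[OF choice_basis(3)[OF 3(2) assms(1)], of b] assms(3) in simp)
  qed
qed

lemma points_V:
  assumes "X ` set xs \<subseteq> V" "Z ` {1..m} \<subseteq> V" shows "set (points g m xs) \<subseteq> V"
  unfolding set_points
proof (intro Un_least assms)
  show "W ` handles g \<subseteq> V" by (rule image_subsetI) (rule V_W)
qed

context
  fixes xs :: "nat list"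
  assumes xs: "sorted_wrt (<) xs" and XV: "X ` set xs \<subseteq> V" and ZV: "Z ` {1..m} \<subseteq> V"
begin

lemmas points_props = sorted_points[OF xs, of g m] points_V[OF XV ZV]

lemma rho_order_corr_mode: "rho_order g V 0 (corr_mode xs y j)"
  unfolding corr_mode_def sewn_def
  by (rule rho_order_formal_sum_0, rule rho_summable_sewn[OF points_props]) (use var_class_points in blast)

lemma rho_order_corr: "rho_order g V 0 (corr xs)"
  unfolding corr_def sewn_def
  by (rule rho_order_formal_sum_0, rule rho_summable_sewn[OF points_props]) (use var_class_points in blast)

lemma rho_order_corr_mode_W:
  assumes a: "a \<in> handles g" shows "rho_order g V (of_nat (Suc n)) (corr_mode xs (W a) (int (Suc n)))"
  unfolding corr_mode_def sewn_def
proof (rule rho_order_formal_sum[OF rho_summable_sewn[OF points_props]])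
  show "var_class y < 4" if "y \<in> set (points g m xs)" for y using var_class_points that by blast
  fix b assume b: "b \<in> basis_choices"
  let ?t = "correlator \<Y> q (points g m xs) (act q (W a) (int (Suc n)) (state B b)) * weight g b"
  show "rho_order g V (of_nat (Suc n)) ?t"
  proof (cases "Suc n \<le> fdegree (b (nat \<bar>a\<bar>))")
    case True
    then have "Suc n \<le> total_degree g b" using fdegree_le_total[OF choice_basis(3)[OF a b], of b] by simp
    moreover have "rho_order g V (of_nat (total_degree g b)) ?t"
      by (rule rho_order_sewn_term[OF points_props]) (use var_class_points in blast)
    ultimately show ?thesis using rho_order_le by (meson of_nat_mono)
  next
    case False
    then have "act q (W a) (int (Suc n)) (state B b) (W a) = 0"
      using heis_state_eq_0[OF a b, of "int (Suc n)"] by (simp add: act_def)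
    then have "?t = 0" using correlator_eq_0[OF Y points_props(1), of "W a"] a by (simp add: set_points)
    then show ?thesis by simp
  qed
qed

lemma corr_mode_0:
  assumes "y \<in> set (points g m xs)" shows "corr_mode xs y 0 = fconst (q y) * corr xs"
proof -
  have "corr_mode xs y 0 = formal_sum (\<lambda>b. fconst (q y) * (correlator \<Y> q (points g m xs) (state B b) * weight g b)) basis_choices"
    unfolding corr_mode_def sewn_def
    by (rule formal_sum_cong) (simp add: correlator_act_0[OF Y points_props(1) assms] mult.assoc)
  also have "\<dots> = fconst (q y) * corr xs"
    unfolding corr_def sewn_def
    by (rule formal_sum_mult_left[OF rho_summable_sewn[OF points_props]]) (use var_class_points in auto)
  finally show ?thesis .
qed

lemma corr_mode_eq_0:
  assumes "y \<in> set (points g m xs)" "\<And>b. b \<in> basis_choices \<Longrightarrow> heis (q y) j (state B b y) = 0"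
  shows "corr_mode xs y j = 0"
proof -
  have "corr_mode xs y j = formal_sum (\<lambda>b. 0) basis_choices"
    unfolding corr_mode_def sewn_def
    by (rule formal_sum_cong)
       (use correlator_eq_0[OF Y points_props(1) assms(1)] assms(2) in \<open>simp add: act_def\<close>)
  then show ?thesis by (simp add: formal_sum_0)
qed

lemma corr_mode_Z: "i \<in> {1..m} \<Longrightarrow> j > 0 \<Longrightarrow> corr_mode xs (Z i) (int j) = 0"
  by (rule corr_mode_eq_0, simp add: set_points, rule heis_eq_0) (auto simp: state_def lookup_one when_def split: if_splits)

lemma corr_mode_X: "i \<in> set xs \<Longrightarrow> j \<noteq> 1 \<Longrightarrow> corr_mode xs (X i) (int j) = 0"
  by (rule corr_mode_eq_0) (auto simp: set_points state_def charge_def heis_h_state)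

lemma corr_mode_X_1:
  assumes "i \<in> set xs" shows "corr_mode xs (X i) 1 = corr (remove1 i xs)"
  unfolding corr_mode_def corr_def
proof (rule sewn_cong)
  fix b
  obtain L R where xs_split: "xs = L @ i # R" using assms by (meson split_list)
  have "distinct xs" using xs strict_sorted_iff by blast
  then have rem: "remove1 i xs = L @ R" by (auto simp: xs_split remove1_append)
  let ?L = "map X L" and ?R = "map X R @ map Z [1..<m + 1] @ concat (map (\<lambda>a. [W (int a), W (- int a)]) [1..<g + 1])"
  have pts: "points g m xs = ?L @ X i # ?R" "points g m (remove1 i xs) = ?L @ ?R"
    by (simp_all add: points_def rem) (simp add: xs_split)
  let ?s = "act q (X i) 1 (state B b)"
  have "correlator \<Y> q (?L @ X i # ?R) ?s = correlator \<Y> q (?L @ ?R) ?s"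
    by (rule correlator_vacuum[OF Y])
       (use points_props(1) heis_h_state[of 1] in \<open>simp_all add: pts act_def charge_def state_def\<close>)
  also have "\<dots> = correlator \<Y> q (?L @ ?R) (state B b)"
  proof (rule correlator_cong)
    fix y assume "y \<in> set (?L @ ?R)"
    moreover have "X i \<notin> set (?L @ ?R)"
      using sorted_wrt_less_distinct[OF points_props(1)] by (auto simp: pts)
    ultimately show "?s y = state B b y" by (auto simp: act_def)
  qed
  finally show "correlator \<Y> q (points g m xs) ?s = correlator \<Y> q (points g m (remove1 i xs)) (state B b)"
    by (simp add: pts)
qed

end

end

section \<open>The linear system of the handles\<close>

lemma sum_PiE_split:
  fixes F :: "(nat \<Rightarrow> 'a) \<Rightarrow> 'b::comm_monoid_add"
  assumes "a \<in> A"
  shows "(\<Sum>b\<in>PiE A T. F b) = (\<Sum>b\<in>PiE (A - {a}) T. \<Sum>x\<in>T a. F (b(a := x)))"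
proof -
  have inj: "inj_on (\<lambda>(x, b). b(a := x)) (T a \<times> PiE (A - {a}) T)"
    using inj_combinator[of a "A - {a}" T] by simp
  have "PiE A T = (\<lambda>(x, b). b(a := x)) ` (T a \<times> PiE (A - {a}) T)"
    using PiE_insert_eq[of a "A - {a}" T] assms by (simp add: insert_absorb)
  then have "(\<Sum>b\<in>PiE A T. F b) = (\<Sum>(x, b)\<in>T a \<times> PiE (A - {a}) T. F (b(a := x)))"
    by (simp only:) (subst sum.reindex[OF inj], simp add: case_prod_unfold o_def)
  also have "\<dots> = (\<Sum>x\<in>T a. \<Sum>b\<in>PiE (A - {a}) T. F (b(a := x)))"
    by (rule sum.cartesian_product[symmetric])
  also have "\<dots> = (\<Sum>b\<in>PiE (A - {a}) T. \<Sum>x\<in>T a. F (b(a := x)))"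
    by (rule sum.swap)
  finally show ?thesis .
qed

lemma sum_degree_shift:
  fixes \<phi> \<psi> :: "fock \<Rightarrow> var fseries"
  assumes basis: "homogeneous_basis B"
    and shift: "\<And>d. (\<Sum>x | x \<in> B \<and> fdegree x = d + k. \<phi> x) = - (\<Sum>x | x \<in> B \<and> fdegree x = d. \<psi> x)"
    and zero: "\<And>x. x \<in> B \<Longrightarrow> fdegree x < k \<Longrightarrow> \<phi> x = 0"
  shows "(\<Sum>x | x \<in> B \<and> fdegree x \<le> N + k. \<phi> x * vpow r (of_nat (fdegree x))) =
    - (vpow r (of_nat k) * (\<Sum>x | x \<in> B \<and> fdegree x \<le> N. \<psi> x * vpow r (of_nat (fdegree x))))"
proof -
  have group: "(\<Sum>x | x \<in> B \<and> fdegree x \<le> M. h x * vpow r (of_nat (fdegree x))) =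
      (\<Sum>d\<le>M. (\<Sum>x | x \<in> B \<and> fdegree x = d. h x) * vpow r (of_nat d))" for M and h :: "fock \<Rightarrow> var fseries"
  proof -
    let ?S = "{x. x \<in> B \<and> fdegree x \<le> M}"
    have "(\<Sum>x\<in>?S. h x * vpow r (of_nat (fdegree x))) =
        (\<Sum>d\<le>M. \<Sum>x | x \<in> ?S \<and> fdegree x = d. h x * vpow r (of_nat (fdegree x)))"
      by (rule sum.group[symmetric]) (use finite_basis_degree_le[OF basis] in auto)
    also have "\<dots> = (\<Sum>d\<le>M. (\<Sum>x | x \<in> B \<and> fdegree x = d. h x) * vpow r (of_nat d))"
      unfolding sum_distrib_right by (intro sum.cong refl) auto
    finally show ?thesis .
  qed
  have 0: "(\<Sum>x | x \<in> B \<and> fdegree x = d. \<phi> x) = 0" if "d < k" for d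
    by (rule sum.neutral) (use zero that in auto)
  have "(\<Sum>d\<le>N + k. (\<Sum>x | x \<in> B \<and> fdegree x = d. \<phi> x) * vpow r (of_nat d)) =
      (\<Sum>d\<in>(\<lambda>d. d + k) ` {..N}. (\<Sum>x | x \<in> B \<and> fdegree x = d. \<phi> x) * vpow r (of_nat d))"
  proof (rule sum.mono_neutral_right)
    show "\<forall>d\<in>{..N + k} - (\<lambda>d. d + k) ` {..N}. (\<Sum>x | x \<in> B \<and> fdegree x = d. \<phi> x) * vpow r (of_nat d) = 0"
    proof
      fix d assume d: "d \<in> {..N + k} - (\<lambda>d. d + k) ` {..N}"
      have "d < k"
      proof (rule ccontr)
        assume "\<not> d < k"
        then have "d = (d - k) + k" "d - k \<in> {..N}" using d by auto
        then show False using d by blast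
      qed
      then show "(\<Sum>x | x \<in> B \<and> fdegree x = d. \<phi> x) * vpow r (of_nat d) = 0" by (simp add: 0)
    qed
  qed auto
  also have "\<dots> = (\<Sum>d\<le>N. - (\<Sum>x | x \<in> B \<and> fdegree x = d. \<psi> x) * vpow r (of_nat (d + k)))"
    by (subst sum.reindex) (auto simp: shift o_def inj_on_def)
  also have "\<dots> = - (vpow r (of_nat k) * (\<Sum>d\<le>N. (\<Sum>x | x \<in> B \<and> fdegree x = d. \<psi> x) * vpow r (of_nat d)))"
    unfolding sum_distrib_left sum_negf[symmetric]
    by (rule sum.cong) (auto simp: vpow_add sum_negf ac_simps)
  finally show ?thesis unfolding group .
qed

lemma pd_formal_sum:
  assumes F: "rho_summable g V F I" and v: "v \<in> V" "var_class v < 4"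
  shows "pd v (formal_sum F I) = formal_sum (\<lambda>i. pd v (F i)) I"
proof (rule eq_if_rho_order_diff[of g V])
  fix N :: nat
  let ?P = "{i\<in>I. \<not> rho_order g V (of_nat N) (F i)}"
  have P: "finite ?P" using F by (simp add: rho_summable_def)
  have "{i\<in>I. \<not> rho_order g V (of_nat M) (pd v (F i))} \<subseteq> {i\<in>I. \<not> rho_order g V (of_nat M) (F i)}" for M :: nat
    using rho_order_pd[OF _ v] by auto
  then have s: "rho_summable g V (\<lambda>i. pd v (F i)) I"
    using F rho_order_pd[OF _ v] unfolding rho_summable_def by (meson finite_subset)
  have "rho_order g V (of_nat N) (pd v (formal_sum F I - sum F ?P))"
    by (rule rho_order_pd[OF formal_sum_truncate[OF F P] v]) auto
  moreover have "rho_order g V (of_nat N) (formal_sum (\<lambda>i. pd v (F i)) I - (\<Sum>i\<in>?P. pd v (F i)))"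
    by (rule formal_sum_truncate[OF s P]) (auto intro: rho_order_pd[OF _ v])
  ultimately have "rho_order g V (of_nat N) (pd v (formal_sum F I - sum F ?P) -
      (formal_sum (\<lambda>i. pd v (F i)) I - (\<Sum>i\<in>?P. pd v (F i))))" by (rule rho_order_diff)
  then show "rho_order g V (of_nat N) (pd v (formal_sum F I) - formal_sum (\<lambda>i. pd v (F i)) I)"
    by (simp add: pd_minus pd_sum)
qed

lemma pi1_deriv_pd:
  assumes "\<And>e. fcoeff f e \<noteq> 0 \<Longrightarrow> lookup e y = 0"
  shows "pd y (f * pi1_deriv m 0 x y) = f * pi1_deriv m 1 x y"
proof -
  have "pd y (pi1_deriv m 0 x y) = pi1_deriv m 1 x y"
    unfolding pi1_deriv_def
    by (subst pd_mult_left) (simp_all add: fcoeff_fconst pd_funpow_commute split: if_splits)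
  then show ?thesis by (simp add: pd_mult_left[OF assms])
qed

lemma L_tilde_eq: "b \<in> handles g \<Longrightarrow> L_tilde g i (b, n) = L_row i (b, Suc n)"
  unfolding L_tilde_def row_mult_def
  by (subst formal_sum_single[of "(b, Suc n)"]) (auto simp: indices_handles Delta_mat_def split: if_splits)

lemma A_tilde_eq: "b \<in> handles g \<Longrightarrow> A_tilde g k (b, n) = A_mat k (b, Suc n)"
  unfolding A_tilde_def mat_mult_def
  by (subst formal_sum_single[of "(b, Suc n)"]) (auto simp: indices_handles Delta_mat_def split: if_splits)

lemma rho_order_rho_pow:
  assumes "surface_vars g \<subseteq> V" "a \<in> handles g"
  shows "rho_order g V (of_nat n / 2) (rho_pow a (of_nat n / 2))"
proof -
  have a: "nat \<bar>a\<bar> \<in> {1..g}" using assms(2) by auto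
  then have "Rho (nat \<bar>a\<bar>) \<in> surface_vars g"
    unfolding surface_vars_def by (intro insertI2 UnI2 imageI)
  then have "Rho (nat \<bar>a\<bar>) \<in> V" using assms(1) by (rule subsetD[rotated])
  then show ?thesis unfolding rho_pow_def by (rule rho_order_vpow_Rho[OF a]) simp
qed

text \<open>
  The coefficient with which the mode \<open>h(j)\<close> at \<open>y\<close> enters the equation for the mode \<open>p + 1\<close> at the
  end \<open>a\<close> of a handle.
\<close>

definition handle_column :: "int \<times> nat \<Rightarrow> var \<Rightarrow> nat \<Rightarrow> var fseries" where
  "handle_column = (\<lambda>(a, p) y j. - (rho_pow a ((of_nat p + 1) / 2) * probe p (W (- a)) y j))"

definition geometric_row :: "nat \<Rightarrow> nat \<Rightarrow> fvector" where
  "geometric_row g x = row_mult g (L_tilde g x) (mat_geometric g (A_tilde g))"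

context
  fixes g :: nat and V :: "var set" and x :: nat
  assumes V: "finite V" "surface_vars g \<subseteq> V" and xV: "X x \<in> V" "DX x \<in> V"
begin

lemma rho_order_L_tilde:
  assumes "k \<in> indices g" shows "rho_order g V (index_order k) (L_tilde g x k)"
proof -
  obtain b n where k: "k = (b, n)" "b \<in> handles g" using assms by (auto simp: indices_handles)
  have "rho_order g V (of_nat (Suc n) / 2 + 0 + 0)
      (rho_pow b (of_nat (Suc n) / 2) * pi1_deriv 0 (Suc n) (X x) (W b) * vpow (DX x) 1)"
    by (intro rho_order_mult rho_order_rho_pow rho_order_pi1_deriv rho_order_vpow_DX)
       (use V xV k(2) in \<open>auto simp: surface_vars_def\<close>)
  then show ?thesis by (simp add: k(1) L_tilde_eq[OF k(2)] L_row_def index_order_def add.commute)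
qed

lemma rho_order_A_tilde:
  assumes "k \<in> indices g" "l \<in> indices g"
  shows "rho_order g V (index_order k + index_order l) (A_tilde g k l)"
proof -
  obtain a m where k: "k = (a, m)" "a \<in> handles g" using assms by (auto simp: indices_handles)
  obtain b n where l: "l = (b, n)" "b \<in> handles g" using assms by (auto simp: indices_handles)
  have a: "- a \<in> handles g" using k(2) by simp
  show ?thesis
  proof (cases "a = - b")
    case False
    have "rho_order g V (of_nat (Suc m) / 2 + of_nat (Suc n) / 2 + 0)
      (rho_pow a (of_nat (Suc m) / 2) * rho_pow b (of_nat (Suc n) / 2) * pi1_deriv m (Suc n) (W (- a)) (W b))"
      by (intro rho_order_mult rho_order_rho_pow rho_order_pi1_deriv)
         (use V k(2) l(2) a False in \<open>auto simp: surface_vars_def\<close>)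
    then show ?thesis using False
      by (simp add: k(1) l(1) A_tilde_eq[OF l(2)] A_mat_def index_order_def add.commute)
  qed (simp add: k(1) l(1) A_tilde_eq[OF l(2)] A_mat_def)
qed

lemma rho_order_geometric_row:
  assumes "k \<in> indices g" shows "rho_order g V 0 (geometric_row g x k)"
  unfolding geometric_row_def
  by (rule rho_order_row_mult_geometric(2)[OF V(1) rho_order_A_tilde rho_order_L_tilde assms])

end

context heisenberg_sewing
begin

context
  fixes xs :: "nat list"
  assumes xs: "sorted_wrt (<) xs" and XV: "X ` set xs \<subseteq> V" and ZV: "Z ` {1..m} \<subseteq> V"
begin

text \<open>
  The modes at the two ends of a handle are exchanged by \<open>\<Sum>\<^sub>b h(j)b \<otimes> b' = - \<Sum>\<^sub>b b \<otimes> h(-j)b'\<close>;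
  the shift of the degree produces the power of the sewing parameter.
\<close>

lemma corr_mode_duality:
  assumes c: "c \<in> handles g"
  shows "corr_mode xs (W c) (int (Suc n)) =
    - (rho_pow c (of_nat (Suc n)) * corr_mode xs (W (- c)) (- int (Suc n)))"
proof (rule eq_if_rho_order_diff[of g V])
  fix N :: nat
  define a where "a = nat \<bar>c\<bar>"
  have a: "a \<in> {1..g}" using c by (auto simp: a_def)
  have Ba: "homogeneous_basis (B a)" by (rule basis[OF a])
  let ?ys = "points g m xs" and ?r = "rho_pow c (of_nat (Suc n))"
  note pts = points_props[OF xs XV ZV]
  define F where "F b = correlator \<Y> q ?ys (act q (W c) (int (Suc n)) (state B b)) * weight g b" for b
  define F' where "F' b = correlator \<Y> q ?ys (act q (W (- c)) (- int (Suc n)) (state B b)) * weight g b" for b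
  \<comment> \<open>\<open>h(n + 1)\<close> lowers the degree by \<open>n + 1\<close>, so on the left-hand side the basis at the handle \<open>a\<close> is cut
    off at a degree higher by \<open>n + 1\<close>\<close>
  define T where "T M a' = {x \<in> B a'. fdegree x \<le> (if a' = a then M else N)}" for M a'
  have fin: "finite (PiE {1..g} (T M))" for M
    by (rule finite_PiE) (use finite_basis_degree_le basis in \<open>auto simp: T_def\<close>)
  have trunc: "rho_order g V (of_nat N) (formal_sum H basis_choices - sum H (PiE {1..g} (T M)))"
    if "M \<ge> N" and H: "\<And>b. H b = correlator \<Y> q ?ys (s b) * weight g b" for M H s
    unfolding H
  proof (rule formal_sum_truncate[OF rho_summable_sewn[OF pts] fin])
    show "PiE {1..g} (T M) \<subseteq> basis_choices" by (rule PiE_mono) (auto simp: T_def)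
    fix b assume "b \<in> basis_choices - PiE {1..g} (T M)"
    then obtain a' where a': "a' \<in> {1..g}" "b a' \<in> B a'" "b a' \<notin> T M a'" by (auto simp: PiE_iff)
    then have "N \<le> total_degree g b"
      using fdegree_le_total[OF a'(1), of b] \<open>M \<ge> N\<close> by (auto simp: T_def split: if_splits)
    then show "rho_order g V (of_nat N) (correlator \<Y> q ?ys (s b) * weight g b)"
      using rho_order_le[OF rho_order_sewn_term[OF pts], of "of_nat N" b "s b"] var_class_points by auto
  qed (use var_class_points in auto)
  have sum_eq: "sum F (PiE {1..g} (T (N + Suc n))) = - (?r * sum F' (PiE {1..g} (T N)))"
  proof -
    have same: "PiE ({1..g} - {a}) (T (N + Suc n)) = PiE ({1..g} - {a}) (T N)"
      by (rule PiE_cong) (auto simp: T_def)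
    have "(\<Sum>x\<in>T (N + Suc n) a. F (b(a := x))) = - (?r * (\<Sum>x\<in>T N a. F' (b(a := x))))" for b
    proof -
      let ?st = "\<lambda>u v. (state B b)(W (int a) := u, W (- int a) := v)"
      let ?d = "dual_vector (B a)"
      define \<Phi> where "\<Phi> u v = correlator \<Y> q ?ys (?st u v)" for u v
      have ne: "W (int a) \<noteq> W (- int a)" using a by auto
      have inpts: "W (int a) \<in> set ?ys" "W (- int a) \<in> set ?ys" using a by (auto simp: set_points)
      have st: "state B (b(a := x)) = ?st x (?d x)" for x
        using a by (intro ext) (auto simp: state_def split: var.splits)
      have wt: "weight g (b(a := x)) = vpow (Rho a) (of_nat (fdegree x)) *
          (\<Prod>a'\<in>{1..g} - {a}. vpow (Rho a') (of_nat (fdegree (b a'))))" for x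
        unfolding weight_def using a by (subst prod.remove[OF _ a]) (auto intro!: prod.cong)
      have q: "q (W (int a)) = \<alpha> a" "q (W (- int a)) = - \<alpha> a" using a by (auto simp: charge_def)
      have act: "act q (W (int a)) j (?st u v) = ?st (heis (\<alpha> a) j u) v"
        "act q (W (- int a)) j (?st u v) = ?st u (heis (- \<alpha> a) j v)" for j u v
        using ne q by (auto simp: act_def fun_eq_iff)
      have add1: "\<Phi> (u + v) w = \<Phi> u w + \<Phi> v w" and scale1: "\<Phi> (fscale k u) w = fconst k * \<Phi> u w" for k u v w
        unfolding \<Phi>_def fun_upd_twist[OF ne]
        by (rule correlator_update_add[OF Y pts(1) inpts(1)], rule correlator_update_scale[OF Y pts(1) inpts(1)])
      have add2: "\<Phi> u (v + w) = \<Phi> u v + \<Phi> u w" and scale2: "\<Phi> u (fscale k v) = fconst k * \<Phi> u v" for k u v w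
        unfolding \<Phi>_def
        by (rule correlator_update_add[OF Y pts(1) inpts(2)], rule correlator_update_scale[OF Y pts(1) inpts(2)])
      note move = sum_basis_heis[OF Ba, of \<Phi>, OF add1 add2 scale1 scale2]
      have zero: "\<Phi> 0 w = 0" "\<Phi> w 0 = 0" for w using scale1[of 0 0 w] scale2[of w 0 0] by (simp_all add: fock.scale_zero_left)
      define \<phi> where "\<phi> x = (if c > 0 then \<Phi> (heis (\<alpha> a) (int (Suc n)) x) (?d x)
          else \<Phi> x (heis (- \<alpha> a) (int (Suc n)) (?d x)))" for x
      define \<psi> where "\<psi> x = (if c > 0 then \<Phi> x (heis (- \<alpha> a) (- int (Suc n)) (?d x))
          else \<Phi> (heis (\<alpha> a) (- int (Suc n)) x) (?d x))" for x
      have ca: "c = int a \<and> c > 0 \<or> c = - int a \<and> \<not> c > 0" using c by (auto simp: a_def)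
      have F: "F (b(a := x)) = \<phi> x * vpow (Rho a) (of_nat (fdegree x)) *
          (\<Prod>a'\<in>{1..g} - {a}. vpow (Rho a') (of_nat (fdegree (b a'))))" for x
        using ca unfolding F_def st wt by (auto simp: act \<phi>_def \<Phi>_def mult.assoc)
      have F': "F' (b(a := x)) = \<psi> x * vpow (Rho a) (of_nat (fdegree x)) *
          (\<Prod>a'\<in>{1..g} - {a}. vpow (Rho a') (of_nat (fdegree (b a'))))" for x
        using ca unfolding F'_def st wt by (auto simp: act \<psi>_def \<Phi>_def mult.assoc)
      have r: "?r = vpow (Rho a) (of_nat (Suc n))" by (simp add: rho_pow_def a_def)
      have "(\<Sum>x | x \<in> B a \<and> fdegree x \<le> N + Suc n. \<phi> x * vpow (Rho a) (of_nat (fdegree x))) =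
        - (vpow (Rho a) (of_nat (Suc n)) * (\<Sum>x | x \<in> B a \<and> fdegree x \<le> N. \<psi> x * vpow (Rho a) (of_nat (fdegree x))))"
      proof (rule sum_degree_shift[OF Ba])
        show "(\<Sum>x | x \<in> B a \<and> fdegree x = d + Suc n. \<phi> x) = - (\<Sum>x | x \<in> B a \<and> fdegree x = d. \<psi> x)" for d
        proof (cases "c > 0")
          case True
          then show ?thesis using move[of "int (Suc n)" "d + Suc n" d "\<alpha> a"] by (simp add: \<phi>_def \<psi>_def)
        next
          case False
          then show ?thesis using move[of "- int (Suc n)" d "d + Suc n" "\<alpha> a"]
            by (simp add: \<phi>_def \<psi>_def add.commute[of _ 1])
        qed
        show "\<phi> x = 0" if x: "x \<in> B a" "fdegree x < Suc n" for x
        proof -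
          have "heis (\<alpha> a) (int (Suc n)) x = 0" "heis (- \<alpha> a) (int (Suc n)) (?d x) = 0"
            using homogeneous_fdegree[OF Ba x(1)] dual_vector(1)[OF Ba x(1)] x(2)
            by (auto intro!: heis_eq_0 simp: homogeneous_iff)
          then show ?thesis by (simp only: \<phi>_def zero if_cancel)
        qed
      qed
      moreover have "T M a = {x. x \<in> B a \<and> fdegree x \<le> M}" for M by (simp add: T_def)
      ultimately show ?thesis unfolding F F' r sum_distrib_right[symmetric] by (simp add: mult.assoc)
    qed
    then show ?thesis unfolding sum_PiE_split[OF a, of F] sum_PiE_split[OF a, of F'] same
      by (simp add: sum_distrib_left sum_negf)
  qed
  have "rho_order g V (of_nat N) (formal_sum F basis_choices - sum F (PiE {1..g} (T (N + Suc n))))"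
    by (rule trunc) (auto simp: F_def)
  moreover have "rho_order g V (of_nat N) (?r * (formal_sum F' basis_choices - sum F' (PiE {1..g} (T N))))"
  proof (rule rho_order_multI)
    have "of_nat (2 * Suc n) / 2 = (of_nat (Suc n) :: complex)" by (simp add: add_divide_distrib)
    then show "rho_order g V (of_nat (2 * Suc n) / 2) ?r"
      using rho_order_rho_pow[OF V(2) c, of "2 * Suc n"] by (simp only:)
    show "rho_order g V (of_nat N) (formal_sum F' basis_choices - sum F' (PiE {1..g} (T N)))"
      by (rule trunc) (auto simp: F'_def)
  qed simp
  ultimately have "rho_order g V (of_nat N) ((formal_sum F basis_choices - sum F (PiE {1..g} (T (N + Suc n)))) +
      ?r * (formal_sum F' basis_choices - sum F' (PiE {1..g} (T N))))" by (rule rho_order_add)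
  moreover have "corr_mode xs (W c) (int (Suc n)) = formal_sum F basis_choices"
    "corr_mode xs (W (- c)) (- int (Suc n)) = formal_sum F' basis_choices"
    by (simp_all only: corr_mode_def sewn_def F_def[abs_def] F'_def[abs_def])
  ultimately show "rho_order g V (of_nat N) (corr_mode xs (W c) (int (Suc n)) -
      - (?r * corr_mode xs (W (- c)) (- int (Suc n))))"
    by (simp only: sum_eq) (simp add: algebra_simps)
qed

text \<open>The unknowns of the linear system, normalised as the matrix \<open>A\<close> requires.\<close>

definition handle_mode :: fvector where
  "handle_mode = (\<lambda>(a, p). - (rho_pow a ((of_nat p + 1) / 2) * corr_mode xs (W (- a)) (- int (Suc p))))"

lemma corr_mode_handle:
  assumes "c \<in> handles g"
  shows "corr_mode xs (W c) (int (Suc n)) = rho_pow c ((of_nat n + 1) / 2) * handle_mode (c, n)"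
proof -
  have "(of_nat n + 1) / 2 + (of_nat n + 1) / 2 = (of_nat (Suc n) :: complex)" by (simp add: field_simps)
  then have "rho_pow c (of_nat (Suc n)) = rho_pow c ((of_nat n + 1) / 2) * rho_pow c ((of_nat n + 1) / 2)"
    unfolding rho_pow_def by (metis vpow_add)
  then show ?thesis unfolding corr_mode_duality[OF assms] by (simp add: handle_mode_def mult.assoc)
qed

lemma rho_order_handle_mode:
  assumes "k \<in> indices g" shows "rho_order g V 0 (handle_mode k)"
proof -
  obtain a p where k: "k = (a, p)" "a \<in> handles g" using assms by (auto simp: indices_handles)
  have "rho_order g V 0 (rho_pow a (of_nat (Suc p) / 2) * corr_mode xs (W (- a)) (- int (Suc p)))"
    by (rule rho_order_multI[OF rho_order_rho_pow[OF V(2) k(2)] rho_order_corr_mode[OF xs XV ZV]]) simp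
  then show ?thesis by (simp add: handle_mode_def k(1) add.commute)
qed

text \<open>The contributions of the insertions and of the charges of the handles.\<close>

definition source :: "(var \<Rightarrow> nat \<Rightarrow> var fseries) \<Rightarrow> var fseries" where
  "source p = (\<Sum>i\<in>set xs. p (X i) 1 * corr (remove1 i xs)) +
     (\<Sum>j=1..m. p (Z j) 0 * (fconst (\<gamma> j) * corr xs)) +
     (\<Sum>c\<in>handles g. p (W c) 0 * (fconst (q (W c)) * corr xs))"

lemma source_add: "source (\<lambda>y j. p y j + p' y j) = source p + source p'"
  by (simp add: source_def distrib_right sum.distrib)

lemma source_mult: "source (\<lambda>y j. c * p y j) = c * source p"
  by (simp add: source_def distrib_left sum_distrib_left mult.assoc)

lemma rho_order_corr_remove1: "rho_order g V 0 (corr (remove1 i xs))"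
proof (rule rho_order_corr[OF _ _ ZV])
  show "sorted_wrt (<) (remove1 i xs)"
    using xs by (simp add: strict_sorted_iff sorted_remove1)
  show "X ` set (remove1 i xs) \<subseteq> V" using XV set_remove1_subset[of i xs] by blast
qed

lemma rho_order_source:
  assumes "\<And>y j. y \<in> set (points g m xs) \<Longrightarrow> rho_order g V r (p y j)"
  shows "rho_order g V r (source p)"
proof -
  have c: "rho_order g V 0 (fconst k * corr xs)" for k
    by (rule rho_order_multI[OF rho_order_fconst rho_order_corr[OF xs XV ZV]]) auto
  show ?thesis unfolding source_def
    by (intro rho_order_add rho_order_sum rho_order_multI[OF assms rho_order_corr_remove1]
        rho_order_multI[OF assms c]) (auto simp: set_points)
qed

text \<open>
  From \<open>h(j)h = \<delta>\<^sub>j\<^sub>,\<^sub>1\<one>\<close> a Heisenberg insertion contributes by its removal, and from \<open>h(j)e\<^sup>\<gamma> = \<delta>\<^sub>j\<^sub>,\<^sub>0 \<gamma> e\<^sup>\<gamma>\<close>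
  the insertion of \<open>e\<^sup>\<gamma>\<close> contributes by its charge, as does \<open>h(0)\<close> at the handles. The modes \<open>h(n + 1)\<close> at
  the handles remain.
\<close>

lemma sum_modes:
  assumes p: "\<And>y j. y \<in> set (points g m xs) \<Longrightarrow> rho_order g V 0 (p y j)"
  shows "(\<Sum>y\<in>set (points g m xs). formal_sum (\<lambda>j. p y j * corr_mode xs y (int j)) UNIV) =
      source p + formal_sum (\<lambda>(c, n). p (W c) (Suc n) * corr_mode xs (W c) (int (Suc n))) (indices g)"
    and "rho_summable g V (\<lambda>(c, n). p (W c) (Suc n) * corr_mode xs (W c) (int (Suc n))) (indices g)"
proof -
  let ?F = "\<lambda>y j. p y j * corr_mode xs y (int j)"
  have mem: "X i \<in> set (points g m xs)" if "i \<in> set xs" for i using that by (simp add: set_points)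
  have memZ: "Z j \<in> set (points g m xs)" if "j \<in> {1..m}" for j using that by (simp add: set_points)
  have memW: "W c \<in> set (points g m xs)" if "c \<in> handles g" for c using that by (simp add: set_points)
  have oS: "rho_order g V (of_nat (Suc n)) (?F (W c) (Suc n))" if "c \<in> handles g" for c n
    by (rule rho_order_multI[OF p[OF memW[OF that]] rho_order_corr_mode_W[OF xs XV ZV that]]) simp
  have oW: "rho_order g V (of_nat j) (?F (W c) j)" if "c \<in> handles g" for c j
  proof (cases j)
    case 0
    then show ?thesis
      using rho_order_multI[OF p[OF memW[OF that]] rho_order_corr_mode[OF xs XV ZV], of 0] by simp
  qed (use oS[OF that] in simp)
  have sW: "rho_summable g V (?F (W c)) UNIV" if "c \<in> handles g" for c
    by (rule rho_summableI[OF V(1) oW[OF that]]) (use finite_real_less in auto)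
  have sWS: "rho_summable g V (\<lambda>k. case k of (c, n) \<Rightarrow> ?F (W c) (Suc n)) (handles g \<times> UNIV)"
    unfolding indices_handles[symmetric]
  proof (rule rho_summable_indices[OF V(1)])
    fix k assume "k \<in> indices g"
    then obtain c n where k: "k = (c, n)" "c \<in> handles g" by (auto simp: indices_handles)
    show "rho_order g V (index_order k) (case k of (c, n) \<Rightarrow> ?F (W c) (Suc n))"
      unfolding k(1) prod.case by (rule rho_order_le[OF oS[OF k(2)]]) (simp add: index_order_def)
  qed
  then show "rho_summable g V (\<lambda>(c, n). p (W c) (Suc n) * corr_mode xs (W c) (int (Suc n))) (indices g)"
    unfolding indices_handles .
  have "(\<Sum>y\<in>set (points g m xs). formal_sum (?F y) UNIV) =
      (\<Sum>i\<in>set xs. formal_sum (?F (X i)) UNIV) + (\<Sum>j=1..m. formal_sum (?F (Z j)) UNIV) +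
      (\<Sum>c\<in>handles g. formal_sum (?F (W c)) UNIV)"
    unfolding set_points
    by (subst sum.union_disjoint, simp, simp add: finite_handles, force)
       (subst sum.union_disjoint, simp, simp, force, simp add: sum.reindex inj_on_def)
  also have "(\<Sum>i\<in>set xs. formal_sum (?F (X i)) UNIV) = (\<Sum>i\<in>set xs. p (X i) 1 * corr (remove1 i xs))"
  proof (rule sum.cong[OF refl])
    fix i assume i: "i \<in> set xs"
    have "formal_sum (?F (X i)) UNIV = ?F (X i) 1"
      by (rule formal_sum_single) (auto simp: corr_mode_X[OF xs XV ZV i])
    then show "formal_sum (?F (X i)) UNIV = p (X i) 1 * corr (remove1 i xs)"
      by (simp add: corr_mode_X_1[OF xs XV ZV i])
  qed
  also have "(\<Sum>j=1..m. formal_sum (?F (Z j)) UNIV) = (\<Sum>j=1..m. p (Z j) 0 * (fconst (\<gamma> j) * corr xs))"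
  proof (rule sum.cong[OF refl])
    fix i assume i: "i \<in> {1..m}"
    have "formal_sum (?F (Z i)) UNIV = ?F (Z i) 0"
      by (rule formal_sum_single) (auto simp: corr_mode_Z[OF xs XV ZV i])
    also have "\<dots> = p (Z i) 0 * (fconst (\<gamma> i) * corr xs)"
      using corr_mode_0[OF xs XV ZV memZ[OF i]] by (simp add: charge_def)
    finally show "formal_sum (?F (Z i)) UNIV = p (Z i) 0 * (fconst (\<gamma> i) * corr xs)" .
  qed
  also have "(\<Sum>c\<in>handles g. formal_sum (?F (W c)) UNIV) =
      (\<Sum>c\<in>handles g. p (W c) 0 * (fconst (q (W c)) * corr xs)) +
      (\<Sum>c\<in>handles g. formal_sum (\<lambda>n. ?F (W c) (Suc n)) UNIV)"
    unfolding sum.distrib[symmetric]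
  proof (rule sum.cong[OF refl])
    fix c assume c: "c \<in> handles g"
    show "formal_sum (?F (W c)) UNIV = p (W c) 0 * (fconst (q (W c)) * corr xs) + formal_sum (\<lambda>n. ?F (W c) (Suc n)) UNIV"
      using formal_sum_Suc(1)[OF sW[OF c]] corr_mode_0[OF xs XV ZV memW[OF c]] by simp
  qed
  also have "(\<Sum>c\<in>handles g. formal_sum (\<lambda>n. ?F (W c) (Suc n)) UNIV) =
      formal_sum (\<lambda>c. formal_sum (\<lambda>n. ?F (W c) (Suc n)) UNIV) (handles g)"
    by (rule formal_sum_finite[OF V(1) finite_handles, symmetric],
        rule rho_order_formal_sum_0[OF formal_sum_Suc(2)[OF sW]])
  also have "\<dots> = formal_sum (\<lambda>(c, n). ?F (W c) (Suc n)) (handles g \<times> UNIV)"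
    by (rule formal_sum_Sigma) (use sWS in simp)
  finally show "(\<Sum>y\<in>set (points g m xs). formal_sum (\<lambda>j. p y j * corr_mode xs y (int j)) UNIV) =
      source p + formal_sum (\<lambda>(c, n). p (W c) (Suc n) * corr_mode xs (W c) (int (Suc n))) (indices g)"
    unfolding source_def indices_handles by (simp add: add.assoc)
qed

lemma rho_order_probe:
  assumes "y \<in> set (points g m xs)" "y' \<in> set (points g m xs)"
  shows "rho_order g V 0 (probe p y y' j)"
proof -
  have "y \<in> V" "y' \<in> V" using assms points_V[OF XV ZV] by auto
  then show ?thesis using var_class_points[OF assms(1)] var_class_points[OF assms(2)] V_A0
    by (auto simp: probe_def intro!: rho_order_f0_deriv rho_order_pi1_deriv)
qed

lemma rho_order_handle_column:
  assumes "k \<in> indices g" "y \<in> set (points g m xs)"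
  shows "rho_order g V (index_order k) (handle_column k y j)"
proof -
  obtain a p where k: "k = (a, p)" "a \<in> handles g" using assms by (auto simp: indices_handles)
  have "W (- a) \<in> set (points g m xs)" using k(2) by (simp add: set_points)
  then have "rho_order g V (of_nat (Suc p) / 2) (rho_pow a (of_nat (Suc p) / 2) * probe p (W (- a)) y j)"
    by (intro rho_order_multI[OF rho_order_rho_pow[OF V(2) k(2)] rho_order_probe] assms(2)) auto
  then show ?thesis by (simp add: handle_column_def k(1) index_order_def add.commute)
qed

text \<open>
  A mode at one end of a handle is a creation mode at the other end, which the kernels express
  through the modes at all points: this is a linear system for the modes at the handles.
\<close>

lemma handle_mode_system:
  assumes "k \<in> indices g"
  shows "handle_mode k = source (handle_column k) + formal_sum (\<lambda>l. A_tilde g k l * handle_mode l) (indices g)"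
proof -
  obtain a p where k: "k = (a, p)" "a \<in> handles g" using assms by (auto simp: indices_handles)
  let ?w = "W (- a)" and ?c = "- rho_pow a ((of_nat p + 1) / 2)"
  let ?F = "\<lambda>(c, n). probe p ?w (W c) (Suc n) * corr_mode xs (W c) (int (Suc n))"
  note pts = points_props[OF xs XV ZV]
  have w: "?w \<in> set (points g m xs)" using k(2) by (simp add: set_points)
  have c: "rho_order g V 0 ?c"
    using rho_order_le[OF rho_order_rho_pow[OF V(2) k(2), of "Suc p"], of 0] by (simp add: add.commute)
  note sums = sum_modes[of "probe p ?w", OF rho_order_probe[OF w]]
  have "corr_mode xs ?w (- int (Suc p)) =
      (\<Sum>y\<in>set (points g m xs). formal_sum (\<lambda>j. probe p ?w y j * corr_mode xs y (int j)) UNIV)"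
    unfolding corr_mode_def
    by (rule sewn_creation_mode(1)[OF pts var_class_points w _ heis_state_bound])
       (simp_all only: sum_list_charge_points charge_0)
  also have "\<dots> = source (probe p ?w) + formal_sum ?F (indices g)" by (rule sums(1))
  finally have "handle_mode k = ?c * source (probe p ?w) + ?c * formal_sum ?F (indices g)"
    by (simp add: handle_mode_def k(1) algebra_simps)
  also have "?c * source (probe p ?w) = source (handle_column k)"
    unfolding source_mult[symmetric] by (simp add: handle_column_def k(1))
  also have "?c * formal_sum ?F (indices g) = formal_sum (\<lambda>l. ?c * ?F l) (indices g)"
    by (rule formal_sum_mult_left[OF sums(2) c, symmetric])
  also have "\<dots> = formal_sum (\<lambda>l. A_tilde g k l * handle_mode l) (indices g)"
  proof (rule formal_sum_cong)
    fix l assume "l \<in> indices g"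
    then obtain b n where l: "l = (b, n)" "b \<in> handles g" by (auto simp: indices_handles)
    show "?c * ?F l = A_tilde g k l * handle_mode l"
      unfolding l(1) prod.case A_tilde_eq[OF l(2)] corr_mode_handle[OF l(2)] k(1)
      by (auto simp: A_mat_def probe_def ac_simps)
  qed
  finally show ?thesis .
qed

lemma source_dot:
  assumes r: "\<And>k. k \<in> indices g \<Longrightarrow> rho_order g V 0 (r k)"
    and c: "\<And>k y j. k \<in> indices g \<Longrightarrow> y \<in> set (points g m xs) \<Longrightarrow> rho_order g V (index_order k) (c k y j)"
  shows "dot g r (\<lambda>k. source (c k)) = source (\<lambda>y j. dot g r (\<lambda>k. c k y j))"
proof -
  let ?I = "indices g"
  have summable: "rho_summable g V (\<lambda>k. r k * c k y j) ?I" if "y \<in> set (points g m xs)" for y j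
    by (rule rho_summable_indices[OF V(1)], rule rho_order_multI[OF r c]) (use that in auto)
  have t: "formal_sum (\<lambda>k. r k * (c k y j * u)) ?I = dot g r (\<lambda>k. c k y j) * u"
    "rho_summable g V (\<lambda>k. r k * (c k y j * u)) ?I"
    if "y \<in> set (points g m xs)" "rho_order g V 0 u" for y j u
    using formal_sum_mult_right[OF summable[OF that(1), of j] that(2)]
      rho_summable_mult_left[OF summable[OF that(1), of j] that(2)]
    by (simp_all add: dot_def ac_simps)
  have u: "rho_order g V 0 (fconst a * corr xs)" for a
    by (rule rho_order_multI[OF rho_order_fconst rho_order_corr[OF xs XV ZV]]) auto
  have mem: "i \<in> set xs \<Longrightarrow> X i \<in> set (points g m xs)" "j \<in> {1..m} \<Longrightarrow> Z j \<in> set (points g m xs)"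
    "b \<in> handles g \<Longrightarrow> W b \<in> set (points g m xs)" for i j b by (simp_all add: set_points)
  note s1 = formal_sum_sum[of "set xs" V g "\<lambda>i k. r k * (c k (X i) 1 * corr (remove1 i xs))" ?I,
      OF finite_set V(1) t(2)[OF mem(1) rho_order_corr_remove1]]
  note s2 = formal_sum_sum[of "{1..m}" V g "\<lambda>j k. r k * (c k (Z j) 0 * (fconst (\<gamma> j) * corr xs))" ?I,
      OF finite_atLeastAtMost V(1) t(2)[OF mem(2) u]]
  note s3 = formal_sum_sum[of "handles g" V g "\<lambda>b k. r k * (c k (W b) 0 * (fconst (q (W b)) * corr xs))" ?I,
      OF finite_handles V(1) t(2)[OF mem(3) u]]
  have "dot g r (\<lambda>k. source (c k)) = formal_sum (\<lambda>k.
      (\<Sum>i\<in>set xs. r k * (c k (X i) 1 * corr (remove1 i xs))) +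
      (\<Sum>j=1..m. r k * (c k (Z j) 0 * (fconst (\<gamma> j) * corr xs))) +
      (\<Sum>b\<in>handles g. r k * (c k (W b) 0 * (fconst (q (W b)) * corr xs)))) ?I"
    unfolding dot_def source_def by (simp only: distrib_left sum_distrib_left)
  also have "\<dots> = (\<Sum>i\<in>set xs. formal_sum (\<lambda>k. r k * (c k (X i) 1 * corr (remove1 i xs))) ?I) +
      (\<Sum>j=1..m. formal_sum (\<lambda>k. r k * (c k (Z j) 0 * (fconst (\<gamma> j) * corr xs))) ?I) +
      (\<Sum>b\<in>handles g. formal_sum (\<lambda>k. r k * (c k (W b) 0 * (fconst (q (W b)) * corr xs))) ?I)"
    by (simp only: conjunct1[OF s1] conjunct1[OF s2] conjunct1[OF s3] formal_sum_add[OF rho_summable_add[OF conjunct2[OF s1] conjunct2[OF s2]] conjunct2[OF s3]]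
        formal_sum_add[OF conjunct2[OF s1] conjunct2[OF s2]])
  also have "\<dots> = source (\<lambda>y j. dot g r (\<lambda>k. c k y j))"
    unfolding source_def
    by (intro arg_cong2[where f = "(+)"] sum.cong refl t(1) mem u rho_order_corr_remove1)
  finally show ?thesis .
qed

text \<open>
  The leftmost Heisenberg field is \<open>h(-1)\<close> acting on the vacuum inserted at \<open>x\<close>, so it is removed
  in the same way as the creation modes at the handles.
\<close>

lemma corr_Cons:
  assumes x: "sorted_wrt (<) (x # xs)" and xV: "X x \<in> V"
  shows "corr (x # xs) =
    (\<Sum>y\<in>set (points g m xs). formal_sum (\<lambda>j. pi1_deriv 0 j (X x) y * corr_mode xs y (int j)) UNIV)"
proof -
  let ?ys = "points g m (x # xs)" and ?s = "\<lambda>b. (state B b)(X x := 1)"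
  have ys: "?ys = X x # points g m xs" by (simp add: points_def)
  have sorted: "sorted_wrt (<) ?ys" by (rule sorted_points[OF x])
  have ysV: "set ?ys \<subseteq> V" using points_V[OF XV ZV] xV by (simp add: ys)
  have notin: "X x \<notin> set (points g m xs)" using sorted_wrt_less_distinct[OF sorted] by (simp add: ys)
  have q: "q (X x) = 0" by (simp add: charge_def)
  have "act q (X x) (- int (Suc 0)) (?s b) = state B b" for b
    by (rule ext) (simp add: act_def q heis_creates_h_state state_def)
  then have "corr (x # xs) = sewn ?ys (\<lambda>b. act q (X x) (- int (Suc 0)) (?s b))"
    by (simp only: corr_def)
  also have "\<dots> = (\<Sum>y\<in>set ?ys. formal_sum (\<lambda>j. probe 0 (X x) y j * sewn ?ys (\<lambda>b. act q y (int j) (?s b))) UNIV)"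
  proof (rule sewn_creation_mode(1)[OF sorted ysV var_class_points])
    show "heis (q t) (int j) (?s b t) = 0"
      if "b \<in> basis_choices" "t \<in> set ?ys" "j \<ge> total_degree g b + 2" for b t j
      using heis_state_bound[OF that] by (simp add: q heis_vacuum)
    show "X x \<in> set ?ys" by (simp add: ys)
  qed (simp_all only: sum_list_charge_points charge_0)
  also have "\<dots> = (\<Sum>y\<in>set (points g m xs). formal_sum (\<lambda>j. probe 0 (X x) y j * sewn ?ys (\<lambda>b. act q y (int j) (?s b))) UNIV)"
  proof -
    have "sewn ?ys (\<lambda>b. act q (X x) (int j) (?s b)) = 0" for j
    proof -
      have "correlator \<Y> q ?ys (act q (X x) (int j) (?s b)) = 0" for b
        by (rule correlator_eq_0[OF Y sorted, of "X x"]) (simp_all add: ys act_def q heis_vacuum)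
      then show ?thesis by (simp add: sewn_def formal_sum_0)
    qed
    then show ?thesis unfolding ys list.set
      by (subst sum.insert) (use notin in \<open>simp_all add: ys[symmetric] formal_sum_0\<close>)
  qed
  also have "\<dots> = (\<Sum>y\<in>set (points g m xs). formal_sum (\<lambda>j. pi1_deriv 0 j (X x) y * corr_mode xs y (int j)) UNIV)"
  proof (intro sum.cong refl formal_sum_cong arg_cong2[where f = "(*)"])
    fix y j assume y: "y \<in> set (points g m xs)"
    then have ne: "y \<noteq> X x" using notin by auto
    show "probe 0 (X x) y j = pi1_deriv 0 j (X x) y" using ne by (simp add: probe_def)
    show "sewn ?ys (\<lambda>b. act q y (int j) (?s b)) = corr_mode xs y (int j)"
      unfolding corr_mode_def
    proof (rule sewn_cong)
      fix b
      have "correlator \<Y> q ([] @ X x # points g m xs) (act q y (int j) (?s b)) =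
          correlator \<Y> q ([] @ points g m xs) (act q y (int j) (?s b))"
        by (rule correlator_vacuum[OF Y]) (use sorted ne in \<open>simp_all add: ys act_def q\<close>)
      also have "\<dots> = correlator \<Y> q (points g m xs) (act q y (int j) (state B b))"
        unfolding append_Nil by (rule correlator_cong) (use notin ne in \<open>auto simp: act_def\<close>)
      finally show "correlator \<Y> q ?ys (act q y (int j) (?s b)) = correlator \<Y> q (points g m xs) (act q y (int j) (state B b))"
        by (simp add: ys)
    qed
  qed
  finally show ?thesis .
qed

text \<open>
  The solution of the system is inserted into the expression for the leftmost field. It depends
  linearly on the source terms, so the kernel of each of them is corrected by the same row.
\<close>

lemma corr_Cons_geometric:
  assumes x: "sorted_wrt (<) (x # xs)" and xV: "X x \<in> V" "DX x \<in> V"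
  shows "corr (x # xs) * vpow (DX x) 1 =
    source (\<lambda>y j. pi1_deriv 0 j (X x) y * vpow (DX x) 1 + dot g (geometric_row g x) (\<lambda>k. handle_column k y j))"
proof -
  let ?p = "\<lambda>y j. pi1_deriv 0 j (X x) y" and ?D = "vpow (DX x) 1"
  let ?F = "\<lambda>(c, n). ?p (W c) (Suc n) * corr_mode xs (W c) (int (Suc n))"
  have D: "rho_order g V 0 ?D" by (rule rho_order_vpow_DX[OF xV(2)])
  have ne: "y \<noteq> X x" if "y \<in> set (points g m xs)" for y
    using x that by (auto simp: set_points)
  have p: "rho_order g V 0 (?p y j)" if "y \<in> set (points g m xs)" for y j
    using ne[OF that] var_class_points[OF that] xV(1) V_A0 that points_V[OF XV ZV]
    by (intro rho_order_pi1_deriv) auto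
  note sums = sum_modes[of ?p, OF p]
  note row = rho_order_geometric_row[OF V xV]
  have "corr (x # xs) * ?D = source ?p * ?D + formal_sum ?F (indices g) * ?D"
    by (simp only: corr_Cons[OF x xV(1)] sums(1) distrib_right)
  also have "source ?p * ?D = source (\<lambda>y j. ?p y j * ?D)"
    using source_mult[of ?D ?p] by (simp add: mult.commute)
  also have "formal_sum ?F (indices g) * ?D = formal_sum (\<lambda>k. ?F k * ?D) (indices g)"
    by (rule formal_sum_mult_right[OF sums(2) D, symmetric])
  also have "\<dots> = dot g (L_tilde g x) handle_mode"
    unfolding dot_def
  proof (rule formal_sum_cong)
    fix k assume "k \<in> indices g"
    then obtain b n where k: "k = (b, n)" "b \<in> handles g" by (auto simp: indices_handles)
    show "?F k * ?D = L_tilde g x k * handle_mode k"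
      unfolding k(1) prod.case L_tilde_eq[OF k(2)] corr_mode_handle[OF k(2)]
      by (simp add: L_row_def ac_simps)
  qed
  also have "dot g (L_tilde g x) handle_mode = dot g (geometric_row g x) (\<lambda>k. source (handle_column k))"
    unfolding geometric_row_def
    by (rule neumann_dot[OF V(1) rho_order_A_tilde[OF V xV] rho_order_L_tilde[OF V xV] rho_order_handle_mode
          rho_order_source[OF rho_order_handle_column] handle_mode_system, symmetric])
  also have "\<dots> = source (\<lambda>y j. dot g (geometric_row g x) (\<lambda>k. handle_column k y j))"
    by (rule source_dot[OF row rho_order_handle_column])
  finally show ?thesis by (simp only: source_add)
qed

end

end

section \<open>The differential forms\<close>

lemma T_form_eq:
  "pi1_deriv 0 0 (X x) (W c) * vpow (DX x) 1 + dot g (geometric_row g x) (\<lambda>k. handle_column k (W c) 0) = T_form g x c"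
proof -
  have "handle_column k (W c) 0 = A_mat k (c, 0)" for k
    by (cases k) (auto simp: handle_column_def A_mat_def probe_def rho_pow_def)
  then show ?thesis
    by (simp add: T_form_def L_row_def rho_pow_def row_mult_def[of g "row_mult g (L_tilde g x) (mat_geometric g (A_tilde g))"]
        dot_def geometric_row_def)
qed

lemma Psi1_eq:
  "pi1_deriv 0 0 (X x) (Z j) * vpow (DX x) 1 + dot g (geometric_row g x) (\<lambda>k. handle_column k (Z j) 0) = Psi1 g x (Z j)"
proof -
  have "handle_column k (Z j) 0 = R_col (Z j) k" for k
    by (cases k) (auto simp: handle_column_def R_col_def probe_def)
  then show ?thesis by (simp add: Psi1_def geometric_row_def pi1_deriv_def)
qed

text \<open>
  In \<open>\<Psi>\<^sub>1(x, y)\<close> only the kernel and the column \<open>R(y)\<close> depend on \<open>y = x\<^sub>i\<close>, and the infinite sum may be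
  differentiated term by term.
\<close>

lemma omega_eq:
  assumes "i \<noteq> x"
  shows "(pi1_deriv 0 1 (X x) (X i) * vpow (DX x) 1 + dot g (geometric_row g x) (\<lambda>k. handle_column k (X i) 1)) * vpow (DX i) 1 =
    omega g x i"
proof -
  define V where "V = insert (X x) (insert (DX x) (surface_vars g))"
  have V: "finite V" "surface_vars g \<subseteq> V" "X x \<in> V" "DX x \<in> V" by (auto simp: V_def finite_surface_vars)
  let ?V = "insert (X i) V" and ?row = "geometric_row g x"
  have notin: "X i \<notin> V" using assms by (auto simp: V_def surface_vars_def)
  have row: "rho_order g V 0 (?row k)" if "k \<in> indices g" for k
    by (rule rho_order_geometric_row[OF V that])
  have R: "rho_order g ?V (index_order k) (R_col (X i) k)" if "k \<in> indices g" for k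
  proof -
    obtain a p where k: "k = (a, p)" "a \<in> handles g" using \<open>k \<in> indices g\<close> by (auto simp: indices_handles)
    have W: "W (- a) \<in> ?V" using k(2) by (auto simp: V_def surface_vars_def)
    have "rho_order g ?V (of_nat (Suc p) / 2 + 0) (rho_pow a (of_nat (Suc p) / 2) * pi1_deriv p 0 (W (- a)) (X i))"
      by (intro rho_order_mult rho_order_rho_pow rho_order_pi1_deriv)
         (use V W k(2) in \<open>auto simp: V_def surface_vars_def\<close>)
    then show ?thesis by (simp add: k(1) R_col_def index_order_def add.commute)
  qed
  have summable: "rho_summable g ?V (\<lambda>k. ?row k * R_col (X i) k) (indices g)"
    by (rule rho_summable_indices, simp add: V, rule rho_order_multI[OF rho_order_mono[OF row] R]) auto
  have "pd (X i) (?row k * R_col (X i) k) = ?row k * handle_column k (X i) 1" if k: "k \<in> indices g" for k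
  proof -
    obtain a p where ap: "k = (a, p)" by (cases k)
    have "pd (X i) (rho_pow a ((of_nat p + 1) / 2) * pi1_deriv p 0 (W (- a)) (X i)) =
        rho_pow a ((of_nat p + 1) / 2) * pi1_deriv p 1 (W (- a)) (X i)"
      by (rule pi1_deriv_pd) (auto simp: rho_pow_def fcoeff_vpow lookup_single split: if_splits)
    then have "pd (X i) (R_col (X i) k) = handle_column k (X i) 1"
      by (simp add: ap R_col_def handle_column_def probe_def pd_uminus)
    moreover have "lookup e (X i) = 0" if "fcoeff (?row k) e \<noteq> 0" for e
      by (rule lookup_eq_0_if_var[OF rho_orderD(1)[OF row[OF k] that] notin])
    ultimately show ?thesis by (simp add: pd_mult_left)
  qed
  then have "pd (X i) (dot g ?row (R_col (X i))) = dot g ?row (\<lambda>k. handle_column k (X i) 1)"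
    unfolding dot_def
    by (subst pd_formal_sum[OF summable]) (auto intro: formal_sum_cong)
  moreover have "pd (X i) (pi1 (X x) (X i) * vpow (DX x) 1) = pi1_deriv 0 1 (X x) (X i) * vpow (DX x) 1"
  proof -
    have "pd (X i) (vpow (DX x) 1 * pi1 (X x) (X i)) = vpow (DX x) 1 * pd (X i) (pi1 (X x) (X i))"
      by (rule pd_mult_left) (auto simp: fcoeff_vpow lookup_single split: if_splits)
    then show ?thesis by (simp add: pi1_deriv_def mult.commute)
  qed
  ultimately show ?thesis
    by (simp only: omega_def Psi1_def pd_add geometric_row_def)
qed

lemma sum_handles:
  fixes f :: "int \<Rightarrow> 'a::ab_group_add"
  shows "(\<Sum>c\<in>handles g. f c) = (\<Sum>a=1..g. f (int a) + f (- int a))"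
proof -
  have "c \<in> int ` {1..g} \<union> (\<lambda>a. - int a) ` {1..g}" if "c \<in> handles g" for c
  proof (cases "c > 0")
    case True
    then show ?thesis using that by (intro UnI1 image_eqI[of _ _ "nat c"]) auto
  next
    case False
    then show ?thesis using that by (intro UnI2 image_eqI[of _ _ "nat (- c)"]) auto
  qed
  then have "handles g = int ` {1..g} \<union> (\<lambda>a. - int a) ` {1..g}" by auto
  also have "sum f \<dots> = sum f (int ` {1..g}) + sum f ((\<lambda>a. - int a) ` {1..g})"
    by (rule sum.union_disjoint) auto
  finally show ?thesis by (simp add: sum.reindex inj_on_def sum.distrib)
qed

context heisenberg_sewing
begin

definition diff_corr :: "nat list \<Rightarrow> var fseries" where
  "diff_corr xs = corr xs * (\<Prod>s\<in>set xs. vpow (DX s) 1)"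

text \<open>
  The corrected kernels are \<open>\<omega>\<close>, \<open>\<Psi>\<^sub>1\<close> and \<open>T\<^sub>a\<close>. The two ends of a handle have opposite charges, which
  gives \<open>T\<^sub>a - T\<^sub>-\<^sub>a = \<nu>\<^sub>a\<close>; the base point \<open>Z k\<close> enters with the total charge, which is zero.
\<close>

lemma diff_corr_Cons:
  assumes x: "sorted_wrt (<) (x # xs)"
    and XV: "X ` set (x # xs) \<subseteq> V" and DV: "DX x \<in> V" and ZV: "Z ` {1..m} \<subseteq> V"
  shows "diff_corr (x # xs) = nu_total g \<alpha> m \<gamma> (Z k) x * diff_corr xs +
    (\<Sum>i\<in>set xs. omega g x i * diff_corr (remove1 i xs))"
proof -
  have xs: "sorted_wrt (<) xs" and XV': "X ` set xs \<subseteq> V" and xV: "X x \<in> V" using x XV by auto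
  have dist: "distinct (x # xs)" using x strict_sorted_iff by blast
  define P where "P y j = pi1_deriv 0 j (X x) y * vpow (DX x) 1 + dot g (geometric_row g x) (\<lambda>k. handle_column k y j)" for y j
  let ?D = "\<Prod>s\<in>set xs. vpow (DX s) 1" and ?\<nu> = "nu_total g \<alpha> m \<gamma> (Z k) x"
  have "diff_corr (x # xs) = corr (x # xs) * vpow (DX x) 1 * ?D"
    using dist by (simp add: diff_corr_def mult.assoc)
  also have "corr (x # xs) * vpow (DX x) 1 = source xs P"
    unfolding P_def by (rule corr_Cons_geometric[OF xs XV' ZV x xV DV])
  also have "source xs P = (\<Sum>i\<in>set xs. P (X i) 1 * corr (remove1 i xs)) + ?\<nu> * corr xs"
  proof -
    have "(\<Sum>j=1..m. P (Z j) 0 * (fconst (\<gamma> j) * corr xs)) =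
        (\<Sum>j=1..m. fconst (\<gamma> j) * Psi1 g x (Z j)) * corr xs"
      unfolding P_def Psi1_eq sum_distrib_right by (simp add: ac_simps)
    also have "(\<Sum>j=1..m. fconst (\<gamma> j) * Psi1 g x (Z j)) = (\<Sum>j=1..m. fconst (\<gamma> j) * omega_diff g x (Z j) (Z k))"
    proof -
      have "(\<Sum>j=1..m. fconst (\<gamma> j) * Psi1 g x (Z k)) = fconst (\<Sum>j=1..m. \<gamma> j) * Psi1 g x (Z k)"
        by (simp only: fconst_sum sum_distrib_right)
      also have "\<dots> = 0" by (simp only: charge_0 fconst_0 mult_zero_left)
      finally show ?thesis by (simp only: omega_diff_def right_diff_distrib sum_subtractf diff_zero)
    qed
    finally have 1: "(\<Sum>j=1..m. P (Z j) 0 * (fconst (\<gamma> j) * corr xs)) =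
        (\<Sum>j=1..m. fconst (\<gamma> j) * omega_diff g x (Z j) (Z k)) * corr xs" .
    have "(\<Sum>c\<in>handles g. P (W c) 0 * (fconst (q (W c)) * corr xs)) =
        (\<Sum>c\<in>handles g. fconst (q (W c)) * T_form g x c) * corr xs"
      unfolding P_def T_form_eq sum_distrib_right by (simp add: ac_simps)
    also have "(\<Sum>c\<in>handles g. fconst (q (W c)) * T_form g x c) = (\<Sum>a=1..g. fconst (\<alpha> a) * nu g x a)"
      unfolding sum_handles
      by (rule sum.cong) (auto simp: charge_def nu_def fconst_uminus right_diff_distrib)
    finally have 2: "(\<Sum>c\<in>handles g. P (W c) 0 * (fconst (q (W c)) * corr xs)) =
        (\<Sum>a=1..g. fconst (\<alpha> a) * nu g x a) * corr xs" .
    show ?thesis unfolding source_def[OF xs XV' ZV] 1 2 nu_total_def by (simp add: distrib_right add.assoc add.commute)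
  qed
  also have "(\<dots>) * ?D = ?\<nu> * diff_corr xs + (\<Sum>i\<in>set xs. P (X i) 1 * corr (remove1 i xs) * ?D)"
    by (simp add: diff_corr_def distrib_right sum_distrib_right mult.assoc)
  also have "(\<Sum>i\<in>set xs. P (X i) 1 * corr (remove1 i xs) * ?D) = (\<Sum>i\<in>set xs. omega g x i * diff_corr (remove1 i xs))"
  proof (rule sum.cong[OF refl])
    fix i assume i: "i \<in> set xs"
    then have "i \<noteq> x" using dist by auto
    from omega_eq[OF this, of g] have om: "P (X i) 1 * vpow (DX i) 1 = omega g x i" by (simp add: P_def)
    have "set (remove1 i xs) = set xs - {i}" using dist by simp
    then have "?D = vpow (DX i) 1 * (\<Prod>s\<in>set (remove1 i xs). vpow (DX s) 1)"
      using i by (simp add: prod.remove)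
    then have "P (X i) 1 * corr (remove1 i xs) * ?D = (P (X i) 1 * vpow (DX i) 1) * diff_corr (remove1 i xs)"
      by (simp add: diff_corr_def ac_simps)
    then show "P (X i) 1 * corr (remove1 i xs) * ?D = omega g x i * diff_corr (remove1 i xs)" by (simp only: om)
  qed
  finally show ?thesis .
qed

end

section \<open>Sums over involutions\<close>

text \<open>Over arbitrary finite sets of labels, since the recursion removes labels.\<close>

definition Sym_on :: "nat set \<Rightarrow> (nat \<Rightarrow> nat \<Rightarrow> var fseries) \<Rightarrow> (nat \<Rightarrow> var fseries) \<Rightarrow> var fseries" where
  "Sym_on S \<omega> \<nu> = (\<Sum>\<phi> | \<phi> permutes S \<and> \<phi> \<circ> \<phi> = id.
     (\<Prod>q | q \<in> S \<and> \<phi> q = q. \<nu> q) * (\<Prod>r | r \<in> S \<and> r < \<phi> r. \<omega> r (\<phi> r)))"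

lemma involution_permutes_iff:
  "\<phi> permutes S \<and> \<phi> \<circ> \<phi> = id \<longleftrightarrow> (\<forall>z. \<phi> (\<phi> z) = z) \<and> (\<forall>z. z \<notin> S \<longrightarrow> \<phi> z = z)"
proof
  assume "(\<forall>z. \<phi> (\<phi> z) = z) \<and> (\<forall>z. z \<notin> S \<longrightarrow> \<phi> z = z)"
  then show "\<phi> permutes S \<and> \<phi> \<circ> \<phi> = id" unfolding permutes_def by (auto simp: fun_eq_iff) metis
qed (auto simp: permutes_def fun_eq_iff)

lemma Sym_on_empty: "Sym_on {} \<omega> \<nu> = 1"
proof -
  have "{\<phi> :: nat \<Rightarrow> nat. \<phi> permutes {} \<and> \<phi> \<circ> \<phi> = id} = {id}" by (auto simp: permutes_empty)
  then show ?thesis unfolding Sym_on_def by (simp only:) simp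
qed

text \<open>An involution either fixes the least label or exchanges it with another one.\<close>

lemma Sym_on_insert:
  assumes S: "finite S" and less: "\<And>s. s \<in> S \<Longrightarrow> x < s"
  shows "Sym_on (insert x S) \<omega> \<nu> = \<nu> x * Sym_on S \<omega> \<nu> + (\<Sum>s\<in>S. \<omega> x s * Sym_on (S - {s}) \<omega> \<nu>)"
proof -
  define inv where "inv A = {\<phi>. \<phi> permutes A \<and> \<phi> \<circ> \<phi> = (id :: nat \<Rightarrow> nat)}" for A
  define F where "F A \<phi> = (\<Prod>q | q \<in> A \<and> \<phi> q = q. \<nu> q) * (\<Prod>r | r \<in> A \<and> r < \<phi> r. \<omega> r (\<phi> r))"
    for A and \<phi> :: "nat \<Rightarrow> nat"
  have inv: "\<phi> \<in> inv A \<longleftrightarrow> (\<forall>z. \<phi> (\<phi> z) = z) \<and> (\<forall>z. z \<notin> A \<longrightarrow> \<phi> z = z)" for \<phi> A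
    unfolding inv_def using involution_permutes_iff by simp
  have Sym: "Sym_on A \<omega> \<nu> = sum (F A) (inv A)" for A by (simp add: Sym_on_def F_def inv_def)
  have x: "x \<notin> S" using less by auto
  have fin: "finite (inv (insert x S))" unfolding inv_def using finite_permutations[of "insert x S"] S by simp
  have img: "(\<lambda>\<phi>. \<phi> x) ` inv (insert x S) \<subseteq> insert x S"
  proof (rule image_subsetI)
    fix \<phi> assume "\<phi> \<in> inv (insert x S)"
    then have "\<phi> permutes insert x S" by (simp add: inv_def)
    from permutes_in_image[OF this, of x] show "\<phi> x \<in> insert x S" by simp
  qed
  have transposed: "(\<Sum>\<phi> | \<phi> \<in> inv (insert x S) \<and> \<phi> x = s. F (insert x S) \<phi>) = \<omega> x s * Sym_on (S - {s}) \<omega> \<nu>"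
    if s: "s \<in> S" for s
  proof -
    have xs: "x \<noteq> s" "x < s" using less[OF s] by auto
    have F: "F (insert x S) (\<psi>(x := s, s := x)) = \<omega> x s * F (S - {s}) \<psi>" if \<psi>: "\<psi> \<in> inv (S - {s})" for \<psi>
    proof -
      let ?\<phi> = "\<psi>(x := s, s := x)"
      have "{q. q \<in> insert x S \<and> ?\<phi> q = q} = {q. q \<in> S - {s} \<and> \<psi> q = q}"
        using xs x by auto
      moreover have "{r. r \<in> insert x S \<and> r < ?\<phi> r} = insert x {r. r \<in> S - {s} \<and> r < \<psi> r}"
        using xs x by auto
      moreover have "(\<Prod>r | r \<in> S - {s} \<and> r < \<psi> r. \<omega> r (?\<phi> r)) = (\<Prod>r | r \<in> S - {s} \<and> r < \<psi> r. \<omega> r (\<psi> r))"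
        by (rule prod.cong) (use x in auto)
      ultimately show ?thesis using S x xs by (simp add: F_def)
    qed
    have "(\<Sum>\<phi> | \<phi> \<in> inv (insert x S) \<and> \<phi> x = s. F (insert x S) \<phi>) = (\<Sum>\<psi>\<in>inv (S - {s}). \<omega> x s * F (S - {s}) \<psi>)"
    proof (rule sum.reindex_bij_witness[of _ "\<lambda>\<psi>. \<psi>(x := s, s := x)" "\<lambda>\<phi>. \<phi>(x := x, s := s)"])
      fix \<phi> assume "\<phi> \<in> {\<phi> \<in> inv (insert x S). \<phi> x = s}"
      then have \<phi>: "\<And>z. \<phi> (\<phi> z) = z" "\<And>z. z \<notin> insert x S \<Longrightarrow> \<phi> z = z" "\<phi> x = s" by (auto simp: inv)
      then have \<phi>s: "\<phi> s = x" by metis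
      have ne: "\<phi> z \<noteq> x" "\<phi> z \<noteq> s" if "z \<noteq> x" "z \<noteq> s" for z using \<phi>(1,3) \<phi>s that by metis+
      show restore: "\<phi>(x := x, s := s, x := s, s := x) = \<phi>" using \<phi>(3) \<phi>s by auto
      show mem: "\<phi>(x := x, s := s) \<in> inv (S - {s})" using \<phi>(1,2) ne by (auto simp: inv)
      show "\<omega> x s * F (S - {s}) (\<phi>(x := x, s := s)) = F (insert x S) \<phi>"
        using F[OF mem] unfolding restore by simp
    next
      fix \<psi> assume "\<psi> \<in> inv (S - {s})"
      then have \<psi>: "\<And>z. \<psi> (\<psi> z) = z" "\<And>z. z \<notin> S - {s} \<Longrightarrow> \<psi> z = z" by (auto simp: inv)
      have fix_xs: "\<psi> x = x" "\<psi> s = s" using \<psi>(2) x by auto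
      have ne: "\<psi> z \<noteq> x" "\<psi> z \<noteq> s" if "z \<noteq> x" "z \<noteq> s" for z using \<psi>(1) fix_xs that by metis+
      show "\<psi>(x := s, s := x, x := x, s := s) = \<psi>" using fix_xs by auto
      show "\<psi>(x := s, s := x) \<in> {\<phi> \<in> inv (insert x S). \<phi> x = s}"
        using \<psi> ne xs s by (auto simp: inv)
    qed
    then show ?thesis by (simp add: Sym sum_distrib_left)
  qed
  have "Sym_on (insert x S) \<omega> \<nu> =
      (\<Sum>y\<in>insert x S. \<Sum>\<phi> | \<phi> \<in> inv (insert x S) \<and> \<phi> x = y. F (insert x S) \<phi>)"
    unfolding Sym by (rule sum.group[symmetric]) (use fin img S in auto)
  also have "\<dots> = (\<Sum>\<phi> | \<phi> \<in> inv (insert x S) \<and> \<phi> x = x. F (insert x S) \<phi>) +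
      (\<Sum>s\<in>S. \<Sum>\<phi> | \<phi> \<in> inv (insert x S) \<and> \<phi> x = s. F (insert x S) \<phi>)"
    using S x by simp
  also have "(\<Sum>\<phi> | \<phi> \<in> inv (insert x S) \<and> \<phi> x = x. F (insert x S) \<phi>) = \<nu> x * Sym_on S \<omega> \<nu>"
    unfolding Sym sum_distrib_left
  proof (rule sum.cong)
    show "{\<phi> \<in> inv (insert x S). \<phi> x = x} = inv S" using x by (auto simp: inv)
    fix \<phi> assume "\<phi> \<in> inv S"
    then have "\<phi> x = x" using x by (simp add: inv)
    then have "{q. q \<in> insert x S \<and> \<phi> q = q} = insert x {q. q \<in> S \<and> \<phi> q = q}"
      "{r. r \<in> insert x S \<and> r < \<phi> r} = {r. r \<in> S \<and> r < \<phi> r}" by auto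
    then show "F (insert x S) \<phi> = \<nu> x * F S \<phi>" using S x by (simp add: F_def mult.assoc)
  qed
  also have "(\<Sum>s\<in>S. \<Sum>\<phi> | \<phi> \<in> inv (insert x S) \<and> \<phi> x = s. F (insert x S) \<phi>) =
      (\<Sum>s\<in>S. \<omega> x s * Sym_on (S - {s}) \<omega> \<nu>)"
    by (rule sum.cong[OF refl transposed])
  finally show ?thesis .
qed

lemma (in heisenberg_sewing) diff_corr_Sym:
  assumes "finite S" "X ` S \<subseteq> V" "DX ` S \<subseteq> V" "Z ` {1..m} \<subseteq> V"
  shows "diff_corr (sorted_list_of_set S) = Sym_on S (omega g) (nu_total g \<alpha> m \<gamma> (Z k)) * diff_corr []"
  using assms(1-3)
proof (induction "card S" arbitrary: S rule: less_induct)
  case less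
  let ?Sym = "\<lambda>S. Sym_on S (omega g) (nu_total g \<alpha> m \<gamma> (Z k))"
  show ?case
  proof (cases "S = {}")
    case True
    then show ?thesis by (simp add: Sym_on_empty)
  next
    case False
    define x S' where "x = Min S" and "S' = S - {x}"
    have S: "S = insert x S'" "x \<notin> S'" "finite S'" using False less.prems(1) Min_in by (auto simp: x_def S'_def)
    have less_x: "x < s" if "s \<in> S'" for s
      using that Min_le[OF less.prems(1), of s] S(2) by (auto simp: x_def S'_def order.strict_iff_order)
    have list: "sorted_list_of_set S = x # sorted_list_of_set S'"
      using sorted_list_of_set_nonempty[OF less.prems(1) False] by (simp add: x_def S'_def)
    have card: "card S' < card S" using S by simp
    have "diff_corr (sorted_list_of_set S) = nu_total g \<alpha> m \<gamma> (Z k) x * diff_corr (sorted_list_of_set S') +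
        (\<Sum>i\<in>set (sorted_list_of_set S'). omega g x i * diff_corr (remove1 i (sorted_list_of_set S')))"
      unfolding list
    proof (rule diff_corr_Cons)
      show "sorted_wrt (<) (x # sorted_list_of_set S')"
        using strict_sorted_list_of_set[of S] by (simp add: list)
    qed (use less.prems S assms(4) in auto)
    also have "\<dots> = nu_total g \<alpha> m \<gamma> (Z k) x * (?Sym S' * diff_corr []) +
        (\<Sum>i\<in>S'. omega g x i * (?Sym (S' - {i}) * diff_corr []))"
    proof (intro arg_cong2[where f = "(+)"] arg_cong2[where f = "(*)"] sum.cong refl)
      show "diff_corr (sorted_list_of_set S') = ?Sym S' * diff_corr []"
        by (rule less.hyps[OF card]) (use less.prems S in auto)
      show "set (sorted_list_of_set S') = S'" using S(3) by simp
      fix i assume "i \<in> S'"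
      have "diff_corr (sorted_list_of_set (S' - {i})) = ?Sym (S' - {i}) * diff_corr []"
        by (rule less.hyps) (use less.prems S card card_mono[of S' "S' - {i}"] in \<open>auto simp del: card_Diff_insert\<close>)
      then show "diff_corr (remove1 i (sorted_list_of_set S')) = ?Sym (S' - {i}) * diff_corr []"
        using sorted_list_of_set_remove[OF S(3), of i] by simp
    qed
    also have "\<dots> = ?Sym S * diff_corr []"
    proof -
      have "?Sym S = nu_total g \<alpha> m \<gamma> (Z k) x * ?Sym S' + (\<Sum>i\<in>S'. omega g x i * ?Sym (S' - {i}))"
        by (subst S(1), rule Sym_on_insert[OF S(3) less_x])
      then show ?thesis by (simp only: distrib_right sum_distrib_right mult.assoc)
    qed
    finally show ?thesis .
  qed
qed

section \<open>The correlation form\<close>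

lemma prod_vpow_monomial:
  "\<exists>s. \<forall>e. fcoeff (\<Prod>a\<in>A. vpow (v a) (c a)) e = (if e = s then 1 else 0)"
proof (induction A rule: infinite_finite_induct)
  case (insert a A)
  then obtain s where s: "\<And>e. fcoeff (\<Prod>a\<in>A. vpow (v a) (c a)) e = (if e = s then 1 else 0)" by blast
  show ?case
    by (rule exI[of _ "s + single (v a) (c a)"])
       (use insert(1,2) in \<open>simp add: fcoeff_vpow_mult s diff_eq_eq\<close>)
qed (auto simp: fcoeff_1 intro!: exI[of _ 0])

text \<open>Multiplication by a monomial permutes the coefficients, whatever its exponents are.\<close>

lemma formal_sum_monomial:
  assumes "rho_summable g V F I" and p: "\<And>e. fcoeff p e = (if e = s then 1 else 0)"
  shows "formal_sum (\<lambda>i. F i * p) I = formal_sum F I * p"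
proof -
  have shift: "fcoeff (f * p) e = fcoeff f (e - s)" for f e
    using fcoeff_monomial_mult[of p, OF p, of f e] by (simp add: mult.commute)
  have "formal_sum (\<lambda>i. F i * p) I = series (fcoeff (formal_sum F I * p))"
    unfolding formal_sum_def[of "\<lambda>i. F i * p"]
    by (rule arg_cong[where f = series], rule ext) (simp add: shift fcoeff_formal_sum[OF assms(1)])
  then show ?thesis by (simp add: fcoeff_inverse)
qed

lemma (in heisenberg_sewing) correlation_form_eq:
  assumes "X ` {1..n} \<subseteq> V" "Z ` {1..m} \<subseteq> V"
  shows "correlation_form \<Y> g \<alpha> B n m \<gamma> = diff_corr [1..<n + 1] *
    ((\<Prod>a=1..g. vpow (Rho a) ((\<alpha> a)\<^sup>2 / 2)) * (\<Prod>j=1..m. vpow (DZ j) ((\<gamma> j)\<^sup>2 / 2)))"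
proof -
  let ?xs = "[1..<n + 1]" and ?p = "\<Prod>a=1..g. vpow (Rho a) ((\<alpha> a)\<^sup>2 / 2)"
  have set: "set ?xs = {1..n}" by auto
  have xs: "sorted_wrt (<) ?xs" by (rule sorted_wrt_upt)
  have XV: "X ` set ?xs \<subseteq> V" using assms(1) by (simp only: set)
  have insertions: "map (\<lambda>i. (X i, 0, h_state)) ?xs @ map (\<lambda>j. (Z j, \<gamma> j, 1)) [1..<m + 1] @
      concat (map (\<lambda>a. [(W (int a), \<alpha> a, b a), (W (- int a), - \<alpha> a, dual_vector (B a) (b a))]) [1..<g + 1]) =
      map (\<lambda>y. (y, q y, state B b y)) (points g m ?xs)" for b
    unfolding points_def map_append map_map map_concat
    by (intro arg_cong2[where f = append] arg_cong[where f = concat] map_cong refl)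
       (auto simp: charge_def state_def)
  have weight: "(\<Prod>a=1..g. vpow (Rho a) (of_nat (fdegree (b a)) + (\<alpha> a)\<^sup>2 / 2)) = weight g b * ?p" for b
    by (simp add: weight_def vpow_add prod.distrib)
  obtain s where s: "\<And>e. fcoeff ?p e = (if e = s then 1 else 0)"
    using prod_vpow_monomial[of Rho "\<lambda>a. (\<alpha> a)\<^sup>2 / 2" "{1..g}"] by blast
  have "formal_sum (\<lambda>b. matrix_element \<Y> (map (\<lambda>y. (y, q y, state B b y)) (points g m ?xs)) * (weight g b * ?p)) basis_choices =
      formal_sum (\<lambda>b. correlator \<Y> q (points g m ?xs) (state B b) * weight g b * ?p) basis_choices"
    by (simp only: correlator_def mult.assoc)
  also have "\<dots> = corr ?xs * ?p"
    unfolding corr_def sewn_def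
    by (rule formal_sum_monomial[OF rho_summable_sewn[OF sorted_points[OF xs] points_V[OF XV assms(2)]] s])
       (use var_class_points in blast)
  finally show ?thesis
    unfolding correlation_form_def insertions weight diff_corr_def set
    by (simp only: ac_simps)
qed

theorem proposition7p1:
  fixes \<Y> :: "complex \<Rightarrow> complex \<Rightarrow> fock \<Rightarrow> complex \<Rightarrow> fock \<Rightarrow> fock"
    and g n m k :: nat
    and \<alpha> \<gamma> :: "nat \<Rightarrow> complex"
    and B :: "nat \<Rightarrow> fock set"
  assumes "heisenberg_intertwiners \<Y>"
    and "\<And>a. a \<in> {1..g} \<Longrightarrow> homogeneous_basis (B a)"
    and "(\<Sum>j=1..m. \<gamma> j) = 0"
  shows "correlation_form \<Y> g \<alpha> B n m \<gamma> =
         Sym n (omega g) (nu_total g \<alpha> m \<gamma> (Z k)) * correlation_form \<Y> g \<alpha> B 0 m \<gamma>"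
proof -
  define V where "V = surface_vars g \<union> X ` {1..n} \<union> DX ` {1..n} \<union> Z ` {1..m}"
  have "finite V" "surface_vars g \<subseteq> V" by (auto simp: V_def finite_surface_vars)
  then interpret heisenberg_sewing \<Y> g m \<alpha> \<gamma> B V using assms by unfold_locales auto
  have V: "X ` {1..n} \<subseteq> V" "X ` {1..0} \<subseteq> V" "DX ` {1..n} \<subseteq> V" "Z ` {1..m} \<subseteq> V" by (auto simp: V_def)
  have "sorted_list_of_set {1..n} = [1..<n + 1]"
    using sorted_list_of_set_range[of 1 "n + 1"] by (simp add: atLeastLessThanSuc_atLeastAtMost)
  then have "diff_corr [1..<n + 1] = Sym n (omega g) (nu_total g \<alpha> m \<gamma> (Z k)) * diff_corr []"
    using diff_corr_Sym[of "{1..n}" k] V by (simp add: Sym_def Sym_on_def)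
  then show ?thesis
    unfolding correlation_form_eq[OF V(1,4)] correlation_form_eq[OF V(2,4)] by (simp add: mult.assoc)
qed

end
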